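(* The variety of complex $3$-dimensional right alternative algebras has dimension $9$ and it has exactly $9$ irreducible components, namely $$\overline{\mathcal{O}(\mathrm{A}_{07})},\ \overline{\mathcal{O}(\mathrm{A}_{17})},\ \overline{\mathcal{O}(\mathrm{A}_{18})},\ \overline{\mathcal{O}(\mathrm{A}_{19})},\ \overline{\mathcal{O}(\mathrm{A}_{20})},\ \overline{\mathcal{O}(\mathrm{A}_{23})},\ \overline{\mathcal{O}(\mathrm{A}_{24})},\ \overline{\mathcal{O}(\mathrm{R}_{09})},\ \overline{\mathcal{O}(\mathrm{R}_{10})}.$$ In particular, there are exactly $9$ rigid algebras (up to isomorphism) in this variety.
   Context: Write $(x,y,z)=(xy)z-x(yz)$. An algebra is right alternative if $(x,y,z)=-(x,z,y)$ for all $x,y,z$. Let $\mathbb{V}=\mathbb{C}^3$. The variety of complex $3$-dimensional right alternative algebras is the Zariski-closed subset of $\mathrm{Hom}(\mathbb{V}\otimes\mathbb{V},\mathbb{V})\cong\mathbb{C}^{27}$ (coordinates: structure constants) consisting of the right alternative multiplications. $\mathrm{GL}(\mathbb{V})$ acts by $(g*\mu)(x\otimes y)=g\mu(g^{-1}x\otimes g^{-1}y)$; $\mathcal{O}(\mathrm{A})$ is the orbit of a structure representing the algebra $\mathrm{A}$, and the bar denotes Zariski closure. An algebra is rigid in the variety if its orbit is an open subset of the variety. The algebras, in a basis $e_1,e_2,e_3$ (products not listed are zero): $\mathrm{A}_{07}$: $e_1e_1=e_1$, $e_2e_2=e_2$, $e_3e_3=e_3$; $\mathrm{A}_{17}$: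 $e_1e_1=e_1$, $e_1e_2=e_2$, $e_1e_3=e_3$; $\mathrm{A}_{18}$: $e_1e_1=e_1$, $e_2e_1=e_2$, $e_3e_1=e_3$; $\mathrm{A}_{19}$: $e_1e_1=e_1$, $e_1e_3=e_3$, $e_2e_1=e_2$; $\mathrm{A}_{20}$: $e_1e_1=e_1$, $e_1e_3=e_3$, $e_2e_2=e_2$, $e_3e_2=e_3$; $\mathrm{A}_{23}$: $e_1e_1=e_1$, $e_1e_3=e_3$, $e_2e_2=e_2$; $\mathrm{A}_{24}$: $e_1e_1=e_1$, $e_2e_2=e_2$, $e_3e_1=e_3$; $\mathrm{R}_{09}$: $e_1e_1=e_1$, $e_2e_1=e_2$, $e_2e_2=e_3$; $\mathrm{R}_{10}$: $e_1e_1=e_1$, $e_1e_2=e_2$, $e_1e_3=e_3$, $e_2e_2=e_3$, $e_3e_1=e_3$. *)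

theory Defs
  imports "HOL-Analysis.Analysis"
begin

section \<open>The Zariski topology on affine space\<close>

text \<open>The library's \<^const>\<open>polynomial_function\<close> is polynomial over the reals, so it also admits
  complex conjugation; hence the following complex version.\<close>

inductive complex_polynomial_fun :: "(complex ^ 'n \<Rightarrow> complex) \<Rightarrow> bool" where
  const: "complex_polynomial_fun (\<lambda>_. c)"
| coord: "complex_polynomial_fun (\<lambda>x. x $ i)"
| add: "complex_polynomial_fun p \<Longrightarrow> complex_polynomial_fun q \<Longrightarrow> complex_polynomial_fun (\<lambda>x. p x + q x)"
| mult: "complex_polynomial_fun p \<Longrightarrow> complex_polynomial_fun q \<Longrightarrow> complex_polynomial_fun (\<lambda>x. p x * q x)"

definition zero_locus :: "(complex ^ 'n \<Rightarrow> complex) set \<Rightarrow> (complex ^ 'n) set" where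
  "zero_locus P = {x. \<forall>p\<in>P. p x = 0}"

definition algebraic_set :: "(complex ^ 'n) set \<Rightarrow> bool" where
  "algebraic_set S \<longleftrightarrow> (\<exists>P. (\<forall>p\<in>P. complex_polynomial_fun p) \<and> S = zero_locus P)"

definition zariski :: "(complex ^ 'n) topology" where
  "zariski = topology (\<lambda>U. algebraic_set (- U))"

lemma algebraic_set_Un:
  assumes "algebraic_set S" "algebraic_set T"
  shows "algebraic_set (S \<union> T)"
proof -
  obtain P Q where PQ: "\<forall>p\<in>P. complex_polynomial_fun p" "S = zero_locus P"
    "\<forall>q\<in>Q. complex_polynomial_fun q" "T = zero_locus Q"
    using assms unfolding algebraic_set_def by auto
  let ?R = "{\<lambda>x. p x * q x | p q. p \<in> P \<and> q \<in> Q}"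
  have "\<forall>r\<in>?R. complex_polynomial_fun r"
    using PQ by (auto intro: complex_polynomial_fun.mult)
  moreover have "S \<union> T = zero_locus ?R"
  proof (intro set_eqI iffI)
    fix x assume "x \<in> S \<union> T"
    then show "x \<in> zero_locus ?R" using PQ by (auto simp: zero_locus_def)
  next
    fix x assume x: "x \<in> zero_locus ?R"
    have R: "r x = 0" if "r \<in> ?R" for r
      using x that by (simp only: zero_locus_def mem_Collect_eq)
    have "p x * q x = 0" if "p \<in> P" "q \<in> Q" for p q
      by (rule R[of "\<lambda>x. p x * q x"], rule CollectI, intro exI conjI) (rule refl that)+
    then show "x \<in> S \<union> T" unfolding PQ(2,4) zero_locus_def Un_iff mem_Collect_eq
      by (metis mult_eq_0_iff)
  qed
  ultimately show ?thesis unfolding algebraic_set_def by blast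
qed

lemma algebraic_set_Inter:
  assumes "\<And>S. S \<in> F \<Longrightarrow> algebraic_set S"
  shows "algebraic_set (\<Inter>F)"
proof -
  obtain P where P: "\<And>S. S \<in> F \<Longrightarrow> (\<forall>p\<in>P S. complex_polynomial_fun p) \<and> S = zero_locus (P S)"
    using assms unfolding algebraic_set_def by metis
  have "\<Inter>F = zero_locus (\<Union>S\<in>F. P S)"
  proof (intro set_eqI iffI)
    fix x assume "x \<in> \<Inter>F"
    then show "x \<in> zero_locus (\<Union>S\<in>F. P S)" using P unfolding zero_locus_def by blast
  next
    fix x assume "x \<in> zero_locus (\<Union>S\<in>F. P S)"
    then have "x \<in> zero_locus (P S)" if "S \<in> F" for S
      using that unfolding zero_locus_def by blast
    then show "x \<in> \<Inter>F" using P by blast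
  qed
  moreover have "\<forall>p\<in>(\<Union>S\<in>F. P S). complex_polynomial_fun p" using P by blast
  ultimately show ?thesis unfolding algebraic_set_def by blast
qed

lemma openin_zariski:
  fixes U :: "(complex ^ 'n) set"
  shows "openin zariski U \<longleftrightarrow> algebraic_set (- U)"
proof -
  have "istopology (\<lambda>U. algebraic_set (- U :: (complex ^ 'n) set))"
    unfolding istopology_def
  proof (intro conjI allI impI)
    fix S T :: "(complex ^ 'n) set"
    assume "algebraic_set (- S)" "algebraic_set (- T)"
    then show "algebraic_set (- (S \<inter> T))"
      by (metis Compl_Int algebraic_set_Un)
  next
    fix K :: "(complex ^ 'n) set set"
    assume "\<forall>S\<in>K. algebraic_set (- S)"
    then have "algebraic_set (\<Inter>(uminus ` K))"
      by (intro algebraic_set_Inter) auto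
    moreover have "- \<Union>K = \<Inter>(uminus ` K)" by auto
    ultimately show "algebraic_set (- \<Union>K)" by simp
  qed
  then show ?thesis by (simp add: zariski_def topology_inverse')
qed

lemma topspace_zariski [simp]: "topspace (zariski :: (complex ^ 'n) topology) = UNIV"
proof -
  have "algebraic_set ({} :: (complex ^ 'n) set)"
    unfolding algebraic_set_def zero_locus_def
    by (intro exI[of _ "{\<lambda>_. 1}"]) (auto intro: complex_polynomial_fun.const)
  then have "openin zariski (UNIV :: (complex ^ 'n) set)" by (simp add: openin_zariski)
  then show ?thesis using openin_subset by blast
qed

lemma closedin_zariski: "closedin zariski S \<longleftrightarrow> algebraic_set S"
  by (simp add: closedin_def openin_zariski Compl_eq_Diff_UNIV[symmetric])


section \<open>Irreducible components and dimension of a topological space\<close>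

definition irreducible_space :: "'a topology \<Rightarrow> bool" where
  "irreducible_space X \<longleftrightarrow> topspace X \<noteq> {} \<and>
     (\<forall>F G. closedin X F \<and> closedin X G \<and> topspace X = F \<union> G \<longrightarrow> F = topspace X \<or> G = topspace X)"

definition irreducible_subset :: "'a topology \<Rightarrow> 'a set \<Rightarrow> bool" where
  "irreducible_subset X S \<longleftrightarrow> S \<subseteq> topspace X \<and> irreducible_space (subtopology X S)"

definition irreducible_components :: "'a topology \<Rightarrow> 'a set set" where
  "irreducible_components X =
     {C. irreducible_subset X C \<and> (\<forall>D. irreducible_subset X D \<and> C \<subseteq> D \<longrightarrow> D = C)}"

text \<open>With this definition the empty space has dimension \<open>0\<close>.\<close>

definition krull_dim :: "'a topology \<Rightarrow> enat" where
  "krull_dim X = Sup (enat ` {n. \<exists>Z :: nat \<Rightarrow> 'a set.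
     (\<forall>i\<le>n. closedin X (Z i) \<and> irreducible_subset X (Z i)) \<and> (\<forall>i<n. Z i \<subset> Z (Suc i))})"


section \<open>Algebra structures on complex 3-space\<close>

text \<open>A multiplication is given by its structure constants:
  the \<open>(i, j, k)\<close> entry is the coefficient of \<open>e\<^sub>k\<close> in \<open>e\<^sub>i e\<^sub>j\<close>.\<close>

type_synonym structure_constants = "complex ^ (3 \<times> 3 \<times> 3)"

definition alg_mult :: "structure_constants \<Rightarrow> complex ^ 3 \<Rightarrow> complex ^ 3 \<Rightarrow> complex ^ 3" where
  "alg_mult \<mu> x y = (\<chi> k. \<Sum>i\<in>UNIV. \<Sum>j\<in>UNIV. \<mu> $ (i, j, k) * x $ i * y $ j)"

definition associator :: "structure_constants \<Rightarrow> complex ^ 3 \<Rightarrow> complex ^ 3 \<Rightarrow> complex ^ 3 \<Rightarrow> complex ^ 3" where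
  "associator \<mu> x y z = alg_mult \<mu> (alg_mult \<mu> x y) z - alg_mult \<mu> x (alg_mult \<mu> y z)"

definition right_alternative :: "structure_constants \<Rightarrow> bool" where
  "right_alternative \<mu> \<longleftrightarrow> (\<forall>x y z. associator \<mu> x y z = - associator \<mu> x z y)"

definition right_alternative_variety :: "structure_constants topology" where
  "right_alternative_variety = subtopology zariski {\<mu>. right_alternative \<mu>}"

definition GL_action :: "complex ^ 3 ^ 3 \<Rightarrow> structure_constants \<Rightarrow> structure_constants" where
  "GL_action g \<mu> = (\<chi> t. case t of (i, j, k) \<Rightarrow>
     (g *v alg_mult \<mu> (matrix_inv g *v axis i 1) (matrix_inv g *v axis j 1)) $ k)"

definition orbit :: "structure_constants \<Rightarrow> structure_constants set" where
  "orbit \<mu> = {GL_action g \<mu> | g. invertible g}"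

definition rigid :: "structure_constants \<Rightarrow> bool" where
  "rigid \<mu> \<longleftrightarrow> right_alternative \<mu> \<and> openin right_alternative_variety (orbit \<mu>)"

definition alg_iso :: "structure_constants \<Rightarrow> structure_constants \<Rightarrow> bool" where
  "alg_iso \<mu> \<nu> \<longleftrightarrow> (\<exists>\<phi>. Vector_Spaces.linear (*s) (*s) \<phi> \<and> bij \<phi> \<and>
     (\<forall>x y. \<phi> (alg_mult \<mu> x y) = alg_mult \<nu> (\<phi> x) (\<phi> y)))"

lemma alg_mult_axis: "alg_mult \<mu> (axis i 1) (axis j 1) $ k = \<mu> $ (i, j, k)"
proof -
  have "alg_mult \<mu> (axis i 1) (axis j 1) $ k
      = (\<Sum>a\<in>UNIV. \<Sum>b\<in>UNIV. if a = i then if b = j then \<mu> $ (i, j, k) else 0 else 0)"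
    unfolding alg_mult_def by (auto simp: axis_def intro!: sum.cong)
  also have "\<dots> = (\<Sum>a\<in>UNIV. if a = i then \<mu> $ (i, j, k) else 0)"
    by (intro sum.cong) auto
  finally show ?thesis by simp
qed

lemma alg_mult_add_left: "alg_mult \<mu> (x + x') y = alg_mult \<mu> x y + alg_mult \<mu> x' y"
  by (simp add: alg_mult_def vec_eq_iff sum.distrib[symmetric] ring_distribs)

lemma alg_mult_add_right: "alg_mult \<mu> x (y + y') = alg_mult \<mu> x y + alg_mult \<mu> x y'"
  by (simp add: alg_mult_def vec_eq_iff sum.distrib[symmetric] ring_distribs)

lemma alg_mult_scale_left: "alg_mult \<mu> (c *s x) y = c *s alg_mult \<mu> x y"
  by (simp add: alg_mult_def vec_eq_iff sum_distrib_left mult.assoc mult.left_commute)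

lemma alg_mult_scale_right: "alg_mult \<mu> x (c *s y) = c *s alg_mult \<mu> x y"
  by (simp add: alg_mult_def vec_eq_iff sum_distrib_left mult.assoc mult.left_commute)

lemma alg_mult_GL_action:
  "alg_mult (GL_action g \<mu>) x y = g *v alg_mult \<mu> (matrix_inv g *v x) (matrix_inv g *v y)"
proof -
  define h where "h = matrix_inv g"
  define m where "m i j = g *v alg_mult \<mu> (h *v axis i 1) (h *v axis j 1)" for i j
  have ax: "alg_mult (GL_action g \<mu>) (axis i 1) (axis j 1) = m i j" for i j
    by (simp add: vec_eq_iff alg_mult_axis GL_action_def m_def h_def)
  have decomp: "z = z $ 1 *s axis 1 1 + z $ 2 *s axis 2 1 + z $ 3 *s axis 3 1" for z :: "complex ^ 3"
    by (simp add: vec_eq_iff forall_3 axis_def)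
  note expand = alg_mult_add_left alg_mult_add_right alg_mult_scale_left alg_mult_scale_right
    matrix_vector_right_distrib vector_scalar_commute
  have "alg_mult (GL_action g \<mu>) (a *s axis 1 1 + b *s axis 2 1 + c *s axis 3 1)
          (a' *s axis 1 1 + b' *s axis 2 1 + c' *s axis 3 1)
      = g *v alg_mult \<mu> (h *v (a *s axis 1 1 + b *s axis 2 1 + c *s axis 3 1))
          (h *v (a' *s axis 1 1 + b' *s axis 2 1 + c' *s axis 3 1))" for a b c a' b' c'
    by (simp only: expand ax m_def)
  from this[of "x $ 1" "x $ 2" "x $ 3" "y $ 1" "y $ 2" "y $ 3"] show ?thesis
    by (simp only: decomp[symmetric] h_def)
qed


section \<open>The algebras\<close>

text \<open>The algebra in which \<open>e\<^sub>i e\<^sub>j = e\<^sub>k\<close> for the listed triples \<open>(i, j, k)\<close>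
  and the remaining products of basis vectors vanish. In the type \<open>3\<close> the numeral \<open>3\<close> equals \<open>0\<close>;
  the three indices \<open>1, 2, 3\<close> are distinct.\<close>

definition alg_table :: "(3 \<times> 3 \<times> 3) set \<Rightarrow> structure_constants" where
  "alg_table T = (\<chi> t. if t \<in> T then 1 else 0)"

definition "A07 = alg_table {(1,1,1), (2,2,2), (3,3,3)}"
definition "A17 = alg_table {(1,1,1), (1,2,2), (1,3,3)}"
definition "A18 = alg_table {(1,1,1), (2,1,2), (3,1,3)}"
definition "A19 = alg_table {(1,1,1), (1,3,3), (2,1,2)}"
definition "A20 = alg_table {(1,1,1), (1,3,3), (2,2,2), (3,2,3)}"
definition "A23 = alg_table {(1,1,1), (1,3,3), (2,2,2)}"
definition "A24 = alg_table {(1,1,1), (2,2,2), (3,1,3)}"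
definition "R09 = alg_table {(1,1,1), (2,1,2), (2,2,3)}"
definition "R10 = alg_table {(1,1,1), (1,2,2), (1,3,3), (2,2,3), (3,1,3)}"

end

theory Submission
  imports Defs "HOL-Computational_Algebra.Fundamental_Theorem_Algebra"
begin

text \<open>Let \<open>L\<^sub>x\<close> and \<open>R\<^sub>x\<close> be left and right multiplication by \<open>x\<close>. For an idempotent \<open>e\<close>, right
  alternativity forces \<open>(S - 2 R) (1 - S) = 0\<close> and \<open>R\<^sup>2 = R\<close>, where \<open>S = L\<^sub>e + R\<^sub>e\<close> and \<open>R = R\<^sub>e\<close>; the
  resulting Peirce decomposition leaves so few structure constants free that every algebra with an
  idempotent lies in an explicit polynomial family whose generic member is one of the nine algebras.
  Algebras without idempotent are generated by one element or have \<open>x\<^sup>3 = 0\<close> identically, and the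
  latter are given by a bilinear form on a plane and degenerate from \<open>R\<^sub>0\<^sub>9\<close>. Hence the nine orbit
  closures cover the variety. They are irreducible because two points of an orbit are joined by a
  rational curve, and identities between the traces of \<open>L\<^sub>x\<close>, \<open>R\<^sub>x\<close> and commutators separate them.
  An orbit is open because the algebras of its closure that lie in no other orbit closure and outside the
  orbit satisfy a closed condition which fails on the orbit.

  A chain of irreducible closed sets yields algebraically independent polynomials on an orbit closure;
  pulled back to \<open>GL\<^sub>3\<close> they are rational functions of nine matrix entries, so the dimension is at most \<open>9\<close>.
  A chain of length \<open>9\<close> comes from the nine parameters of the algebras generated by a fixed vector.\<close>

section \<open>Rational curves and irreducible sets\<close>

text \<open>Two standard facts about group actions are replaced by explicit work: that an orbit is
  open in its closure, and that its dimension is that of the group minus that of a stabilizer.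
  Instead of the first, every algebra is placed in an orbit closure together with a certificate,
  namely that it lies in the orbit or satisfies a closed condition failing there; this is why the
  families are followed down to their degenerate parameter values. Instead of the second, monomials
  are counted. The number 9 then has two origins: the nine entries of a matrix, and six coordinates
  of a frame containing a fixed vector plus three coefficients of a cubic. The constants in the
  separating conditions come from two linear forms, the right and the left trace. They are
  proportional in six of the nine algebras, with distinct ratios except for \<open>A07\<close> and
  \<open>A19\<close>, which share 1:1. In \<open>A20\<close>, \<open>A23\<close> and
  \<open>A24\<close> they are independent and serve as coordinates for the eigenvalues on
  commutators.\<close>

inductive_set function_algebra :: "('a \<Rightarrow> complex) set \<Rightarrow> ('a \<Rightarrow> complex) set" for G where
  const: "(\<lambda>_. c) \<in> function_algebra G"
| gen: "f \<in> G \<Longrightarrow> f \<in> function_algebra G"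
| add: "f \<in> function_algebra G \<Longrightarrow> g \<in> function_algebra G \<Longrightarrow> (\<lambda>x. f x + g x) \<in> function_algebra G"
| mult: "f \<in> function_algebra G \<Longrightarrow> g \<in> function_algebra G \<Longrightarrow> (\<lambda>x. f x * g x) \<in> function_algebra G"

lemma function_algebra_uminus: "f \<in> function_algebra G \<Longrightarrow> (\<lambda>x. - f x) \<in> function_algebra G"
  using function_algebra.mult[OF function_algebra.const[of "-1"]] by fastforce

lemma function_algebra_diff:
  "f \<in> function_algebra G \<Longrightarrow> g \<in> function_algebra G \<Longrightarrow> (\<lambda>x. f x - g x) \<in> function_algebra G"
  using function_algebra.add[OF _ function_algebra_uminus, of f G g] by simp

lemma function_algebra_power: "f \<in> function_algebra G \<Longrightarrow> (\<lambda>x. f x ^ n) \<in> function_algebra G"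
  by (induction n) (auto intro: function_algebra.intros)

lemma function_algebra_sum:
  "(\<And>i. i \<in> A \<Longrightarrow> f i \<in> function_algebra G) \<Longrightarrow> (\<lambda>x. \<Sum>i\<in>A. f i x) \<in> function_algebra G"
  by (induction A rule: infinite_finite_induct) (auto intro: function_algebra.intros)

lemma function_algebra_coord: "(\<lambda>x. x $ i) \<in> function_algebra (range (\<lambda>i x. x $ i))"
  by (rule function_algebra.gen) auto

lemma function_algebra_id: "(\<lambda>t. t) \<in> function_algebra {\<lambda>t. t}"
  by (rule function_algebra.gen) auto

lemmas function_algebra_intros =
  function_algebra.const function_algebra_id function_algebra_coord function_algebra.add
  function_algebra.mult function_algebra_uminus function_algebra_diff function_algebra_power
  function_algebra_sum

text \<open>The generators vary below: the coordinates give polynomials on affine space, the single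
  function \<open>\<lambda>t. t\<close> gives polynomials in one variable, and nine entry functions
  give polynomials on matrices. Pullbacks between these settings then need one lemma only.\<close>

lemma complex_polynomial_fun_iff:
  "complex_polynomial_fun p \<longleftrightarrow> p \<in> function_algebra (range (\<lambda>i x. x $ i))"
proof
  show "complex_polynomial_fun p \<Longrightarrow> p \<in> function_algebra (range (\<lambda>i x. x $ i))"
    by (induction rule: complex_polynomial_fun.induct) (auto intro: function_algebra.intros)
  show "p \<in> function_algebra (range (\<lambda>i x. x $ i)) \<Longrightarrow> complex_polynomial_fun p"
    by (induction rule: function_algebra.induct) (auto intro: complex_polynomial_fun.intros)
qed

lemma complex_polynomial_fun_comp:
  assumes "complex_polynomial_fun p" "\<And>i. (\<lambda>x. f x $ i) \<in> function_algebra G"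
  shows "(\<lambda>x. p (f x)) \<in> function_algebra G"
  using assms by (induction rule: complex_polynomial_fun.induct) (auto intro: function_algebra.intros)

text \<open>Clearing denominators: \<open>f\<close> is a tuple of rational functions with common denominator \<open>d\<close>.\<close>

lemma complex_polynomial_fun_clear_denominator:
  assumes "complex_polynomial_fun p" and d: "d \<in> function_algebra G"
    and f: "\<And>i. (\<lambda>x. d x * f x $ i) \<in> function_algebra G"
  obtains N where "\<And>M. N \<le> M \<Longrightarrow> (\<lambda>x. d x ^ M * p (f x)) \<in> function_algebra G"
proof -
  have "\<exists>N. (\<lambda>x. d x ^ N * p (f x)) \<in> function_algebra G"
    using assms(1)
  proof (induction rule: complex_polynomial_fun.induct)
    case (const c)
    show ?case by (intro exI[of _ 0]) (auto intro: function_algebra.intros)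
  next
    case (coord i)
    show ?case using f by (intro exI[of _ 1]) auto
  next
    case (add p q)
    then obtain N M where NM: "(\<lambda>x. d x ^ N * p (f x)) \<in> function_algebra G"
      "(\<lambda>x. d x ^ M * q (f x)) \<in> function_algebra G" by auto
    have "(\<lambda>x. d x ^ (N + M) * (p (f x) + q (f x))) =
        (\<lambda>x. d x ^ M * (d x ^ N * p (f x)) + d x ^ N * (d x ^ M * q (f x)))"
      by (auto simp: algebra_simps power_add)
    also have "\<dots> \<in> function_algebra G" by (intro function_algebra_intros d NM)
    finally show ?case by blast
  next
    case (mult p q)
    then obtain N M where NM: "(\<lambda>x. d x ^ N * p (f x)) \<in> function_algebra G"
      "(\<lambda>x. d x ^ M * q (f x)) \<in> function_algebra G" by auto
    have "(\<lambda>x. d x ^ (N + M) * (p (f x) * q (f x))) =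
        (\<lambda>x. (d x ^ N * p (f x)) * (d x ^ M * q (f x)))"
      by (auto simp: algebra_simps power_add)
    also have "\<dots> \<in> function_algebra G" by (intro function_algebra_intros NM)
    finally show ?case by blast
  qed
  then obtain N where N: "(\<lambda>x. d x ^ N * p (f x)) \<in> function_algebra G" by blast
  have "(\<lambda>x. d x ^ M * p (f x)) \<in> function_algebra G" if "N \<le> M" for M
  proof -
    have "(\<lambda>x. d x ^ M * p (f x)) = (\<lambda>x. d x ^ (M - N) * (d x ^ N * p (f x)))"
      using that by (simp add: mult.assoc[symmetric] power_add[symmetric])
    also have "\<dots> \<in> function_algebra G" by (intro function_algebra_intros d N)
    finally show ?thesis .
  qed
  then show ?thesis using that by blast
qed

lemma univariate_function_algebra:
  assumes "f \<in> function_algebra {\<lambda>t :: complex. t}"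
  obtains p where "f = poly p"
proof -
  have "\<exists>p. f = poly p" using assms
  proof (induction rule: function_algebra.induct)
    case (const c) show ?case by (intro exI[of _ "[:c:]"]) auto
  next
    case (gen f) then show ?case by (intro exI[of _ "[:0, 1:]"]) auto
  next
    case (add f g) then obtain p q where "f = poly p" "g = poly q" by auto
    then show ?case by (intro exI[of _ "p + q"]) auto
  next
    case (mult f g) then obtain p q where "f = poly p" "g = poly q" by auto
    then show ?case by (intro exI[of _ "p * q"]) auto
  qed
  then show ?thesis using that by blast
qed

lemma univariate_finite_zeros:
  assumes "f \<in> function_algebra {\<lambda>t :: complex. t}" "f s \<noteq> 0"
  shows "finite {t. f t = 0}"
proof -
  obtain p where p: "f = poly p" using univariate_function_algebra[OF assms(1)] .
  then have "p \<noteq> 0" using assms(2) by auto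
  then show ?thesis using poly_roots_finite p by auto
qed

section \<open>Zariski closures and rational curves\<close>

lemma zariski_closure_iff:
  "\<mu> \<in> zariski closure_of S \<longleftrightarrow> (\<forall>p. complex_polynomial_fun p \<and> (\<forall>x\<in>S. p x = 0) \<longrightarrow> p \<mu> = 0)"
proof
  assume \<mu>: "\<mu> \<in> zariski closure_of S"
  show "\<forall>p. complex_polynomial_fun p \<and> (\<forall>x\<in>S. p x = 0) \<longrightarrow> p \<mu> = 0"
  proof (intro allI impI)
    fix p :: "complex ^ 'a \<Rightarrow> complex" assume p: "complex_polynomial_fun p \<and> (\<forall>x\<in>S. p x = 0)"
    then have "closedin zariski (zero_locus {p})"
      unfolding closedin_zariski algebraic_set_def by blast
    moreover have "S \<subseteq> zero_locus {p}" using p by (auto simp: zero_locus_def)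
    ultimately have "zariski closure_of S \<subseteq> zero_locus {p}" by (rule closure_of_minimal[rotated])
    then show "p \<mu> = 0" using \<mu> by (auto simp: zero_locus_def)
  qed
next
  assume r: "\<forall>p. complex_polynomial_fun p \<and> (\<forall>x\<in>S. p x = 0) \<longrightarrow> p \<mu> = 0"
  have "closedin zariski (zariski closure_of S)" by simp
  then obtain P where P: "\<forall>p\<in>P. complex_polynomial_fun p" "zariski closure_of S = zero_locus P"
    unfolding closedin_zariski algebraic_set_def by blast
  have "S \<subseteq> zariski closure_of S" by (simp add: closure_of_subset)
  then have "p \<mu> = 0" if "p \<in> P" for p using r P that unfolding zero_locus_def by blast
  then show "\<mu> \<in> zariski closure_of S" using P(2) by (auto simp: zero_locus_def)
qed

text \<open>A polynomial vanishing on \<open>S\<close> vanishes along the curve at infinitely many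
  parameters, hence at all of them. Degenerations are exhibited in this way: \<open>f t0\<close>
  itself may lie outside \<open>S\<close>.\<close>

lemma curve_in_zariski_closure:
  assumes f: "\<And>i. (\<lambda>t. f t $ i) \<in> function_algebra {\<lambda>t :: complex. t}"
    and fin: "finite {t. f t \<notin> S}"
  shows "f t0 \<in> zariski closure_of S"
  unfolding zariski_closure_iff
proof (intro allI impI)
  fix p assume p: "complex_polynomial_fun p \<and> (\<forall>x\<in>S. p x = 0)"
  then have pf: "(\<lambda>t. p (f t)) \<in> function_algebra {\<lambda>t. t}"
    using complex_polynomial_fun_comp f by blast
  have "infinite {t. f t \<in> S}"
  proof
    assume "finite {t. f t \<in> S}"
    then have "finite ({t. f t \<in> S} \<union> {t. f t \<notin> S})" using fin by simp
    moreover have "{t. f t \<in> S} \<union> {t. f t \<notin> S} = (UNIV :: complex set)" by auto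
    ultimately show False using infinite_UNIV_char_0 by metis
  qed
  moreover have "{t. f t \<in> S} \<subseteq> {t. p (f t) = 0}" using p by auto
  ultimately have "infinite {t. p (f t) = 0}" using finite_subset by blast
  then show "p (f t0) = 0" using univariate_finite_zeros[OF pf, of t0] by blast
qed

text \<open>At a zero of \<open>d\<close> the value of \<open>f\<close> is arbitrary; this
  accommodates \<open>matrix_inv\<close> at singular matrices.\<close>

definition rational_curve :: "(complex \<Rightarrow> complex ^ 'n) \<Rightarrow> (complex \<Rightarrow> complex) \<Rightarrow> bool" where
  "rational_curve f d \<longleftrightarrow> d \<in> function_algebra {\<lambda>t. t} \<and>
     (\<forall>i. (\<lambda>t. d t * f t $ i) \<in> function_algebra {\<lambda>t. t})"

definition rationally_connected :: "(complex ^ 'n) set \<Rightarrow> bool" where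
  "rationally_connected S \<longleftrightarrow> S \<noteq> {} \<and> (\<forall>x\<in>S. \<forall>y\<in>S. \<exists>f d. rational_curve f d \<and>
     f 0 = x \<and> f 1 = y \<and> d 0 \<noteq> 0 \<and> d 1 \<noteq> 0 \<and> (\<forall>t. d t \<noteq> 0 \<longrightarrow> f t \<in> S))"

lemma irreducible_subset_zariski_iff:
  "irreducible_subset zariski S \<longleftrightarrow> S \<noteq> {} \<and>
     (\<forall>F G. algebraic_set F \<and> algebraic_set G \<and> S \<subseteq> F \<union> G \<longrightarrow> S \<subseteq> F \<or> S \<subseteq> G)"
  (is "?L \<longleftrightarrow> ?R")
proof
  assume L: ?L
  show ?R
  proof (intro conjI allI impI)
    show "S \<noteq> {}" using L by (auto simp: irreducible_subset_def irreducible_space_def)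
  next
    fix F G assume FG: "algebraic_set F \<and> algebraic_set G \<and> S \<subseteq> F \<union> G"
    then have "closedin (subtopology zariski S) (F \<inter> S)" "closedin (subtopology zariski S) (G \<inter> S)"
      by (auto simp: closedin_subtopology closedin_zariski)
    moreover have "topspace (subtopology zariski S) = (F \<inter> S) \<union> (G \<inter> S)" using FG by auto
    ultimately have "F \<inter> S = topspace (subtopology zariski S) \<or> G \<inter> S = topspace (subtopology zariski S)"
      using L unfolding irreducible_subset_def irreducible_space_def by metis
    then have "F \<inter> S = S \<or> G \<inter> S = S" by simp
    then show "S \<subseteq> F \<or> S \<subseteq> G" by auto
  qed
next
  assume R: ?R
  show ?L unfolding irreducible_subset_def irreducible_space_def
  proof (intro conjI allI impI)
    show "topspace (subtopology zariski S) \<noteq> {}" using R by auto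
  next
    fix F G assume FG: "closedin (subtopology zariski S) F \<and> closedin (subtopology zariski S) G \<and>
      topspace (subtopology zariski S) = F \<union> G"
    then obtain F' G' where "algebraic_set F'" "algebraic_set G'" "F = F' \<inter> S" "G = G' \<inter> S"
      unfolding closedin_subtopology closedin_zariski by blast
    moreover have "S \<subseteq> F \<union> G" using FG by simp
    then have "S \<subseteq> F' \<union> G'" using \<open>F = F' \<inter> S\<close> \<open>G = G' \<inter> S\<close> by blast
    ultimately have "S \<subseteq> F' \<or> S \<subseteq> G'" using R by blast
    then show "F = topspace (subtopology zariski S) \<or> G = topspace (subtopology zariski S)"
      unfolding \<open>F = F' \<inter> S\<close> \<open>G = G' \<inter> S\<close> by auto
  qed auto
qed

text \<open>If neither closed set contained \<open>S\<close>, a curve would join a point outside the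
  first to a point outside the second. The pullbacks of the two witnessing polynomials have finitely
  many zeros, so some point of the curve avoids both sets.\<close>

lemma irreducible_subset_zariski_closure:
  assumes "rationally_connected S"
  shows "irreducible_subset zariski (zariski closure_of S)"
  unfolding irreducible_subset_zariski_iff
proof (intro conjI allI impI)
  show "zariski closure_of S \<noteq> {}"
    using assms closure_of_subset[of S zariski] by (auto simp: rationally_connected_def)
next
  fix F G assume FG: "algebraic_set F \<and> algebraic_set G \<and> zariski closure_of S \<subseteq> F \<union> G"
  then obtain P Q where P: "\<And>p. p \<in> P \<Longrightarrow> complex_polynomial_fun p" "F = zero_locus P"
    and Q: "\<And>p. p \<in> Q \<Longrightarrow> complex_polynomial_fun p" "G = zero_locus Q"
    unfolding algebraic_set_def by blast
  have S: "S \<subseteq> F \<union> G" using FG closure_of_subset[of S zariski] by auto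
  have "S \<subseteq> F \<or> S \<subseteq> G"
  proof (rule ccontr)
    assume "\<not> (S \<subseteq> F \<or> S \<subseteq> G)"
    then obtain x y where xy: "x \<in> S" "x \<notin> F" "y \<in> S" "y \<notin> G" by auto
    then obtain p q where p: "p \<in> P" "p x \<noteq> 0" and q: "q \<in> Q" "q y \<noteq> 0"
      using P(2) Q(2) by (auto simp: zero_locus_def)
    obtain f d where fd: "rational_curve f d" "f 0 = x" "f 1 = y" "d 0 \<noteq> 0" "d 1 \<noteq> 0"
      "\<And>t. d t \<noteq> 0 \<Longrightarrow> f t \<in> S"
      using assms xy unfolding rationally_connected_def by metis
    note rc = fd(1)[unfolded rational_curve_def]
    obtain N where N: "(\<lambda>t. d t ^ N * p (f t)) \<in> function_algebra {\<lambda>t. t}"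
      using complex_polynomial_fun_clear_denominator[OF P(1)[OF p(1)], of d "{\<lambda>t. t}" f] rc by blast
    obtain M where M: "(\<lambda>t. d t ^ M * q (f t)) \<in> function_algebra {\<lambda>t. t}"
      using complex_polynomial_fun_clear_denominator[OF Q(1)[OF q(1)], of d "{\<lambda>t. t}" f] rc by blast
    have 1: "finite {t. d t ^ N * p (f t) = 0}"
      using univariate_finite_zeros[OF N, of 0] fd p by auto
    have 2: "finite {t. d t ^ M * q (f t) = 0}"
      using univariate_finite_zeros[OF M, of 1] fd q by auto
    have 3: "finite {t. d t = 0}"
      using univariate_finite_zeros[of d 0] fd rc by auto
    have "finite ({t. d t ^ N * p (f t) = 0} \<union> {t. d t ^ M * q (f t) = 0} \<union> {t. d t = 0})"
      (is "finite ?A") using 1 2 3 by blast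
    then have "?A \<noteq> UNIV" using infinite_UNIV_char_0 by metis
    then obtain t where t: "p (f t) \<noteq> 0" "q (f t) \<noteq> 0" "d t \<noteq> 0" by auto
    then have "f t \<in> F \<union> G" using fd(6) S by auto
    then show False using t p(1) q(1) P(2) Q(2) by (auto simp: zero_locus_def)
  qed
  then show "zariski closure_of S \<subseteq> F \<or> zariski closure_of S \<subseteq> G"
    using FG closedin_zariski closure_of_minimal by metis
qed

section \<open>The action of the general linear group\<close>

lemma matrix_vector_axis [simp]: "((A :: complex ^ 'n ^ 'm) *v axis i 1) $ a = A $ a $ i"
  by (simp add: matrix_vector_mult_def axis_def if_distrib cong: if_cong)

lemma GL_action_nth:
  "GL_action g \<mu> $ (i, j, k) = (\<Sum>c\<in>UNIV. g $ k $ c *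
     (\<Sum>a\<in>UNIV. \<Sum>b\<in>UNIV. \<mu> $ (a, b, c) * matrix_inv g $ a $ i * matrix_inv g $ b $ j))"
  unfolding GL_action_def alg_mult_def by (simp add: matrix_vector_mult_def[of g])

lemma structure_constants_eq_iff:
  "\<mu> = (\<nu> :: structure_constants) \<longleftrightarrow> (\<forall>i j k. \<mu> $ (i, j, k) = \<nu> $ (i, j, k))"
  unfolding vec_eq_iff by (metis prod_cases3)

lemma structure_constants_eqI:
  assumes "\<And>x y. alg_mult \<mu> x y = alg_mult \<nu> x y" shows "\<mu> = \<nu>"
  using assms alg_mult_axis by (metis (no_types, lifting) prod_cases3 vec_eq_iff)

lemma matrix_inv_inverse:
  assumes "invertible (g :: complex ^ 'n ^ 'n)"
  shows "g ** matrix_inv g = mat 1" "matrix_inv g ** g = mat 1"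
  using assms someI_ex[of "\<lambda>h. g ** h = mat 1 \<and> h ** g = mat 1"]
  unfolding matrix_inv_def invertible_def by auto

lemma matrix_inv_vector [simp]:
  assumes "invertible (g :: complex ^ 'n ^ 'n)"
  shows "g *v (matrix_inv g *v x) = x" "matrix_inv g *v (g *v x) = x"
  using matrix_inv_inverse[OF assms] by (simp_all add: matrix_vector_mul_assoc)

lemma invertible_matrix_inv:
  "invertible (g :: complex ^ 'n ^ 'n) \<Longrightarrow> invertible (matrix_inv g)"
  using matrix_inv_inverse unfolding invertible_def by blast

lemma matrix_inv_unique:
  assumes "h ** g = mat 1" "g ** h = mat 1" shows "matrix_inv g = (h :: complex ^ 'n ^ 'n)"
proof -
  have "invertible g" using assms unfolding invertible_def by blast
  then have "h ** (g ** matrix_inv g) = h" by (simp add: matrix_inv_inverse)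
  then show ?thesis using assms by (simp add: matrix_mul_assoc)
qed

lemma GL_action_mult:
  assumes "invertible g" "invertible h"
  shows "GL_action g (GL_action h \<mu>) = GL_action (g ** h) \<mu>"
proof (rule structure_constants_eqI)
  have "matrix_inv (g ** h) = matrix_inv h ** matrix_inv g"
    using assms matrix_inv_inverse[OF assms(1)] matrix_inv_inverse[OF assms(2)]
    by (intro matrix_inv_unique) (metis matrix_mul_assoc matrix_mul_rid)+
  then show "alg_mult (GL_action g (GL_action h \<mu>)) x y = alg_mult (GL_action (g ** h) \<mu>) x y" for x y
    by (simp add: alg_mult_GL_action matrix_vector_mul_assoc)
qed

lemma GL_action_id: "GL_action (mat 1) \<mu> = \<mu>"
proof (rule structure_constants_eqI)
  have "matrix_inv (mat 1 :: complex ^ 3 ^ 3) = mat 1" by (rule matrix_inv_unique) auto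
  then show "alg_mult (GL_action (mat 1) \<mu>) x y = alg_mult \<mu> x y" for x y
    by (simp add: alg_mult_GL_action)
qed

lemma GL_action_inverse:
  assumes "invertible g"
  shows "GL_action (matrix_inv g) (GL_action g \<mu>) = \<mu>" "GL_action g (GL_action (matrix_inv g) \<mu>) = \<mu>"
  using assms by (simp_all add: GL_action_mult invertible_matrix_inv matrix_inv_inverse GL_action_id)

lemma orbit_refl: "\<mu> \<in> orbit \<mu>"
proof -
  have "invertible (mat 1 :: complex ^ 3 ^ 3)" unfolding invertible_def by auto
  then show ?thesis unfolding orbit_def using GL_action_id[of \<mu>] by force
qed

lemma orbit_sym: "\<nu> \<in> orbit \<mu> \<Longrightarrow> \<mu> \<in> orbit \<nu>"
  unfolding orbit_def using GL_action_inverse invertible_matrix_inv by (smt (verit) mem_Collect_eq)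

lemma orbit_trans: "\<nu> \<in> orbit \<mu> \<Longrightarrow> \<xi> \<in> orbit \<nu> \<Longrightarrow> \<xi> \<in> orbit \<mu>"
  unfolding orbit_def using GL_action_mult invertible_mult by (smt (verit) mem_Collect_eq)

lemma orbit_eq: "\<nu> \<in> orbit \<mu> \<Longrightarrow> orbit \<nu> = orbit \<mu>"
  using orbit_sym orbit_trans by blast

lemma alg_iso_iff_orbit: "alg_iso \<mu> \<nu> \<longleftrightarrow> \<nu> \<in> orbit \<mu>"
proof
  assume "alg_iso \<mu> \<nu>"
  then obtain \<phi> where \<phi>: "Vector_Spaces.linear (*s) (*s) \<phi>" "bij \<phi>"
    "\<And>x y. \<phi> (alg_mult \<mu> x y) = alg_mult \<nu> (\<phi> x) (\<phi> y)"
    unfolding alg_iso_def by blast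
  define g where "g = matrix \<phi>"
  have g: "g *v x = \<phi> x" for x unfolding g_def by (rule matrix_works[OF \<phi>(1)])
  have "inj ((*v) g)" using \<phi>(2) g by (metis bij_is_inj ext)
  then have inv: "invertible g"
    using matrix_left_invertible_injective invertible_left_inverse by blast
  have "g *v alg_mult \<mu> x y = alg_mult \<nu> (g *v x) (g *v y)" for x y using \<phi>(3) g by simp
  then have "GL_action g \<mu> = \<nu>"
    by (intro structure_constants_eqI) (simp add: alg_mult_GL_action inv)
  then show "\<nu> \<in> orbit \<mu>" unfolding orbit_def using inv by blast
next
  assume "\<nu> \<in> orbit \<mu>"
  then obtain g where g: "invertible g" "\<nu> = GL_action g \<mu>" unfolding orbit_def by blast
  have "bij ((*v) g)"
    using g(1) by (intro o_bij[of "(*v) (matrix_inv g)"]) auto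
  then show "alg_iso \<mu> \<nu>" unfolding alg_iso_def
    by (intro exI[of _ "(*v) g"]) (auto simp: g alg_mult_GL_action matrix_vector_mul_linear_gen)
qed

lemma GL_action_nth_linear: "(\<lambda>\<mu>. GL_action g \<mu> $ t) \<in> function_algebra (range (\<lambda>i x. x $ i))"
proof -
  obtain i j k where "t = (i, j, k)" by (metis prod_cases3)
  then show ?thesis unfolding GL_action_nth
    by (simp only: GL_action_nth) (intro function_algebra_intros)
qed

text \<open>The action of \<open>g\<close> is linear in the structure constants and preserves the
  orbit, so it pulls polynomials vanishing on the orbit back to such polynomials.\<close>

lemma GL_action_zariski_closure:
  assumes "invertible g" "\<mu> \<in> zariski closure_of orbit \<nu>"
  shows "GL_action g \<mu> \<in> zariski closure_of orbit \<nu>"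
  unfolding zariski_closure_iff
proof (intro allI impI)
  fix p assume p: "complex_polynomial_fun p \<and> (\<forall>x\<in>orbit \<nu>. p x = 0)"
  have "complex_polynomial_fun (\<lambda>\<mu>. p (GL_action g \<mu>))"
    unfolding complex_polynomial_fun_iff
    using complex_polynomial_fun_comp[of p "GL_action g"] p GL_action_nth_linear by blast
  moreover have "GL_action g x \<in> orbit \<nu>" if "x \<in> orbit \<nu>" for x
    using that orbit_trans[of x \<nu>] assms(1) unfolding orbit_def by blast
  ultimately show "p (GL_action g \<mu>) = 0" using assms(2) p unfolding zariski_closure_iff by blast
qed

section \<open>Bases and changes of basis\<close>

definition frame :: "complex ^ 3 \<Rightarrow> complex ^ 3 \<Rightarrow> complex ^ 3 \<Rightarrow> complex ^ 3 ^ 3" where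
  "frame u v w = (\<chi> i j. (vector [u, v, w] :: complex ^ 3 ^ 3) $ j $ i)"

lemma frame_mult: "frame u v w *v x = x $ 1 *s u + x $ 2 *s v + x $ 3 *s w"
  by (simp add: frame_def matrix_vector_mult_def vec_eq_iff sum_3 algebra_simps)

lemma invertible_frame:
  assumes "\<And>a b c. a *s u + b *s v + c *s w = 0 \<Longrightarrow> a = 0 \<and> b = 0 \<and> c = 0"
  shows "invertible (frame u v w)"
proof -
  have "x = 0" if "frame u v w *v x = 0" for x
    using assms[of "x $ 1" "x $ 2" "x $ 3"] that by (simp add: frame_mult vec_eq_iff forall_3)
  then show ?thesis using invertible_left_inverse matrix_left_invertible_ker by blast
qed

definition structure_table :: "complex ^ 3 ^ 3 ^ 3 \<Rightarrow> structure_constants" where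
  "structure_table m = (\<chi> t. case t of (i, j, k) \<Rightarrow> m $ i $ j $ k)"

lemma change_basis:
  fixes \<mu> :: structure_constants
  assumes "invertible (frame u v w)"
  defines "\<nu> \<equiv> GL_action (matrix_inv (frame u v w)) \<mu>"
  shows "alg_mult \<mu> (frame u v w *v x) (frame u v w *v y) = frame u v w *v alg_mult \<nu> x y"
    and "\<nu> \<in> orbit \<mu>"
proof -
  have "\<mu> = GL_action (frame u v w) \<nu>" unfolding \<nu>_def using assms(1) by (simp add: GL_action_inverse)
  then show "alg_mult \<mu> (frame u v w *v x) (frame u v w *v y) = frame u v w *v alg_mult \<nu> x y"
    using assms(1) by (simp add: alg_mult_GL_action)
  show "\<nu> \<in> orbit \<mu>" unfolding \<nu>_def orbit_def using assms(1) invertible_matrix_inv by blast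
qed

lemma frame_axis:
  "frame u v w *v axis 1 1 = u" "frame u v w *v axis 2 1 = v" "frame u v w *v axis 3 1 = w"
  by (simp_all add: frame_mult axis_def)

lemma frame_inject:
  "invertible (frame u v w) \<Longrightarrow> frame u v w *v x = frame u v w *v y \<longleftrightarrow> x = y"
  using matrix_inv_vector(2) by metis

text \<open>A basis of one algebra whose multiplication table is \<open>\<nu>\<close> exhibits an
  isomorphism. Below, \<open>\<mu>\<close> is one of the nine algebras and \<open>\<nu>\<close> a
  member of a parametrized family.\<close>

lemma orbit_by_basis:
  assumes det: "det (frame u v w) \<noteq> 0"
    and prod: "\<forall>i j. alg_mult \<mu> (vector [u, v, w] $ i) (vector [u, v, w] $ j) =
       \<nu> $ (i, j, 1) *s u + \<nu> $ (i, j, 2) *s v + \<nu> $ (i, j, 3) *s w"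
  shows "\<nu> \<in> orbit \<mu>"
proof -
  let ?P = "frame u v w"
  have inv: "invertible ?P" using det by (simp add: invertible_det_nz)
  let ?\<nu> = "GL_action (matrix_inv ?P) \<mu>"
  have ax: "?P *v axis i 1 = vector [u, v, w] $ i" for i
    by (simp add: frame_def vec_eq_iff)
  have "?P *v alg_mult ?\<nu> (axis i 1) (axis j 1) = ?P *v (\<chi> k. \<nu> $ (i, j, k))" for i j
  proof -
    have "?P *v (\<chi> k. \<nu> $ (i, j, k)) =
        \<nu> $ (i, j, 1) *s u + \<nu> $ (i, j, 2) *s v + \<nu> $ (i, j, 3) *s w"
      by (simp add: frame_mult)
    then show ?thesis
      by (simp only: ax prod[rule_format] change_basis(1)[OF inv, symmetric])
  qed
  then have "alg_mult ?\<nu> (axis i 1) (axis j 1) = (\<chi> k. \<nu> $ (i, j, k))" for i j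
    using frame_inject[OF inv] by blast
  then have "?\<nu> $ (i, j, k) = \<nu> $ (i, j, k)" for i j k
    using alg_mult_axis[of ?\<nu> i j k] by simp
  then have "?\<nu> = \<nu>" unfolding structure_constants_eq_iff by blast
  then show ?thesis using change_basis(2)[OF inv, of \<mu>] by argo
qed

section \<open>The action as a rational function of the matrix entries\<close>

lemma adjugate_3:
  assumes "det (g :: complex ^ 3 ^ 3) \<noteq> 0"
  shows "matrix_inv g $ a $ i = det (\<chi> k l. if l = a then (if k = i then 1 else 0) else g $ k $ l) / det g"
proof -
  have "g *v (matrix_inv g *v axis i 1) = axis i 1"
    using assms by (simp add: invertible_det_nz)
  then have "matrix_inv g *v axis i 1 =
      (\<chi> k. det (\<chi> k' l. if l = k then (axis i 1 :: complex ^ 3) $ k' else g $ k' $ l) / det g)"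
    by (rule cramer[OF assms, THEN iffD1])
  then have "(matrix_inv g *v axis i 1) $ a = det (\<chi> k' l. if l = a then (axis i 1 :: complex ^ 3) $ k' else g $ k' $ l) / det g"
    by (simp only: vec_lambda_beta)
  then show ?thesis unfolding matrix_vector_axis by (simp only: axis_def vec_lambda_beta)
qed

lemma det_function_algebra:
  assumes "\<And>i j. (\<lambda>x. g x $ i $ j) \<in> function_algebra G"
  shows "(\<lambda>x. det (g x :: complex ^ 3 ^ 3)) \<in> function_algebra G"
  unfolding det_3 by (intro function_algebra_intros assms)

text \<open>The extra factor \<open>det g\<close> makes the identity valid where \<open>g\<close> is singular and \<open>matrix_inv g\<close> is junk.\<close>

lemma GL_action_rational:
  assumes g: "\<And>i j. (\<lambda>x. g x $ i $ j) \<in> function_algebra G"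
    and M: "\<And>t. (\<lambda>x. M x $ t) \<in> function_algebra G"
  shows "(\<lambda>x. det (g x) ^ 3 * GL_action (g x) (M x) $ t) \<in> function_algebra G"
proof -
  obtain i j k where t: "t = (i, j, k)" by (metis prod_cases3)
  define A where "A x a i = det (\<chi> k l. if l = a then (if k = i then 1 else 0) else g x $ k $ l)" for x a i
  have A: "(\<lambda>x. A x a i) \<in> function_algebra G" for a i
    unfolding A_def
  proof (intro det_function_algebra)
    show "(\<lambda>x. (\<chi> k l. if l = a then (if k = i then 1 else 0) else g x $ k $ l) $ p $ q) \<in> function_algebra G" for p q
      using g by (cases "q = a") (auto intro: function_algebra.intros)
  qed
  have "det (g x) ^ 3 * GL_action (g x) (M x) $ t = det (g x) * (\<Sum>c\<in>UNIV. g x $ k $ c *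
     (\<Sum>a\<in>UNIV. \<Sum>b\<in>UNIV. M x $ (a, b, c) * A x a i * A x b j))" for x
  proof (cases "det (g x) = 0")
    case False
    have "GL_action (g x) (M x) $ t = (\<Sum>c\<in>UNIV. g x $ k $ c *
       (\<Sum>a\<in>UNIV. \<Sum>b\<in>UNIV. M x $ (a, b, c) * A x a i * A x b j)) / det (g x) ^ 2"
      unfolding t GL_action_nth adjugate_3[OF False] A_def[symmetric]
      by (simp add: sum_divide_distrib sum_distrib_left power2_eq_square)
    then show ?thesis using False by (simp add: power3_eq_cube power2_eq_square)
  qed auto
  then show ?thesis
    by (simp only:) (intro function_algebra_intros det_function_algebra g M A)
qed

text \<open>Joining parameters inside \<open>L\<close> joins their images, since the action is
  rational with denominator \<open>det (g x) ^ 3\<close>. With a constant \<open>M\<close> this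
  covers orbits, with a moving table the sets of the chain of length 9.\<close>

lemma rationally_connected_family:
  assumes "x0 \<in> L" "det (g x0) \<noteq> 0"
    and line: "\<And>x y. x \<in> L \<Longrightarrow> y \<in> L \<Longrightarrow> \<exists>l. l 0 = x \<and> l 1 = y \<and> (\<forall>t. l t \<in> L) \<and>
      (\<forall>i j. (\<lambda>t. g (l t) $ i $ j) \<in> function_algebra {\<lambda>t. t}) \<and>
      (\<forall>k. (\<lambda>t. M (l t) $ k) \<in> function_algebra {\<lambda>t. t})"
  shows "rationally_connected {GL_action (g x) (M x) | x. x \<in> L \<and> det (g x) \<noteq> 0}"
  unfolding rationally_connected_def
proof (intro conjI ballI)
  show "{GL_action (g x) (M x) | x. x \<in> L \<and> det (g x) \<noteq> 0} \<noteq> {}" using assms by blast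
next
  fix \<mu> \<nu> assume "\<mu> \<in> {GL_action (g x) (M x) | x. x \<in> L \<and> det (g x) \<noteq> 0}"
    "\<nu> \<in> {GL_action (g x) (M x) | x. x \<in> L \<and> det (g x) \<noteq> 0}"
  then obtain x y where xy: "\<mu> = GL_action (g x) (M x)" "x \<in> L" "det (g x) \<noteq> 0"
    "\<nu> = GL_action (g y) (M y)" "y \<in> L" "det (g y) \<noteq> 0" by blast
  obtain l where l: "l 0 = x" "l 1 = y" "\<And>t. l t \<in> L"
    "\<And>i j. (\<lambda>t. g (l t) $ i $ j) \<in> function_algebra {\<lambda>t. t}"
    "\<And>k. (\<lambda>t. M (l t) $ k) \<in> function_algebra {\<lambda>t. t}" using line[OF xy(2,5)] by blast
  have "rational_curve (\<lambda>t. GL_action (g (l t)) (M (l t))) (\<lambda>t. det (g (l t)) ^ 3)"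
    unfolding rational_curve_def
    by (intro conjI allI GL_action_rational function_algebra_power det_function_algebra l)
  then show "\<exists>f d. rational_curve f d \<and> f 0 = \<mu> \<and> f 1 = \<nu> \<and> d 0 \<noteq> 0 \<and> d 1 \<noteq> 0 \<and>
      (\<forall>t. d t \<noteq> 0 \<longrightarrow> f t \<in> {GL_action (g x) (M x) | x. x \<in> L \<and> det (g x) \<noteq> 0})"
    using l xy by (intro exI[of _ "\<lambda>t. GL_action (g (l t)) (M (l t))"] exI[of _ "\<lambda>t. det (g (l t)) ^ 3"]) auto
qed

lemma irreducible_orbit_closure: "irreducible_subset zariski (zariski closure_of orbit \<mu>)"
proof -
  have "rationally_connected {GL_action (id g) ((\<lambda>_. \<mu>) g) | g. g \<in> UNIV \<and> det (id g) \<noteq> 0}"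
  proof (rule rationally_connected_family[of "mat 1"])
    fix x y :: "complex ^ 3 ^ 3"
    \<comment> \<open>The segment between two matrices may pass through singular ones; these are
      zeros of the denominator.\<close>
    have "(\<lambda>t. id (\<chi> i j. x $ i $ j + t * (y $ i $ j - x $ i $ j)) $ i $ j) \<in> function_algebra {\<lambda>t. t}" for i j
      by simp (intro function_algebra_intros)
    then show "\<exists>l. l 0 = x \<and> l 1 = y \<and> (\<forall>t. l t \<in> UNIV) \<and>
      (\<forall>i j. (\<lambda>t. id (l t) $ i $ j) \<in> function_algebra {\<lambda>t. t}) \<and>
      (\<forall>k. (\<lambda>t. \<mu> $ k) \<in> function_algebra {\<lambda>t. t})"
      by (intro exI[of _ "\<lambda>t. \<chi> i j. x $ i $ j + t * (y $ i $ j - x $ i $ j)"])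
        (auto simp: vec_eq_iff intro: function_algebra.intros)
  qed auto
  moreover have "orbit \<mu> = {GL_action (id g) ((\<lambda>_. \<mu>) g) | g. g \<in> UNIV \<and> det (id g) \<noteq> 0}"
    unfolding orbit_def by (auto simp: invertible_det_nz)
  ultimately show ?thesis using irreducible_subset_zariski_closure by metis
qed

section \<open>Closed invariant conditions\<close>

definition right_trace :: "structure_constants \<Rightarrow> complex ^ 3 \<Rightarrow> complex" where
  "right_trace \<mu> x = (\<Sum>i\<in>UNIV. alg_mult \<mu> (axis i 1) x $ i)"

definition left_trace :: "structure_constants \<Rightarrow> complex ^ 3 \<Rightarrow> complex" where
  "left_trace \<mu> x = (\<Sum>i\<in>UNIV. alg_mult \<mu> x (axis i 1) $ i)"

definition commutator :: "structure_constants \<Rightarrow> complex ^ 3 \<Rightarrow> complex ^ 3 \<Rightarrow> complex ^ 3" where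
  "commutator \<mu> x y = alg_mult \<mu> x y - alg_mult \<mu> y x"

definition commutative_alg :: "structure_constants \<Rightarrow> bool" where
  "commutative_alg \<mu> \<longleftrightarrow> (\<forall>x y. alg_mult \<mu> x y = alg_mult \<mu> y x)"

definition trace_relation :: "complex \<Rightarrow> complex \<Rightarrow> structure_constants \<Rightarrow> bool" where
  "trace_relation a b \<mu> \<longleftrightarrow> (\<forall>x. a * right_trace \<mu> x + b * left_trace \<mu> x = 0)"

text \<open>Commutators are common eigenvectors of all left multiplications, with an eigenvalue that
  is a prescribed combination of the two traces. Expressing the eigenvalue by traces makes the
  condition both polynomial and independent of a basis.\<close>

definition left_commutator_weight :: "complex \<Rightarrow> complex \<Rightarrow> structure_constants \<Rightarrow> bool" where
  "left_commutator_weight a b \<mu> \<longleftrightarrow> (\<forall>x y z. alg_mult \<mu> z (commutator \<mu> x y) =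
     (a * right_trace \<mu> z + b * left_trace \<mu> z) *s commutator \<mu> x y)"

definition right_commutator_weight :: "complex \<Rightarrow> complex \<Rightarrow> structure_constants \<Rightarrow> bool" where
  "right_commutator_weight a b \<mu> \<longleftrightarrow> (\<forall>x y z. alg_mult \<mu> (commutator \<mu> x y) z =
     (a * right_trace \<mu> z + b * left_trace \<mu> z) *s commutator \<mu> x y)"

text \<open>The vectors \<open>T(y) x - T(x) y\<close> run through the kernel of a linear form \<open>T \<noteq> 0\<close>.\<close>

definition traceless_squares_vanish :: "structure_constants \<Rightarrow> bool" where
  "traceless_squares_vanish \<mu> \<longleftrightarrow> (\<forall>x y. alg_mult \<mu>
     (right_trace \<mu> y *s x - right_trace \<mu> x *s y) (right_trace \<mu> y *s x - right_trace \<mu> x *s y) = 0)"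

text \<open>Here \<open>n\<close> lies in the left radical of the bilinear form that sends x, y to
  the right trace of x y. For a commutative associative algebra, nondegeneracy of this form means
  semisimplicity.\<close>

definition degenerate_trace_form :: "structure_constants \<Rightarrow> bool" where
  "degenerate_trace_form \<mu> \<longleftrightarrow> (\<exists>n. n \<noteq> 0 \<and> (\<forall>y. right_trace \<mu> (alg_mult \<mu> n y) = 0))"

lemma alg_mult_left_matrix: "alg_mult \<mu> x y = (\<chi> a b. alg_mult \<mu> x (axis b 1) $ a) *v y"
  by (simp add: alg_mult_def matrix_vector_mult_def vec_eq_iff sum_3 axis_def forall_3 algebra_simps)

lemma alg_mult_right_matrix: "alg_mult \<mu> x y = (\<chi> a b. alg_mult \<mu> (axis b 1) y $ a) *v x"
  by (simp add: alg_mult_def matrix_vector_mult_def vec_eq_iff sum_3 axis_def forall_3 algebra_simps)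

lemma trace_conj:
  assumes "invertible (g :: complex ^ 3 ^ 3)"
  shows "trace (g ** A ** matrix_inv g) = trace A"
proof -
  have "trace (g ** A ** matrix_inv g) = trace (matrix_inv g ** (g ** A))" by (rule trace_mul_sym)
  then show ?thesis using assms by (simp add: matrix_mul_assoc matrix_inv_inverse)
qed

lemma right_trace_GL_action:
  assumes "invertible g" shows "right_trace (GL_action g \<mu>) (g *v y) = right_trace \<mu> y"
proof -
  define R where "R = (\<chi> a b. alg_mult \<mu> (axis b 1) y $ a)"
  have "alg_mult (GL_action g \<mu>) x (g *v y) = g *v (R *v (matrix_inv g *v x))" for x
    unfolding alg_mult_GL_action R_def using assms by (simp only: matrix_inv_vector flip: alg_mult_right_matrix)
  then have "alg_mult (GL_action g \<mu>) (axis i 1) (g *v y) $ i = (g ** R ** matrix_inv g) $ i $ i" for i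
    by (simp only: matrix_vector_mul_assoc matrix_mul_assoc matrix_vector_axis)
  then have "right_trace (GL_action g \<mu>) (g *v y) = trace (g ** R ** matrix_inv g)"
    by (simp add: right_trace_def trace_def)
  also have "\<dots> = right_trace \<mu> y" unfolding trace_conj[OF assms] by (simp add: R_def right_trace_def trace_def)
  finally show ?thesis .
qed

lemma left_trace_GL_action:
  assumes "invertible g" shows "left_trace (GL_action g \<mu>) (g *v y) = left_trace \<mu> y"
proof -
  define R where "R = (\<chi> a b. alg_mult \<mu> y (axis b 1) $ a)"
  have "alg_mult (GL_action g \<mu>) (g *v y) x = g *v (R *v (matrix_inv g *v x))" for x
    unfolding alg_mult_GL_action R_def using assms by (simp only: matrix_inv_vector flip: alg_mult_left_matrix)
  then have "alg_mult (GL_action g \<mu>) (g *v y) (axis i 1) $ i = (g ** R ** matrix_inv g) $ i $ i" for i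
    by (simp only: matrix_vector_mul_assoc matrix_mul_assoc matrix_vector_axis)
  then have "left_trace (GL_action g \<mu>) (g *v y) = trace (g ** R ** matrix_inv g)"
    by (simp add: left_trace_def trace_def)
  also have "\<dots> = left_trace \<mu> y" unfolding trace_conj[OF assms] by (simp add: R_def left_trace_def trace_def)
  finally show ?thesis .
qed

text \<open>Substituting \<open>g *v x\<close> for bound variables turns a condition on the
  transported algebra into the same condition on the original one; the invariance proofs rest on
  this.\<close>

lemma all_vector_GL:
  assumes "invertible (g :: complex ^ 3 ^ 3)"
  shows "(\<forall>x. P x) \<longleftrightarrow> (\<forall>x. P (g *v x))"
  using matrix_inv_vector(1)[OF assms] by metis

lemma alg_mult_GL_action':
  "invertible g \<Longrightarrow> alg_mult (GL_action g \<mu>) (g *v x) (g *v y) = g *v alg_mult \<mu> x y"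
  by (simp add: alg_mult_GL_action)

lemma alg_mult_diff_left: "alg_mult \<mu> (x - x') y = alg_mult \<mu> x y - alg_mult \<mu> x' y"
  by (metis alg_mult_add_left add_diff_cancel diff_add_cancel)

lemma alg_mult_diff_right: "alg_mult \<mu> x (y - y') = alg_mult \<mu> x y - alg_mult \<mu> x y'"
  by (metis alg_mult_add_right add_diff_cancel diff_add_cancel)

lemma commutator_GL_action:
  "invertible g \<Longrightarrow> commutator (GL_action g \<mu>) (g *v x) (g *v y) = g *v commutator \<mu> x y"
  by (simp add: commutator_def alg_mult_GL_action' matrix_vector_mult_diff_distrib)

lemma GL_vector_eq_iff:
  "invertible (g :: complex ^ 3 ^ 3) \<Longrightarrow> g *v x = g *v y \<longleftrightarrow> x = y"
  using matrix_inv_vector(2) by metis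

lemma GL_vector_0_iff:
  "invertible (g :: complex ^ 3 ^ 3) \<Longrightarrow> g *v x = 0 \<longleftrightarrow> x = 0"
  using GL_vector_eq_iff[of g x 0] by simp

lemmas GL_invariance_simps = right_trace_GL_action left_trace_GL_action alg_mult_GL_action'
  commutator_GL_action GL_vector_eq_iff GL_vector_0_iff

lemma commutative_alg_GL_action:
  assumes "invertible g" shows "commutative_alg (GL_action g \<mu>) \<longleftrightarrow> commutative_alg \<mu>"
  unfolding commutative_alg_def
  by (subst (1 2) all_vector_GL[OF assms]) (simp add: GL_invariance_simps assms)

lemma trace_relation_GL_action:
  assumes "invertible g" shows "trace_relation a b (GL_action g \<mu>) \<longleftrightarrow> trace_relation a b \<mu>"
  unfolding trace_relation_def
  by (subst all_vector_GL[OF assms]) (simp add: GL_invariance_simps assms)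

lemma left_commutator_weight_GL_action:
  assumes "invertible g"
  shows "left_commutator_weight a b (GL_action g \<mu>) \<longleftrightarrow> left_commutator_weight a b \<mu>"
  unfolding left_commutator_weight_def
  by (subst (1 2 3) all_vector_GL[OF assms])
    (simp add: GL_invariance_simps assms flip: vector_scalar_commute)

lemma right_commutator_weight_GL_action:
  assumes "invertible g"
  shows "right_commutator_weight a b (GL_action g \<mu>) \<longleftrightarrow> right_commutator_weight a b \<mu>"
  unfolding right_commutator_weight_def
  by (subst (1 2 3) all_vector_GL[OF assms])
    (simp add: GL_invariance_simps assms flip: vector_scalar_commute)

lemma traceless_squares_vanish_GL_action:
  assumes "invertible g"
  shows "traceless_squares_vanish (GL_action g \<mu>) \<longleftrightarrow> traceless_squares_vanish \<mu>"
  unfolding traceless_squares_vanish_def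
  by (subst (1 2) all_vector_GL[OF assms])
    (simp add: GL_invariance_simps assms flip: vector_scalar_commute matrix_vector_mult_diff_distrib)

lemma degenerate_trace_form_GL_action:
  assumes "invertible g"
  shows "degenerate_trace_form (GL_action g \<mu>) \<longleftrightarrow> degenerate_trace_form \<mu>"
proof -
  \<comment> \<open>The existential quantifier is negated, because the substitution rule is stated
    for universal ones.\<close>
  have "(\<forall>n. n \<noteq> 0 \<longrightarrow> \<not> (\<forall>y. right_trace (GL_action g \<mu>) (alg_mult (GL_action g \<mu>) n y) = 0)) \<longleftrightarrow>
      (\<forall>n. n \<noteq> 0 \<longrightarrow> \<not> (\<forall>y. right_trace \<mu> (alg_mult \<mu> n y) = 0))"
    by (subst (1 2) all_vector_GL[OF assms]) (simp add: GL_invariance_simps assms)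
  then show ?thesis unfolding degenerate_trace_form_def by blast
qed

lemma right_alternative_GL_action:
  assumes "invertible g"
  shows "right_alternative (GL_action g \<mu>) \<longleftrightarrow> right_alternative \<mu>"
proof -
  have "associator (GL_action g \<mu>) (g *v x) (g *v y) (g *v z) = g *v associator \<mu> x y z" for x y z
    by (simp add: associator_def alg_mult_GL_action' assms matrix_vector_mult_diff_distrib)
  moreover have "g *v a = - (g *v b) \<longleftrightarrow> a = - b" for a b
    using GL_vector_eq_iff[OF assms, of a "- b"] matrix_vector_mult_diff_distrib[of g 0 b] by simp
  ultimately show ?thesis unfolding right_alternative_def
    by (subst (1 2 3) all_vector_GL[OF assms]) simp
qed

section \<open>Closedness of the conditions\<close>

abbreviation coordinate_algebra :: "(structure_constants \<Rightarrow> complex) set" where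
  "coordinate_algebra \<equiv> function_algebra (range (\<lambda>i x. x $ i))"

lemma alg_mult_polynomial:
  assumes "\<And>i. (\<lambda>\<mu>. x \<mu> $ i) \<in> coordinate_algebra" "\<And>i. (\<lambda>\<mu>. y \<mu> $ i) \<in> coordinate_algebra"
  shows "(\<lambda>\<mu>. alg_mult \<mu> (x \<mu>) (y \<mu>) $ k) \<in> coordinate_algebra"
  unfolding alg_mult_def by simp (intro function_algebra_intros assms)

lemma trace_polynomial:
  assumes "\<And>i. (\<lambda>\<mu>. x \<mu> $ i) \<in> coordinate_algebra"
  shows "(\<lambda>\<mu>. right_trace \<mu> (x \<mu>)) \<in> coordinate_algebra" "(\<lambda>\<mu>. left_trace \<mu> (x \<mu>)) \<in> coordinate_algebra"
  unfolding right_trace_def left_trace_def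
  by (intro function_algebra_sum alg_mult_polynomial assms function_algebra.const)+

lemma closedin_zariski_polynomials:
  assumes "\<And>s. p s \<in> function_algebra (range (\<lambda>i x. x $ i))"
  shows "closedin zariski {\<mu>. \<forall>s. p s \<mu> = 0}"
proof -
  have "{\<mu>. \<forall>s. p s \<mu> = 0} = zero_locus (range p)" by (auto simp: zero_locus_def)
  moreover have "\<forall>q\<in>range p. complex_polynomial_fun q" using assms complex_polynomial_fun_iff by blast
  ultimately show ?thesis unfolding closedin_zariski algebraic_set_def by blast
qed

lemma closedin_zariski_vectors:
  fixes p :: "'s \<Rightarrow> structure_constants \<Rightarrow> complex ^ 3"
  assumes "\<And>s k. (\<lambda>\<mu>. p s \<mu> $ k) \<in> coordinate_algebra"
  shows "closedin zariski {\<mu>. \<forall>s. p s \<mu> = 0}"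
proof -
  have "{\<mu>. \<forall>s. p s \<mu> = 0} = {\<mu>. \<forall>t. p (fst t) \<mu> $ snd t = 0}"
    unfolding split_paired_All by (simp only: vec_eq_iff zero_index fst_conv snd_conv)
  then show ?thesis using closedin_zariski_polynomials[of "\<lambda>t \<mu>. p (fst t) \<mu> $ snd t"] assms by simp
qed

lemmas polynomial_intros = function_algebra_intros alg_mult_polynomial trace_polynomial

lemma closedin_vectors3:
  fixes p :: "complex ^ 3 \<Rightarrow> complex ^ 3 \<Rightarrow> complex ^ 3 \<Rightarrow> structure_constants \<Rightarrow> complex ^ 3"
  assumes "\<And>x y z k. (\<lambda>\<mu>. p x y z \<mu> $ k) \<in> coordinate_algebra"
  shows "closedin zariski {\<mu>. \<forall>x y z. p x y z \<mu> = 0}"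
proof -
  have "{\<mu>. \<forall>x y z. p x y z \<mu> = 0} = {\<mu>. \<forall>s. (case s of (x, y, z) \<Rightarrow> p x y z) \<mu> = 0}"
    by (simp only: split_paired_All prod.case)
  moreover have "(\<lambda>\<mu>. (case s of (x, y, z) \<Rightarrow> p x y z) \<mu> $ k) \<in> coordinate_algebra" for s k
    using assms by (cases s) (simp only: prod.case)
  ultimately show ?thesis using closedin_zariski_vectors[of "\<lambda>s. case s of (x, y, z) \<Rightarrow> p x y z"] by presburger
qed

lemma closedin_right_alternative: "closedin zariski {\<mu>. right_alternative \<mu>}"
proof -
  have "closedin zariski {\<mu>. \<forall>x y z. associator \<mu> x y z + associator \<mu> x z y = 0}"
    by (rule closedin_vectors3, simp only: associator_def vector_add_component vector_minus_component,
        intro polynomial_intros)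
  then show ?thesis by (simp only: right_alternative_def eq_neg_iff_add_eq_0)
qed

lemma closedin_commutative_alg: "closedin zariski {\<mu>. commutative_alg \<mu>}"
proof -
  have "closedin zariski {\<mu>. \<forall>x y z :: complex ^ 3. alg_mult \<mu> x y - alg_mult \<mu> y x = 0}"
    by (rule closedin_vectors3, simp only: vector_minus_component, intro polynomial_intros)
  then show ?thesis by (simp add: commutative_alg_def)
qed

lemma closedin_trace_relation: "closedin zariski {\<mu>. trace_relation a b \<mu>}"
  unfolding trace_relation_def by (rule closedin_zariski_polynomials, intro polynomial_intros)

lemma closedin_left_commutator_weight: "closedin zariski {\<mu>. left_commutator_weight a b \<mu>}"
proof -
  have "closedin zariski {\<mu>. \<forall>x y z. alg_mult \<mu> z (commutator \<mu> x y) -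
     (a * right_trace \<mu> z + b * left_trace \<mu> z) *s commutator \<mu> x y = 0}"
    by (rule closedin_vectors3, simp only: commutator_def vector_minus_component vector_smult_component,
        intro polynomial_intros, simp only: vector_minus_component, intro polynomial_intros)
  then show ?thesis by (simp add: left_commutator_weight_def)
qed

lemma closedin_right_commutator_weight: "closedin zariski {\<mu>. right_commutator_weight a b \<mu>}"
proof -
  have "closedin zariski {\<mu>. \<forall>x y z. alg_mult \<mu> (commutator \<mu> x y) z -
     (a * right_trace \<mu> z + b * left_trace \<mu> z) *s commutator \<mu> x y = 0}"
    by (rule closedin_vectors3, simp only: commutator_def vector_minus_component vector_smult_component,
        intro polynomial_intros, simp only: vector_minus_component, intro polynomial_intros)
  then show ?thesis by (simp add: right_commutator_weight_def)
qed

lemma closedin_traceless_squares_vanish: "closedin zariski {\<mu>. traceless_squares_vanish \<mu>}"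
proof -
  have "closedin zariski {\<mu>. \<forall>x y z :: complex ^ 3. alg_mult \<mu>
     (right_trace \<mu> y *s x - right_trace \<mu> x *s y) (right_trace \<mu> y *s x - right_trace \<mu> x *s y) = 0}"
    by (rule closedin_vectors3, intro alg_mult_polynomial;
        simp only: vector_minus_component vector_smult_component, intro polynomial_intros)
  then show ?thesis by (simp add: traceless_squares_vanish_def)
qed

lemma trace_of_product_axes:
  "right_trace \<mu> (alg_mult \<mu> n y) = (\<Sum>j\<in>UNIV. y $ j * right_trace \<mu> (alg_mult \<mu> n (axis j 1)))"
  by (simp add: right_trace_def alg_mult_def sum_3 axis_def forall_3 algebra_simps)

lemma det_zero_iff_kernel: "det (A :: complex ^ 'n ^ 'n) = 0 \<longleftrightarrow> (\<exists>n. n \<noteq> 0 \<and> A *v n = 0)"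
  using invertible_det_nz[of A] invertible_left_inverse[of A] matrix_left_invertible_ker[of A] by blast

text \<open>The existential condition is closed because it is the vanishing of a determinant:
  \<open>A \<mu>\<close> is the Gram matrix, transposed so that its kernel is the left
  radical.\<close>

lemma closedin_degenerate_trace_form: "closedin zariski {\<mu>. degenerate_trace_form \<mu>}"
proof -
  define A where "A \<mu> = (\<chi> j i. right_trace \<mu> (alg_mult \<mu> (axis i 1) (axis j 1)))" for \<mu>
  have comp: "(A \<mu> *v n) $ j = right_trace \<mu> (alg_mult \<mu> n (axis j 1))" for \<mu> n j
    by (simp add: A_def matrix_vector_mult_def right_trace_def alg_mult_def sum_3 axis_def algebra_simps)
  have "(\<forall>y. right_trace \<mu> (alg_mult \<mu> n y) = 0) \<longleftrightarrow> A \<mu> *v n = 0" for \<mu> n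
    unfolding vec_eq_iff comp zero_index by (metis (no_types, lifting) trace_of_product_axes mult_zero_right sum.neutral)
  then have "degenerate_trace_form \<mu> \<longleftrightarrow> det (A \<mu>) = 0" for \<mu>
    unfolding degenerate_trace_form_def det_zero_iff_kernel by simp
  moreover have "closedin zariski {\<mu>. \<forall>s :: unit. det (A \<mu>) = 0}"
    by (rule closedin_zariski_polynomials, intro det_function_algebra, simp only: A_def vec_lambda_beta,
        intro polynomial_intros)
  ultimately show ?thesis by simp
qed

section \<open>The nine algebras\<close>

lemmas alg_mult_expand = alg_mult_def alg_table_def sum_3 vec_eq_iff forall_3

lemma alg_mult_A07: "alg_mult A07 x y = vector [x$1 * y$1, x$2 * y$2, x$3 * y$3]"
  and alg_mult_A17: "alg_mult A17 x y = vector [x$1 * y$1, x$1 * y$2, x$1 * y$3]"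
  and alg_mult_A18: "alg_mult A18 x y = vector [x$1 * y$1, x$2 * y$1, x$3 * y$1]"
  and alg_mult_A19: "alg_mult A19 x y = vector [x$1 * y$1, x$2 * y$1, x$1 * y$3]"
  and alg_mult_A20: "alg_mult A20 x y = vector [x$1 * y$1, x$2 * y$2, x$1 * y$3 + x$3 * y$2]"
  and alg_mult_A23: "alg_mult A23 x y = vector [x$1 * y$1, x$2 * y$2, x$1 * y$3]"
  and alg_mult_A24: "alg_mult A24 x y = vector [x$1 * y$1, x$2 * y$2, x$3 * y$1]"
  and alg_mult_R09: "alg_mult R09 x y = vector [x$1 * y$1, x$2 * y$1, x$2 * y$2]"
  and alg_mult_R10: "alg_mult R10 x y = vector [x$1 * y$1, x$1 * y$2, x$1 * y$3 + x$2 * y$2 + x$3 * y$1]"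
  unfolding A07_def A17_def A18_def A19_def A20_def A23_def A24_def R09_def R10_def
  by (simp_all add: alg_mult_expand)

lemmas alg_mult_table = alg_mult_A07 alg_mult_A17 alg_mult_A18 alg_mult_A19 alg_mult_A20 alg_mult_A23
  alg_mult_A24 alg_mult_R09 alg_mult_R10

datatype component = C07 | C17 | C18 | C19 | C20 | C23 | C24 | D09 | D10

lemma UNIV_component: "UNIV = {C07, C17, C18, C19, C20, C23, C24, D09, D10}"
  using component.exhaust by auto

fun component_algebra :: "component \<Rightarrow> structure_constants" where
  "component_algebra C07 = A07" | "component_algebra C17 = A17" | "component_algebra C18 = A18"
| "component_algebra C19 = A19" | "component_algebra C20 = A20" | "component_algebra C23 = A23"
| "component_algebra C24 = A24" | "component_algebra D09 = R09" | "component_algebra D10 = R10"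

text \<open>The constants are read off the tables. The pair of right and left trace is (x1, 3 x1)
  for \<open>A17\<close>, (3 x1, x1) for \<open>A18\<close>, (2 x1, 2 x1) for \<open>A19\<close>, (2
  x1, x1) for \<open>R09\<close> and (2 x1, 3 x1) for \<open>R10\<close>. In \<open>A20\<close>,
  \<open>A23\<close>, \<open>A24\<close> it is (x1 + 2 x2, 2 x1 + x2), (x1 + x2, 2 x1 + x2), (2 x1 +
  x2, x1 + x2); the commutators there span the line of e3, on which x acts from the right by x2, 0,
  x1 and from the left by x1, x1, 0. Degeneracy of the trace form is added where \<open>A07\<close>
  would otherwise pass.\<close>

fun separating_condition :: "component \<Rightarrow> structure_constants \<Rightarrow> bool" where
  "separating_condition C07 \<mu> = commutative_alg \<mu>"
| "separating_condition C17 \<mu> = trace_relation 3 (-1) \<mu>"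
| "separating_condition C18 \<mu> = trace_relation 1 (-3) \<mu>"
| "separating_condition C19 \<mu> = (trace_relation 1 (-1) \<mu> \<and> degenerate_trace_form \<mu>)"
| "separating_condition C20 \<mu> = (right_commutator_weight (2/3) (-1/3) \<mu> \<and>
     left_commutator_weight (-1/3) (2/3) \<mu> \<and> degenerate_trace_form \<mu>)"
| "separating_condition C23 \<mu> = (right_commutator_weight 0 0 \<mu> \<and>
     left_commutator_weight (-1) 1 \<mu> \<and> degenerate_trace_form \<mu>)"
| "separating_condition C24 \<mu> = (right_commutator_weight 1 (-1) \<mu> \<and>
     left_commutator_weight 0 0 \<mu> \<and> degenerate_trace_form \<mu>)"
| "separating_condition D09 \<mu> = trace_relation 1 (-2) \<mu>"
| "separating_condition D10 \<mu> = trace_relation 3 (-2) \<mu>"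

text \<open>Holds on those algebras of the orbit closure that lie neither in the orbit nor in another
  orbit closure; the components \<open>17\<close> to \<open>20\<close> have none.\<close>

fun boundary_condition :: "component \<Rightarrow> structure_constants \<Rightarrow> bool" where
  "boundary_condition C07 \<mu> = degenerate_trace_form \<mu>"
| "boundary_condition C23 \<mu> = trace_relation 2 (-1) \<mu>"
| "boundary_condition C24 \<mu> = trace_relation 2 (-3) \<mu>"
| "boundary_condition D09 \<mu> = traceless_squares_vanish \<mu>"
| "boundary_condition D10 \<mu> = traceless_squares_vanish \<mu>"
| "boundary_condition _ \<mu> = False"

lemma separating_condition_GL_action:
  "invertible g \<Longrightarrow> separating_condition c (GL_action g \<mu>) \<longleftrightarrow> separating_condition c \<mu>"
  by (cases c) (simp_all add: commutative_alg_GL_action trace_relation_GL_action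
      left_commutator_weight_GL_action right_commutator_weight_GL_action degenerate_trace_form_GL_action)

lemma boundary_condition_GL_action:
  "invertible g \<Longrightarrow> boundary_condition c (GL_action g \<mu>) \<longleftrightarrow> boundary_condition c \<mu>"
  by (cases c) (simp_all add: trace_relation_GL_action traceless_squares_vanish_GL_action
      degenerate_trace_form_GL_action)

lemma closedin_separating_condition: "closedin zariski {\<mu>. separating_condition c \<mu>}"
  by (cases c) (auto simp: Collect_conj_eq intro!: closedin_Int closedin_commutative_alg closedin_trace_relation
      closedin_left_commutator_weight closedin_right_commutator_weight closedin_degenerate_trace_form)

lemma closedin_boundary_condition: "closedin zariski {\<mu>. boundary_condition c \<mu>}"
  by (cases c) (simp_all add: closedin_trace_relation closedin_degenerate_trace_form
      closedin_traceless_squares_vanish)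

lemma right_alternative_component_algebra: "right_alternative (component_algebra c)"
  unfolding right_alternative_def associator_def
  by (cases c) (simp_all add: alg_mult_table vec_eq_iff forall_3 algebra_simps)

lemmas trace_table = right_trace_def left_trace_def alg_mult_table sum_3 axis_def

lemma degenerate_trace_formI:
  "n \<noteq> 0 \<Longrightarrow> (\<And>y. right_trace \<mu> (alg_mult \<mu> n y) = 0) \<Longrightarrow> degenerate_trace_form \<mu>"
  unfolding degenerate_trace_form_def by blast

lemma degenerate_trace_form_components:
  "degenerate_trace_form A19" "degenerate_trace_form A20" "degenerate_trace_form A23"
  "degenerate_trace_form A24"
  by (rule degenerate_trace_formI[of "vector [0, 0, 1]"]; simp add: trace_table vec_eq_iff forall_3)+

lemma nondegenerate_trace_form_A07: "\<not> degenerate_trace_form A07"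
proof
  assume "degenerate_trace_form A07"
  then obtain n where n: "n \<noteq> 0" "\<And>y. right_trace A07 (alg_mult A07 n y) = 0"
    unfolding degenerate_trace_form_def by blast
  have "n $ 1 = 0" "n $ 2 = 0" "n $ 3 = 0"
    using n(2)[of "axis 1 1"] n(2)[of "axis 2 1"] n(2)[of "axis 3 1"] by (simp_all add: trace_table)
  then show False using n(1) by (simp add: vec_eq_iff forall_3)
qed

lemma separating_condition_self: "separating_condition c (component_algebra c)"
  by (cases c)
    (simp_all add: degenerate_trace_form_components commutative_alg_def trace_relation_def
      left_commutator_weight_def right_commutator_weight_def commutator_def trace_table
      vec_eq_iff forall_3 field_simps)

text \<open>Single test vectors suffice for the separation. The coordinate 7 is a generic value: at
  [1, 1, 0] the algebra \<open>A23\<close> has traces 2 and 3 and would satisfy the relation 3, -2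
  of \<open>R10\<close>. The commutator of [1, 0, 0] and [0, 1, 1] used below is nonzero in all
  eight noncommutative algebras.\<close>

lemma trace_relation_D: "trace_relation a b \<mu> \<Longrightarrow>
    a * right_trace \<mu> (vector [1, 7, 0]) + b * left_trace \<mu> (vector [1, 7, 0]) = 0"
  unfolding trace_relation_def by blast

lemma commutative_alg_D: "commutative_alg \<mu> \<Longrightarrow>
    alg_mult \<mu> (vector [1, 0, 0]) (vector [0, 1, 1]) = alg_mult \<mu> (vector [0, 1, 1]) (vector [1, 0, 0])"
  unfolding commutative_alg_def by blast

lemma left_commutator_weight_D: "left_commutator_weight a b \<mu> \<Longrightarrow>
    alg_mult \<mu> (vector [1, 7, 0]) (commutator \<mu> (vector [1, 0, 0]) (vector [0, 1, 1])) =
    (a * right_trace \<mu> (vector [1, 7, 0]) + b * left_trace \<mu> (vector [1, 7, 0])) *s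
      commutator \<mu> (vector [1, 0, 0]) (vector [0, 1, 1])"
  unfolding left_commutator_weight_def by blast

lemma right_commutator_weight_D: "right_commutator_weight a b \<mu> \<Longrightarrow>
    alg_mult \<mu> (commutator \<mu> (vector [1, 0, 0]) (vector [0, 1, 1])) (vector [1, 7, 0]) =
    (a * right_trace \<mu> (vector [1, 7, 0]) + b * left_trace \<mu> (vector [1, 7, 0])) *s
      commutator \<mu> (vector [1, 0, 0]) (vector [0, 1, 1])"
  unfolding right_commutator_weight_def by blast

lemma separating_condition_iff: "separating_condition c (component_algebra c') \<longleftrightarrow> c = c'"
proof
  assume "separating_condition c (component_algebra c')"
  then show "c = c'"
    by (cases c; cases c')
      (simp_all add: nondegenerate_trace_form_A07, (auto dest!: trace_relation_D commutative_alg_D left_commutator_weight_D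
        right_commutator_weight_D simp: commutator_def trace_table vec_eq_iff forall_3)+)
qed (use separating_condition_self in simp)

lemma traceless_squares_vanish_D: "traceless_squares_vanish \<mu> \<Longrightarrow>
    alg_mult \<mu>
      (right_trace \<mu> (vector [1, 0, 0]) *s vector [0, 1, 0] - right_trace \<mu> (vector [0, 1, 0]) *s vector [1, 0, 0])
      (right_trace \<mu> (vector [1, 0, 0]) *s vector [0, 1, 0] - right_trace \<mu> (vector [0, 1, 0]) *s vector [1, 0, 0])
     = 0"
  unfolding traceless_squares_vanish_def by blast

lemma not_boundary_condition_component: "\<not> boundary_condition c (component_algebra c)"
  by (cases c) (auto simp: nondegenerate_trace_form_A07 trace_table vec_eq_iff forall_3
      dest!: trace_relation_D traceless_squares_vanish_D)

section \<open>The families of right alternative algebras\<close>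

text \<open>Membership in a closure alone would yield only the components. The second clause, which
  confines the points outside the orbit to a closed locus, is what later makes the orbits
  open.\<close>

definition classified :: "structure_constants \<Rightarrow> bool" where
  "classified \<mu> \<longleftrightarrow> (\<exists>c. \<mu> \<in> zariski closure_of orbit (component_algebra c) \<and>
     (\<mu> \<in> orbit (component_algebra c) \<or> boundary_condition c \<mu>))"

lemma classified_orbit:
  assumes "\<nu> \<in> orbit \<mu>" "classified \<nu>" shows "classified \<mu>"
proof -
  have "\<mu> \<in> orbit \<nu>" using assms(1) by (rule orbit_sym)
  then obtain g where g: "invertible g" "\<mu> = GL_action g \<nu>" unfolding orbit_def by blast
  obtain c where c: "\<nu> \<in> zariski closure_of orbit (component_algebra c)"
    "\<nu> \<in> orbit (component_algebra c) \<or> boundary_condition c \<nu>" using assms(2) unfolding classified_def by blast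
  have "\<mu> \<in> zariski closure_of orbit (component_algebra c)"
    using g c(1) GL_action_zariski_closure by blast
  moreover have "\<mu> \<in> orbit (component_algebra c) \<or> boundary_condition c \<mu>"
    using c(2) \<open>\<mu> \<in> orbit \<nu>\<close> orbit_trans boundary_condition_GL_action[OF g(1)] g(2) by blast
  ultimately show ?thesis unfolding classified_def by blast
qed

lemma classified_by_orbit: "\<mu> \<in> orbit (component_algebra c) \<Longrightarrow> classified \<mu>"
  unfolding classified_def using closure_of_subset[of "orbit (component_algebra c)" zariski] by auto

lemma structure_table_nth [simp]: "structure_table m $ (i, j, k) = m $ i $ j $ k"
  by (simp add: structure_table_def)

lemma structure_table_polynomial:
  assumes "\<forall>i j k. (\<lambda>s. m s $ i $ j $ k) \<in> function_algebra G"
  shows "(\<lambda>s. structure_table (m s) $ t) \<in> function_algebra G"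
  using assms by (cases t) simp

text \<open>The given table is the point at parameter 0 of a curve that meets the complement of the
  orbit finitely often; the last assumption treats the case that the starting point is one of these
  exceptions.\<close>

lemma classified_by_curve:
  assumes "\<forall>i j k. (\<lambda>s. m s $ i $ j $ k) \<in> function_algebra {\<lambda>s. s}"
    and "finite A" "\<And>s. s \<notin> A \<Longrightarrow> structure_table (m s) \<in> orbit (component_algebra c)"
    and "structure_table (m 0) \<notin> orbit (component_algebra c) \<Longrightarrow> boundary_condition c (structure_table (m 0))"
  shows "classified (structure_table (m 0))"
proof -
  have "{s. structure_table (m s) \<notin> orbit (component_algebra c)} \<subseteq> A" using assms(3) by blast
  then have "structure_table (m 0) \<in> zariski closure_of orbit (component_algebra c)"
    using curve_in_zariski_closure[of "\<lambda>s. structure_table (m s)"] structure_table_polynomial[OF assms(1)]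
      finite_subset[OF _ assms(2)] by blast
  then show ?thesis unfolding classified_def using assms(4) by blast
qed

lemmas table_simps = structure_table_nth alg_mult_def right_trace_def left_trace_def sum_3 axis_def
  vec_eq_iff forall_3

text \<open>Modulo e3 the product is x y = t y1 x, and a bilinear form with arbitrary coefficients
  takes values in the line of e3, which annihilates everything. At \<open>t = 0\<close> these are
  the algebras given by a bilinear form alone.\<close>

definition family_R09 :: "complex \<Rightarrow> complex \<Rightarrow> complex \<Rightarrow> complex \<Rightarrow> complex \<Rightarrow> complex ^ 3 ^ 3 ^ 3" where
  "family_R09 t b11 b12 b21 b22 = vector [
     vector [vector [t, 0, b11], vector [0, 0, b12], vector [0, 0, 0]],
     vector [vector [0, t, b21], vector [0, 0, b22], vector [0, 0, 0]],
     vector [vector [0, 0, 0], vector [0, 0, 0], vector [0, 0, 0]]]"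

lemma alg_mult_family_R09: "alg_mult (structure_table (family_R09 t b11 b12 b21 b22)) x y =
    vector [t * x$1 * y$1, t * x$2 * y$1, b11 * x$1 * y$1 + b12 * x$1 * y$2 + b21 * x$2 * y$1 + b22 * x$2 * y$2]"
  by (simp add: table_simps family_R09_def)

lemma family_R09_orbit:
  assumes "t \<noteq> 0" "b22 \<noteq> 0"
  shows "structure_table (family_R09 t b11 b12 b21 b22) \<in> orbit R09"
proof -
  \<comment> \<open>In \<open>R09\<close> the second vector must square to \<open>b22\<close> e3,
    and the first times the second must be \<open>b12\<close> e3. This fixes \<open>d\<close> and
    \<open>b\<close>; the third coordinates of the basis then absorb \<open>b11\<close> and
    \<open>b21\<close>.\<close>
  define d where "d = csqrt b22"
  have d: "d ^ 2 = b22" "d \<noteq> 0" using assms by (auto simp: d_def)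
  define b where "b = b12 / d"
  have b: "d * b = b12" using d by (simp add: b_def)
  show ?thesis
    by (rule orbit_by_basis[of "vector [t, b, (b ^ 2 - b11) / t]" "vector [0, d, (b12 - b21) / t]" "vector [0, 0, 1]"])
      (use assms d b in \<open>simp_all add: frame_def det_3 forall_3 alg_mult_R09 family_R09_def vec_eq_iff\<close>,
       simp_all add: field_simps power2_eq_square)
qed

text \<open>The right trace is 2 t x1. If \<open>t = 0\<close>, the vectors to be squared vanish;
  otherwise they have first coordinate 0, and their squares are multiples of
  \<open>b22\<close>.\<close>

lemma family_R09_traceless:
  assumes "t = 0 \<or> b22 = 0"
  shows "traceless_squares_vanish (structure_table (family_R09 t b11 b12 b21 b22))"
proof -
  have "right_trace (structure_table (family_R09 t b11 b12 b21 b22)) x = 2 * t * x $ 1" for x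
    by (simp add: right_trace_def alg_mult_family_R09 sum_3 axis_def)
  then show ?thesis using assms
    by (auto simp: traceless_squares_vanish_def alg_mult_family_R09 vec_eq_iff forall_3)
qed

lemma classified_family_R09: "classified (structure_table (family_R09 t b11 b12 b21 b22))"
proof -
  have "classified (structure_table ((\<lambda>s. family_R09 (t + s) b11 b12 b21 (b22 + s)) 0))"
  proof (rule classified_by_curve[where c = D09 and A = "{-t, -b22}"])
    show "\<forall>i j k. (\<lambda>s. family_R09 (t + s) b11 b12 b21 (b22 + s) $ i $ j $ k) \<in> function_algebra {\<lambda>s. s}"
      by (simp add: forall_3 family_R09_def) (intro conjI function_algebra_intros)
    show "structure_table (family_R09 (t + s) b11 b12 b21 (b22 + s)) \<in> orbit (component_algebra D09)"
      if "s \<notin> {- t, - b22}" for s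
      using that family_R09_orbit by (auto simp: add_eq_0_iff)
  qed (simp_all, use family_R09_orbit family_R09_traceless in blast)
  then show ?thesis by simp
qed

text \<open>Put n = e2 - r e1. Then e1 is a two-sided unit for n, and n n = 0, e3 e1 = u n, e1 e3 =
  e3 - u n, e3 e3 = y n. So n plays the part of the third basis vector of \<open>R10\<close>, and e3
  that of the second, whose square it is up to the factor \<open>y\<close>.\<close>

definition family_R10 :: "complex \<Rightarrow> complex \<Rightarrow> complex \<Rightarrow> complex ^ 3 ^ 3 ^ 3" where
  "family_R10 r u y = vector [
     vector [vector [1, 0, 0], vector [0, 1, 0], vector [u * r, - u, 1]],
     vector [vector [0, 1, 0], vector [-(r^2), 2 * r, 0], vector [r * u * r, - (r * u), r]],
     vector [vector [- (u * r), u, 0], vector [- (r * u * r), r * u, 0], vector [- (y * r), y, 0]]]"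

lemma family_R10_orbit:
  assumes "y \<noteq> 0"
  shows "structure_table (family_R10 r u y) \<in> orbit R10"
  by (rule orbit_by_basis[of "vector [1, - u / y, - (u^2 / y^2)]" "vector [r, - r * u / y, - r * (u^2 / y^2) + 1 / y]" "vector [0, 1, 2 * u / y]"])
    (use assms in \<open>simp_all add: frame_def det_3 forall_3 alg_mult_R10 family_R10_def vec_eq_iff\<close>,
       (simp_all add: field_simps power2_eq_square)?)

lemma family_R10_boundary:
  assumes "y = 0"
  shows "traceless_squares_vanish (structure_table (family_R10 r u y))"
proof -
  have "right_trace (structure_table (family_R10 r u y)) x = 2 * (x $ 1 + r * x $ 2)" for x
    by (simp add: table_simps family_R10_def algebra_simps)
  then show ?thesis using assms
    by (simp add: traceless_squares_vanish_def alg_mult_def sum_3 vec_eq_iff forall_3 family_R10_def)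
      (simp add: algebra_simps power2_eq_square)?
qed

lemma classified_family_R10: "classified (structure_table (family_R10 r u y))"
proof -
  have "classified (structure_table ((\<lambda>s. family_R10 r u (y + s)) 0))"
  proof (rule classified_by_curve[where c = D10 and A = "{- y}"])
    show "\<forall>i j k. (\<lambda>s. family_R10 r u (y + s) $ i $ j $ k) \<in> function_algebra {\<lambda>s. s}"
      by (simp add: forall_3 family_R10_def) (intro conjI function_algebra_intros)
    show "structure_table (family_R10 r u (y + s)) \<in> orbit (component_algebra D10)"
      if "s \<notin> {- y}" for s
    proof -
      have "y + s \<noteq> 0" using that by (auto simp: field_simps add_eq_0_iff)
      then show ?thesis using family_R10_orbit by simp
    qed
  qed (simp_all, use family_R10_orbit family_R10_boundary in blast)
  then show ?thesis by simp
qed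

section \<open>Degenerations of A23, A24 and A20\<close>

definition family_A23 :: "complex \<Rightarrow> complex ^ 3 ^ 3 ^ 3" where
  "family_A23 p = vector [
     vector [vector [1, 0, 0], vector [0, 1, 0], vector [0, 0, 0]],
     vector [vector [0, 0, 0], vector [0, 0, 0], vector [0, 0, 0]],
     vector [vector [0, 0, 0], vector [0, 0, 0], vector [0, 0, p]]]"

lemma family_A23_orbit:
  assumes "p \<noteq> 0"
  shows "structure_table (family_A23 p) \<in> orbit A23"
  by (rule orbit_by_basis[of "vector [1, 0, 0]" "vector [0, 0, 1]" "vector [0, p, 0]"])
    (use assms in \<open>simp_all add: frame_def det_3 forall_3 alg_mult_A23 family_A23_def vec_eq_iff\<close>,
       (simp_all add: field_simps power2_eq_square)?)

lemma family_A23_boundary: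
  assumes "p = 0"
  shows "trace_relation 2 (-1) (structure_table (family_A23 p))"
  using assms by (auto simp: trace_relation_def table_simps family_A23_def algebra_simps)

lemma classified_family_A23: "classified (structure_table (family_A23 p))"
proof -
  have "classified (structure_table ((\<lambda>s. family_A23 (p + s)) 0))"
  proof (rule classified_by_curve[where c = C23 and A = "{- p}"])
    show "\<forall>i j k. (\<lambda>s. family_A23 (p + s) $ i $ j $ k) \<in> function_algebra {\<lambda>s. s}"
      by (simp add: forall_3 family_A23_def) (intro conjI function_algebra_intros)
    show "structure_table (family_A23 (p + s)) \<in> orbit (component_algebra C23)"
      if "s \<notin> {- p}" for s
    proof -
      have "p + s \<noteq> 0" using that by (auto simp: field_simps add_eq_0_iff)
      then show ?thesis using family_A23_orbit by simp
    qed
  qed (simp_all, use family_A23_orbit family_A23_boundary in blast)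
  then show ?thesis by simp
qed

text \<open>In the unital plane of e1 and e2 the element e2 has eigenvalues \<open>r\<close> and
  \<open>q - r\<close>, and it acts on e3 from the left by the first. When they coincide, that is
  for \<open>q = 2 * r\<close>, the table is \<open>family_R10 r 0 0\<close>.\<close>

definition family_A23' :: "complex \<Rightarrow> complex \<Rightarrow> complex ^ 3 ^ 3 ^ 3" where
  "family_A23' r q = vector [
     vector [vector [1, 0, 0], vector [0, 1, 0], vector [0, 0, 1]],
     vector [vector [0, 1, 0], vector [r * (r - q), q, 0], vector [0, 0, r]],
     vector [vector [0, 0, 0], vector [0, 0, 0], vector [0, 0, 0]]]"

lemma family_A23'_orbit:
  assumes "q \<noteq> 2 * r"
  shows "structure_table (family_A23' r q) \<in> orbit A23"
  by (rule orbit_by_basis[of "vector [1, 1, 0]" "vector [r, q - r, 0]" "vector [0, 0, 1]"])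
    (use assms in \<open>simp_all add: frame_def det_3 forall_3 alg_mult_A23 family_A23'_def vec_eq_iff\<close>,
       (simp_all add: field_simps power2_eq_square)?)

text \<open>The opposite table of \<open>family_A23'\<close>. Here coincidence of the eigenvalues is
  covered by the boundary condition of \<open>A24\<close>.\<close>

definition family_A24 :: "complex \<Rightarrow> complex \<Rightarrow> complex ^ 3 ^ 3 ^ 3" where
  "family_A24 r q = vector [
     vector [vector [1, 0, 0], vector [0, 1, 0], vector [0, 0, 0]],
     vector [vector [0, 1, 0], vector [r * (r - q), q, 0], vector [0, 0, 0]],
     vector [vector [0, 0, 1], vector [0, 0, r], vector [0, 0, 0]]]"

lemma family_A24_orbit:
  assumes "q \<noteq> 2 * r"
  shows "structure_table (family_A24 r q) \<in> orbit A24"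
  by (rule orbit_by_basis[of "vector [1, 1, 0]" "vector [r, q - r, 0]" "vector [0, 0, 1]"])
    (use assms in \<open>simp_all add: frame_def det_3 forall_3 alg_mult_A24 family_A24_def vec_eq_iff\<close>,
       (simp_all add: field_simps power2_eq_square)?)

lemma family_A24_boundary:
  assumes "q = 2 * r"
  shows "trace_relation 2 (-3) (structure_table (family_A24 r q))"
  using assms by (auto simp: trace_relation_def table_simps family_A24_def algebra_simps)

lemma classified_family_A24: "classified (structure_table (family_A24 r q))"
proof -
  have "classified (structure_table ((\<lambda>s. family_A24 r (q + s)) 0))"
  proof (rule classified_by_curve[where c = C24 and A = "{2 * r - q}"])
    show "\<forall>i j k. (\<lambda>s. family_A24 r (q + s) $ i $ j $ k) \<in> function_algebra {\<lambda>s. s}"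
      by (simp add: forall_3 family_A24_def) (intro conjI function_algebra_intros)
    show "structure_table (family_A24 r (q + s)) \<in> orbit (component_algebra C24)"
      if "s \<notin> {2 * r - q}" for s
    proof -
      have "q + s \<noteq> 2 * r" using that by (auto simp: field_simps add_eq_0_iff)
      then show ?thesis using family_A24_orbit by simp
    qed
  qed (simp_all, use family_A24_orbit family_A24_boundary in blast)
  then show ?thesis by simp
qed

definition family_A24' :: "complex \<Rightarrow> complex ^ 3 ^ 3 ^ 3" where
  "family_A24' p = vector [
     vector [vector [1, 0, 0], vector [0, 0, 0], vector [0, 0, 0]],
     vector [vector [0, 1, 0], vector [0, 0, 0], vector [0, 0, 0]],
     vector [vector [0, 0, 0], vector [0, 0, 0], vector [0, 0, p]]]"

lemma family_A24'_orbit: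
  assumes "p \<noteq> 0"
  shows "structure_table (family_A24' p) \<in> orbit A24"
  by (rule orbit_by_basis[of "vector [1, 0, 0]" "vector [0, 0, 1]" "vector [0, p, 0]"])
    (use assms in \<open>simp_all add: frame_def det_3 forall_3 alg_mult_A24 family_A24'_def vec_eq_iff\<close>,
       (simp_all add: field_simps power2_eq_square)?)

text \<open>\<open>A20\<close> is isomorphic to its opposite by exchanging its two idempotents;
  hence this table and the opposite one, \<open>family_A20'\<close>, both belong to its
  orbit.\<close>

definition family_A20 :: "complex \<Rightarrow> complex ^ 3 ^ 3 ^ 3" where
  "family_A20 p = vector [
     vector [vector [1, 0, 0], vector [0, 0, 0], vector [0, 0, 0]],
     vector [vector [0, 1, 0], vector [0, 0, 0], vector [0, 0, 0]],
     vector [vector [0, 0, 0], vector [0, p, 0], vector [0, 0, p]]]"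

lemma family_A20_orbit:
  assumes "p \<noteq> 0"
  shows "structure_table (family_A20 p) \<in> orbit A20"
  by (rule orbit_by_basis[of "vector [0, 1, 0]" "vector [0, 0, 1]" "vector [p, 0, 0]"])
    (use assms in \<open>simp_all add: frame_def det_3 forall_3 alg_mult_A20 family_A20_def vec_eq_iff\<close>,
       (simp_all add: field_simps power2_eq_square)?)

definition family_A20' :: "complex \<Rightarrow> complex ^ 3 ^ 3 ^ 3" where
  "family_A20' p = vector [
     vector [vector [1, 0, 0], vector [0, 1, 0], vector [0, 0, 0]],
     vector [vector [0, 0, 0], vector [0, 0, 0], vector [0, p, 0]],
     vector [vector [0, 0, 0], vector [0, 0, 0], vector [0, 0, p]]]"

lemma family_A20'_orbit:
  assumes "p \<noteq> 0"
  shows "structure_table (family_A20' p) \<in> orbit A20"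
  by (rule orbit_by_basis[of "vector [1, 0, 0]" "vector [0, 0, 1]" "vector [0, p, 0]"])
    (use assms in \<open>simp_all add: frame_def det_3 forall_3 alg_mult_A20 family_A20'_def vec_eq_iff\<close>,
       (simp_all add: field_simps power2_eq_square)?)

section \<open>Degenerations of A07\<close>

text \<open>The basis consists of \<open>x\<close>, \<open>x\<^sup>2\<close>, \<open>x\<^sup>3\<close>, and \<open>x\<^sup>4 = a x + b x\<^sup>2 + c x\<^sup>3\<close>.\<close>

definition monogenic_table :: "complex \<Rightarrow> complex \<Rightarrow> complex \<Rightarrow> complex ^ 3 ^ 3 ^ 3" where
  "monogenic_table a b c = vector [
     vector [vector [0, 1, 0], vector [0, 0, 1], vector [a, b, c]],
     vector [vector [0, 0, 1], vector [a, b, c], vector [c * a, a + c * b, b + c^2]],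
     vector [vector [a, b, c], vector [c * a, a + c * b, b + c^2], vector [(b + c^2) * a, c * a + (b + c^2) * b, a + c * b + (b + c^2) * c]]]"

definition family_A07_monogenic :: "complex \<Rightarrow> complex \<Rightarrow> complex \<Rightarrow> complex ^ 3 ^ 3 ^ 3" where
  "family_A07_monogenic p q r = monogenic_table (p * q * r) (- (p * q + q * r + r * p)) (p + q + r)"

text \<open>The element (p, q, r) of the diagonal algebra generates it. Its powers start at one, so
  their determinant is the Vandermonde determinant times the product of the three values.\<close>

lemma family_A07_monogenic_orbit:
  assumes "p \<noteq> 0" "q \<noteq> 0" "r \<noteq> 0" "p \<noteq> q" "q \<noteq> r" "p \<noteq> r"
  shows "structure_table (family_A07_monogenic p q r) \<in> orbit A07"
proof (rule orbit_by_basis[of "vector [p, q, r]" "vector [p^2, q^2, r^2]" "vector [p^3, q^3, r^3]"])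
  have "det (frame (vector [p, q, r]) (vector [p^2, q^2, r^2]) (vector [p^3, q^3, r^3])) =
      p * q * r * (q - p) * (r - p) * (r - q)"
    by (simp add: frame_def det_3) algebra
  then show "det (frame (vector [p, q, r]) (vector [p^2, q^2, r^2]) (vector [p^3, q^3, r^3])) \<noteq> 0"
    using assms by simp
qed (simp only: forall_3 alg_mult_A07 family_A07_monogenic_def monogenic_table_def vec_eq_iff vector_3 structure_table_nth
    vector_add_component vector_smult_component; intro conjI; algebra)

lemma family_A07_monogenic_boundary:
  assumes "p = 0 \<or> q = 0 \<or> r = 0 \<or> p = q \<or> q = r \<or> p = r"
  shows "degenerate_trace_form (structure_table (family_A07_monogenic p q r))"
proof -
  have T: "right_trace (structure_table (family_A07_monogenic p q r)) x =
      (p + q + r) * x $ 1 + (p^2 + q^2 + r^2) * x $ 2 + (p^3 + q^3 + r^3) * x $ 3" for x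
    by (simp add: table_simps family_A07_monogenic_def monogenic_table_def) algebra
  \<comment> \<open>This vector is x (x - a) (x - b) for the generator x. The trace is the sum of
    the values at \<open>p\<close>, \<open>q\<close>, \<open>r\<close>, and \<open>a\<close>,
    \<open>b\<close> are chosen so that all three values vanish.\<close>
  have *: "degenerate_trace_form (structure_table (family_A07_monogenic p q r))"
    if "\<And>y. right_trace (structure_table (family_A07_monogenic p q r))
       (alg_mult (structure_table (family_A07_monogenic p q r)) (vector [a * b, - (a + b), 1]) y) = 0" for a b
    by (rule degenerate_trace_formI[OF _ that]) (simp add: vec_eq_iff forall_3)
  from assms consider "p = 0" | "q = 0" | "r = 0" | "p = q" | "q = r" | "p = r" by blast
  then show ?thesis
  proof cases
    case 1 then show ?thesis by (intro *[of q r]) (unfold T, simp add: alg_mult_def sum_3 family_A07_monogenic_def monogenic_table_def, (simp add: algebra_simps power2_eq_square power3_eq_cube)?)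
  next
    case 2 then show ?thesis by (intro *[of p r]) (unfold T, simp add: alg_mult_def sum_3 family_A07_monogenic_def monogenic_table_def, (simp add: algebra_simps power2_eq_square power3_eq_cube)?)
  next
    case 3 then show ?thesis by (intro *[of p q]) (unfold T, simp add: alg_mult_def sum_3 family_A07_monogenic_def monogenic_table_def, (simp add: algebra_simps power2_eq_square power3_eq_cube)?)
  next
    case 4 then show ?thesis by (intro *[of p r]) (unfold T, simp add: alg_mult_def sum_3 family_A07_monogenic_def monogenic_table_def, (simp add: algebra_simps power2_eq_square power3_eq_cube)?)
  next
    case 5 then show ?thesis by (intro *[of p q]) (unfold T, simp add: alg_mult_def sum_3 family_A07_monogenic_def monogenic_table_def, (simp add: algebra_simps power2_eq_square power3_eq_cube)?)
  next
    case 6 then show ?thesis by (intro *[of p q]) (unfold T, simp add: alg_mult_def sum_3 family_A07_monogenic_def monogenic_table_def, (simp add: algebra_simps power2_eq_square power3_eq_cube)?)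
  qed
qed

lemma classified_family_A07_monogenic: "classified (structure_table (family_A07_monogenic p q r))"
proof -
  \<comment> \<open>The slopes 1, 2, 3 are nonzero and distinct, so each of the six degeneracies
    occurs for a single \<open>s\<close>.\<close>
  have "classified (structure_table ((\<lambda>s. family_A07_monogenic (p + s) (q + 2 * s) (r + 3 * s)) 0))"
  proof (rule classified_by_curve[where c = C07 and A = "{- p, - q / 2, - r / 3, p - q, q - r, (p - r) / 2}"])
    show "\<forall>i j k. (\<lambda>s. family_A07_monogenic (p + s) (q + 2 * s) (r + 3 * s) $ i $ j $ k) \<in> function_algebra {\<lambda>s. s}"
      by (simp add: forall_3 family_A07_monogenic_def monogenic_table_def) (intro conjI function_algebra_intros)
    show "structure_table (family_A07_monogenic (p + s) (q + 2 * s) (r + 3 * s)) \<in> orbit (component_algebra C07)"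
      if "s \<notin> {- p, - q / 2, - r / 3, p - q, q - r, (p - r) / 2}" for s
    proof -
      have "p + s \<noteq> 0" "q + 2 * s \<noteq> 0" "r + 3 * s \<noteq> 0" "p + s \<noteq> q + 2 * s" "q + 2 * s \<noteq> r + 3 * s" "p + s \<noteq> r + 3 * s" using that by (auto simp: field_simps add_eq_0_iff)
      then show ?thesis using family_A07_monogenic_orbit by simp
    qed
  qed (simp_all, use family_A07_monogenic_orbit family_A07_monogenic_boundary in blast)
  then show ?thesis by simp
qed

definition family_A07_unital_plane :: "complex \<Rightarrow> complex \<Rightarrow> complex \<Rightarrow> complex ^ 3 ^ 3 ^ 3" where
  "family_A07_unital_plane p q r = vector [
     vector [vector [1, 0, 0], vector [0, 1, 0], vector [0, 0, 0]],
     vector [vector [0, 1, 0], vector [- (p * q), p + q, 0], vector [0, 0, 0]],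
     vector [vector [0, 0, 0], vector [0, 0, 0], vector [0, 0, r]]]"

lemma family_A07_unital_plane_orbit:
  assumes "p \<noteq> q" "r \<noteq> 0"
  shows "structure_table (family_A07_unital_plane p q r) \<in> orbit A07"
  by (rule orbit_by_basis[of "vector [1, 1, 0]" "vector [p, q, 0]" "vector [0, 0, r]"])
    (use assms in \<open>simp_all add: frame_def det_3 forall_3 alg_mult_A07 family_A07_unital_plane_def vec_eq_iff\<close>,
       (simp_all add: field_simps power2_eq_square)?)

lemma family_A07_unital_plane_boundary:
  assumes "p = q \<or> r = 0"
  shows "degenerate_trace_form (structure_table (family_A07_unital_plane p q r))"
proof (cases "r = 0")
  case True
  then show ?thesis
    by (intro degenerate_trace_formI[of "vector [0, 0, 1]"]) (auto simp: table_simps family_A07_unital_plane_def)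
next
  case False
  \<comment> \<open>Now the roots coincide and e2 - p e1 is nilpotent.\<close>
  then show ?thesis using assms
    by (intro degenerate_trace_formI[of "vector [- p, 1, 0]"]) (auto simp: table_simps family_A07_unital_plane_def algebra_simps)
qed

lemma classified_family_A07_unital_plane: "classified (structure_table (family_A07_unital_plane p q r))"
proof -
  have "classified (structure_table ((\<lambda>s. family_A07_unital_plane p (q + s) (r + s)) 0))"
  proof (rule classified_by_curve[where c = C07 and A = "{p - q, - r}"])
    show "\<forall>i j k. (\<lambda>s. family_A07_unital_plane p (q + s) (r + s) $ i $ j $ k) \<in> function_algebra {\<lambda>s. s}"
      by (simp add: forall_3 family_A07_unital_plane_def) (intro conjI function_algebra_intros)
    show "structure_table (family_A07_unital_plane p (q + s) (r + s)) \<in> orbit (component_algebra C07)"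
      if "s \<notin> {p - q, - r}" for s
    proof -
      have "p \<noteq> q + s" "r + s \<noteq> 0" using that by (auto simp: field_simps add_eq_0_iff)
      then show ?thesis using family_A07_unital_plane_orbit by simp
    qed
  qed (simp_all, use family_A07_unital_plane_orbit family_A07_unital_plane_boundary in blast)
  then show ?thesis by simp
qed

definition family_A07_diagonal :: "complex \<Rightarrow> complex \<Rightarrow> complex ^ 3 ^ 3 ^ 3" where
  "family_A07_diagonal p q = vector [
     vector [vector [1, 0, 0], vector [0, 0, 0], vector [0, 0, 0]],
     vector [vector [0, 0, 0], vector [0, p, 0], vector [0, 0, 0]],
     vector [vector [0, 0, 0], vector [0, 0, 0], vector [0, 0, q]]]"

lemma family_A07_diagonal_orbit:
  assumes "p \<noteq> 0" "q \<noteq> 0"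
  shows "structure_table (family_A07_diagonal p q) \<in> orbit A07"
  by (rule orbit_by_basis[of "vector [1, 0, 0]" "vector [0, p, 0]" "vector [0, 0, q]"])
    (use assms in \<open>simp_all add: frame_def det_3 forall_3 alg_mult_A07 family_A07_diagonal_def vec_eq_iff\<close>,
       (simp_all add: field_simps power2_eq_square)?)

lemma family_A07_diagonal_boundary:
  assumes "p = 0 \<or> q = 0"
  shows "degenerate_trace_form (structure_table (family_A07_diagonal p q))"
proof (cases "p = 0")
  case True
  then show ?thesis
    by (intro degenerate_trace_formI[of "vector [0, 1, 0]"]) (auto simp: table_simps family_A07_diagonal_def)
next
  case False
  then show ?thesis using assms
    by (intro degenerate_trace_formI[of "vector [0, 0, 1]"]) (auto simp: table_simps family_A07_diagonal_def)
qed

lemma classified_family_A07_diagonal: "classified (structure_table (family_A07_diagonal p q))"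
proof -
  have "classified (structure_table ((\<lambda>s. family_A07_diagonal (p + s) (q + s)) 0))"
  proof (rule classified_by_curve[where c = C07 and A = "{- p, - q}"])
    show "\<forall>i j k. (\<lambda>s. family_A07_diagonal (p + s) (q + s) $ i $ j $ k) \<in> function_algebra {\<lambda>s. s}"
      by (simp add: forall_3 family_A07_diagonal_def) (intro conjI function_algebra_intros)
    show "structure_table (family_A07_diagonal (p + s) (q + s)) \<in> orbit (component_algebra C07)"
      if "s \<notin> {- p, - q}" for s
    proof -
      have "p + s \<noteq> 0" "q + s \<noteq> 0" using that by (auto simp: field_simps add_eq_0_iff)
      then show ?thesis using family_A07_diagonal_orbit by simp
    qed
  qed (simp_all, use family_A07_diagonal_orbit family_A07_diagonal_boundary in blast)
  then show ?thesis by simp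
qed

definition family_A07_unital :: "complex \<Rightarrow> complex ^ 3 ^ 3 ^ 3" where
  "family_A07_unital p = vector [
     vector [vector [1, 0, 0], vector [0, 1, 0], vector [0, 0, 1]],
     vector [vector [0, 1, 0], vector [0, p, 0], vector [0, 0, 0]],
     vector [vector [0, 0, 1], vector [0, 0, 0], vector [0, 0, p]]]"

lemma family_A07_unital_orbit:
  assumes "p \<noteq> 0"
  shows "structure_table (family_A07_unital p) \<in> orbit A07"
  by (rule orbit_by_basis[of "vector [1, 1, 1]" "vector [p, 0, 0]" "vector [0, p, 0]"])
    (use assms in \<open>simp_all add: frame_def det_3 forall_3 alg_mult_A07 family_A07_unital_def vec_eq_iff\<close>,
       (simp_all add: field_simps power2_eq_square)?)

lemma family_A07_unital_boundary:
  assumes "p = 0"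
  shows "degenerate_trace_form (structure_table (family_A07_unital p))"
  by (rule degenerate_trace_formI[of "vector [0, 1, 0]"]) (use assms in \<open>auto simp: table_simps family_A07_unital_def algebra_simps\<close>)

lemma classified_family_A07_unital: "classified (structure_table (family_A07_unital p))"
proof -
  have "classified (structure_table ((\<lambda>s. family_A07_unital (p + s)) 0))"
  proof (rule classified_by_curve[where c = C07 and A = "{- p}"])
    show "\<forall>i j k. (\<lambda>s. family_A07_unital (p + s) $ i $ j $ k) \<in> function_algebra {\<lambda>s. s}"
      by (simp add: forall_3 family_A07_unital_def) (intro conjI function_algebra_intros)
    show "structure_table (family_A07_unital (p + s)) \<in> orbit (component_algebra C07)"
      if "s \<notin> {- p}" for s
    proof -
      have "p + s \<noteq> 0" using that by (auto simp: field_simps add_eq_0_iff)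
      then show ?thesis using family_A07_unital_orbit by simp
    qed
  qed (simp_all, use family_A07_unital_orbit family_A07_unital_boundary in blast)
  then show ?thesis by simp
qed

section \<open>Solving the structure equations\<close>

abbreviation basis_product :: "structure_constants \<Rightarrow> 3 \<Rightarrow> 3 \<Rightarrow> complex ^ 3" where
  "basis_product \<mu> i j \<equiv> alg_mult \<mu> (axis i 1) (axis j 1)"

lemma basis_product_coords:
  assumes "basis_product \<mu> i j = vector [a, b, c]"
  shows "\<mu> $ (i, j, 1) = a" "\<mu> $ (i, j, 2) = b" "\<mu> $ (i, j, 3) = c"
  unfolding alg_mult_axis[symmetric] assms by simp_all

lemma alg_mult_axis_nth: "alg_mult \<mu> (axis i 1) (axis j 1) = (\<chi> k. \<mu> $ (i, j, k))"
  by (simp add: vec_eq_iff alg_mult_axis)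

lemma right_alternative_alt:
  "right_alternative \<mu> \<longleftrightarrow> (\<forall>x y z. alg_mult \<mu> (alg_mult \<mu> x y) z + alg_mult \<mu> (alg_mult \<mu> x z) y =
     alg_mult \<mu> x (alg_mult \<mu> y z) + alg_mult \<mu> x (alg_mult \<mu> z y))"
  unfolding right_alternative_def associator_def by (auto simp: algebra_simps)

lemma alg_mult_axis_right_nth: "alg_mult \<mu> x (axis m 1) $ l = (\<Sum>p\<in>UNIV. x $ p * \<mu> $ (p, m, l))"
  by (simp add: alg_mult_def axis_def if_distrib mult_ac cong: if_cong)

lemma alg_mult_axis_left_nth: "alg_mult \<mu> (axis m 1) x $ l = (\<Sum>q\<in>UNIV. x $ q * \<mu> $ (m, q, l))"
proof -
  have "alg_mult \<mu> (axis m 1) x $ l = (\<Sum>p\<in>UNIV. if p = m then (\<Sum>q\<in>UNIV. x $ q * \<mu> $ (m, q, l)) else 0)"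
    unfolding alg_mult_def vec_lambda_beta by (rule sum.cong) (simp_all add: axis_def mult_ac)
  then show ?thesis by simp
qed

text \<open>Below, \<open>r[of i j k l]\<close> is thus the l-th coordinate of the linearized
  identity at the basis vectors i, j, k. The instances are ordered so that each, after substitution
  of the constants already found, determines a further constant or leaves a product relation for a
  case distinction.\<close>

lemma right_alternative_coords:
  assumes "right_alternative \<mu>"
  shows "(\<mu> $ (i,j,1) * \<mu> $ (1,k,l) + \<mu> $ (i,j,2) * \<mu> $ (2,k,l) + \<mu> $ (i,j,3) * \<mu> $ (3,k,l)) +
    (\<mu> $ (i,k,1) * \<mu> $ (1,j,l) + \<mu> $ (i,k,2) * \<mu> $ (2,j,l) + \<mu> $ (i,k,3) * \<mu> $ (3,j,l)) =
    (\<mu> $ (j,k,1) * \<mu> $ (i,1,l) + \<mu> $ (j,k,2) * \<mu> $ (i,2,l) + \<mu> $ (j,k,3) * \<mu> $ (i,3,l)) +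
    (\<mu> $ (k,j,1) * \<mu> $ (i,1,l) + \<mu> $ (k,j,2) * \<mu> $ (i,2,l) + \<mu> $ (k,j,3) * \<mu> $ (i,3,l))"
proof -
  have "(alg_mult \<mu> (alg_mult \<mu> (axis i 1) (axis j 1)) (axis k 1) + alg_mult \<mu> (alg_mult \<mu> (axis i 1) (axis k 1)) (axis j 1)) $ l =
     (alg_mult \<mu> (axis i 1) (alg_mult \<mu> (axis j 1) (axis k 1)) + alg_mult \<mu> (axis i 1) (alg_mult \<mu> (axis k 1) (axis j 1))) $ l"
    using assms unfolding right_alternative_alt by simp
  then show ?thesis
    unfolding vector_add_component alg_mult_axis_right_nth alg_mult_axis_left_nth alg_mult_axis_nth vec_lambda_beta sum_3 .
qed

lemma quadratic_roots: obtains p q :: complex where "p + q = b" "p * q = c"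
proof -
  define d where "d = csqrt (b ^ 2 - 4 * c)"
  have d: "d * d = b ^ 2 - 4 * c" unfolding d_def by (metis power2_csqrt power2_eq_square)
  have "(b + d) / 2 + (b - d) / 2 = b" by (simp add: field_simps)
  moreover have "(b + d) / 2 * ((b - d) / 2) = c" using d by (simp add: field_simps power2_eq_square)
  ultimately show ?thesis using that by blast
qed

lemma cubic_roots:
  obtains p q r :: complex where "p + q + r = c" "- (p * q + q * r + r * p) = b" "p * q * r = a"
proof -
  have "\<not> constant (poly [:- a, - b, - c, 1:])"
    by (simp add: constant_degree)
  then obtain p where "poly [:- a, - b, - c, 1:] p = 0"
    using fundamental_theorem_of_algebra by blast
  then have p: "p * (p * p - c * p - b) = a" by (simp add: algebra_simps)
  \<comment> \<open>The other two roots are those of the quotient by X - p, which is X^2 - (c - p) X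
    + (p^2 - c p - b).\<close>
  obtain q r where qr: "q + r = c - p" "q * r = p * p - c * p - b" by (rule quadratic_roots)
  show ?thesis
  proof (rule that[of p q r])
    show "p + q + r = c" using qr by (simp add: algebra_simps)
    show "- (p * q + q * r + r * p) = b" using qr by algebra
    show "p * q * r = a" using qr p by (simp add: mult.assoc)
  qed
qed

section \<open>Tables with an idempotent e1 and prescribed Peirce types of e2 and e3\<close>

lemma classified_peirce_1a_1a:
  fixes \<mu> :: structure_constants
  assumes RA: "right_alternative \<mu>"
    and known: "basis_product \<mu> 1 1 = vector [1, 0, 0]" "basis_product \<mu> 1 2 = vector [0, 0, 0]"
      "basis_product \<mu> 1 3 = vector [0, 0, 0]" "basis_product \<mu> 2 1 = vector [0, 1, 0]"
      "basis_product \<mu> 3 1 = vector [0, 0, 1]"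
  shows "classified \<mu>"
proof -
  note r = right_alternative_coords[OF RA]
  note k = known[THEN basis_product_coords(1)] known[THEN basis_product_coords(2)] known[THEN basis_product_coords(3)]
  have "\<mu> $ (2, 2, 1) = 0" "\<mu> $ (3, 3, 1) = 0" "\<mu> $ (2, 2, 2) = 0" "\<mu> $ (2, 2, 3) = 0" "\<mu> $ (2, 3, 1) = 0"
      "\<mu> $ (2, 3, 2) = 0" "\<mu> $ (2, 3, 3) = 0" "\<mu> $ (3, 2, 1) = 0" "\<mu> $ (3, 2, 2) = 0" "\<mu> $ (3, 2, 3) = 0"
      "\<mu> $ (3, 3, 2) = 0" "\<mu> $ (3, 3, 3) = 0"
    using r[of 1 2 2 1] r[of 1 3 3 1] r[of 2 1 2 2] r[of 2 1 2 3] r[of 2 1 3 1] r[of 2 1 3 2]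
      r[of 2 1 3 3] r[of 3 1 2 1] r[of 3 1 2 2] r[of 3 1 2 3] r[of 3 1 3 2] r[of 3 1 3 3]
    by (simp_all add: k)
  note k = k this
  have "\<mu> = A18"
    by (simp add: structure_constants_eq_iff forall_3 A18_def alg_table_def k)
  then show ?thesis using classified_by_orbit[of \<mu> C18] orbit_refl by simp
qed

lemma classified_peirce_1a_1b:
  fixes \<mu> :: structure_constants
  assumes RA: "right_alternative \<mu>"
    and known: "basis_product \<mu> 1 1 = vector [1, 0, 0]" "basis_product \<mu> 1 2 = vector [0, 0, 0]"
      "basis_product \<mu> 1 3 = vector [-u, 0, 1]" "basis_product \<mu> 2 1 = vector [0, 1, 0]"
      "basis_product \<mu> 3 1 = vector [u, 0, 0]"
  shows "classified \<mu>"
proof -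
  note r = right_alternative_coords[OF RA]
  note k = known[THEN basis_product_coords(1)] known[THEN basis_product_coords(2)] known[THEN basis_product_coords(3)]
  have "\<mu> $ (2, 2, 3) = 0" "\<mu> $ (3, 2, 2) = 0" "\<mu> $ (2, 3, 3) = 0" "\<mu> $ (3, 3, 2) = 0" "u = 0"
      "\<mu> $ (2, 2, 2) = 0" "\<mu> $ (2, 3, 2) = 0" "\<mu> $ (3, 2, 3) = 0"
    using r[of 1 2 2 3] r[of 1 2 3 2] r[of 1 2 3 3] r[of 1 3 3 2] r[of 1 3 3 3] r[of 2 1 2 2]
      r[of 2 1 3 2] r[of 3 1 2 3]
    by (simp_all add: k)
  note k = k this
  have "\<mu> $ (2, 2, 1) = 0" "\<mu> $ (2, 3, 1) = 0" "\<mu> $ (3, 3, 1) = 0" "\<mu> $ (3, 3, 3) = 0" "\<mu> $ (3, 2, 1) = 0"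
    using r[of 1 2 2 1] r[of 1 2 3 1] r[of 2 3 3 2] r[of 3 1 3 3] r[of 3 2 3 3]
    by (simp_all add: k)
  note k = k this
  have "\<mu> = A19"
    by (simp add: structure_constants_eq_iff forall_3 A19_def alg_table_def k)
  then show ?thesis using classified_by_orbit[of \<mu> C19] orbit_refl by simp
qed

lemma classified_peirce_1b_1b:
  fixes \<mu> :: structure_constants
  assumes RA: "right_alternative \<mu>"
    and known: "basis_product \<mu> 1 1 = vector [1, 0, 0]" "basis_product \<mu> 1 2 = vector [-u, 1, 0]"
      "basis_product \<mu> 1 3 = vector [-w, 0, 1]" "basis_product \<mu> 2 1 = vector [u, 0, 0]"
      "basis_product \<mu> 3 1 = vector [w, 0, 0]"
  shows "classified \<mu>"
proof -
  note r = right_alternative_coords[OF RA]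
  note k = known[THEN basis_product_coords(1)] known[THEN basis_product_coords(2)] known[THEN basis_product_coords(3)]
  have "u = 0" "w = 0" "\<mu> $ (2, 2, 3) = 0" "\<mu> $ (2, 3, 2) = 0" "\<mu> $ (3, 2, 3) = 0"
      "\<mu> $ (3, 3, 2) = 0"
    using r[of 1 2 2 2] r[of 1 2 3 2] r[of 2 1 2 3] r[of 2 1 3 2] r[of 3 1 2 3] r[of 3 1 3 2]
    by (simp_all add: k)
  note k = k this
  have "\<mu> $ (2, 2, 2) = 0" "\<mu> $ (2, 3, 3) = 0" "\<mu> $ (2, 2, 1) = 0" "\<mu> $ (2, 3, 1) = 0" "\<mu> $ (3, 2, 2) = 0"
      "\<mu> $ (3, 3, 3) = 0" "\<mu> $ (3, 2, 1) = 0" "\<mu> $ (3, 3, 1) = 0"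
    using r[of 2 1 2 2] r[of 2 1 3 3] r[of 2 2 2 2] r[of 2 3 3 3] r[of 3 1 2 2] r[of 3 1 3 3]
      r[of 3 2 2 2] r[of 3 3 3 3]
    by (simp_all add: k)
  note k = k this
  have "\<mu> = A17"
    by (simp add: structure_constants_eq_iff forall_3 A17_def alg_table_def k)
  then show ?thesis using classified_by_orbit[of \<mu> C17] orbit_refl by simp
qed

lemma classified_peirce_1a_0:
  fixes \<mu> :: structure_constants
  assumes RA: "right_alternative \<mu>"
    and known: "basis_product \<mu> 1 1 = vector [1, 0, 0]" "basis_product \<mu> 1 2 = vector [0, 0, -v]"
      "basis_product \<mu> 1 3 = vector [0, 0, 0]" "basis_product \<mu> 2 1 = vector [0, 1, v]"
      "basis_product \<mu> 3 1 = vector [0, 0, 0]"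
  shows "classified \<mu>"
proof -
  note r = right_alternative_coords[OF RA]
  note k = known[THEN basis_product_coords(1)] known[THEN basis_product_coords(2)] known[THEN basis_product_coords(3)]
  have "\<mu> $ (3, 3, 1) = 0" "\<mu> $ (3, 3, 2) = 0"
    using r[of 1 3 3 1] r[of 3 1 3 2]
    by (simp_all add: k)
  note k = k this
  have "\<mu> $ (2, 3, 1) = 0" "\<mu> $ (2, 3, 2) = 0"
    using r[of 2 1 3 1] r[of 2 1 3 2]
    by (simp_all add: k)
  note k = k this
  have "\<mu> $ (3, 2, 1) = 0"
    by (insert r[of 1 2 3 1], simp add: k, (algebra | simp add: algebra_simps eq_neg_iff_add_eq_0)?)
  note k = k this
  have "\<mu> $ (2, 2, 1) = 0"
    by (insert r[of 1 2 2 1], simp add: k, (algebra | simp add: algebra_simps eq_neg_iff_add_eq_0)?)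
  note k = k this
  have "\<mu> $ (2, 2, 2) = (-1) * \<mu> $ (3, 2, 2) * v"
    by (insert r[of 2 1 2 2], simp add: k, (algebra | simp add: algebra_simps eq_neg_iff_add_eq_0)?)
  note k = k this
  have "\<mu> $ (2, 3, 3) = (-1) * \<mu> $ (3, 3, 3) * v"
    by (insert r[of 2 1 3 3], simp add: k, (algebra | simp add: algebra_simps eq_neg_iff_add_eq_0)?)
  note k = k this
  have "\<mu> $ (3, 2, 3) = \<mu> $ (3, 2, 2) * v"
    by (insert r[of 3 1 2 3], simp add: k, (algebra | simp add: algebra_simps eq_neg_iff_add_eq_0)?)
  note k = k this
  have z: "\<mu> $ (3, 2, 2) * v = 0" "\<mu> $ (3, 3, 3) * v = 0" "\<mu> $ (2, 2, 3) * \<mu> $ (3, 2, 2) = 0"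
    "\<mu> $ (3, 2, 2) * (\<mu> $ (3, 2, 2) - \<mu> $ (3, 3, 3)) = 0"
    by (insert r[of 1 2 2 2] r[of 1 2 3 3] r[of 2 2 2 2] r[of 3 2 3 2], simp_all add: k, (algebra | simp add: algebra_simps eq_neg_iff_add_eq_0)+)
  have z': "\<mu> $ (2, 2, 3) * \<mu> $ (3, 3, 3) = 0"
    by (insert r[of 2 2 3 3] z, simp add: k, (algebra | simp add: algebra_simps eq_neg_iff_add_eq_0)?)
  \<comment> \<open>The square of e3 is \<open>\<mu> $ (3, 3, 3)\<close> times e3. If it vanishes,
    the relations force \<open>\<mu> $ (3, 2, 2) = 0\<close>. Otherwise e3 is idempotent up to scale
    and acts on e2 from the left by \<open>\<mu> $ (3, 2, 2)\<close>, which is 0 or the same scale;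
    this distinguishes \<open>A24\<close> from \<open>A20\<close>.\<close>
  show ?thesis
  proof (cases "\<mu> $ (3, 3, 3) = 0")
    case True
    then have "\<mu> $ (3, 2, 2) = 0" using z by auto
    note k = k this True
    have "\<mu> = structure_table (family_R09 1 0 (- v) v (\<mu> $ (2, 2, 3)))"
    by (simp add: structure_constants_eq_iff forall_3 family_R09_def k algebra_simps power2_eq_square)
  then show ?thesis by (rule ssubst) (rule classified_family_R09)

  next
    case False
    then have "v = 0" "\<mu> $ (2, 2, 3) = 0" using z z' by auto
    note k = k this
    from z consider "\<mu> $ (3, 2, 2) = 0" | "\<mu> $ (3, 2, 2) = \<mu> $ (3, 3, 3)" by auto
    then show ?thesis
    proof cases
      case 1
      note k = k this
      have "\<mu> = structure_table (family_A24' (\<mu> $ (3, 3, 3)))"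
    by (simp add: structure_constants_eq_iff forall_3 family_A24'_def k algebra_simps power2_eq_square)
  then have "\<mu> \<in> orbit (component_algebra C24)"
    unfolding component_algebra.simps by (rule ssubst) (rule family_A24'_orbit[OF False])
  then show ?thesis by (rule classified_by_orbit)

    next
      case 2
      note k = k this
      have "\<mu> = structure_table (family_A20 (\<mu> $ (3, 3, 3)))"
    by (simp add: structure_constants_eq_iff forall_3 family_A20_def k algebra_simps power2_eq_square)
  then have "\<mu> \<in> orbit (component_algebra C20)"
    unfolding component_algebra.simps by (rule ssubst) (rule family_A20_orbit[OF False])
  then show ?thesis by (rule classified_by_orbit)

    qed
  qed
qed

lemma classified_peirce_1b_0:
  fixes \<mu> :: structure_constants
  assumes RA: "right_alternative \<mu>"
    and known: "basis_product \<mu> 1 1 = vector [1, 0, 0]" "basis_product \<mu> 1 2 = vector [-u, 1, 0]"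
      "basis_product \<mu> 1 3 = vector [0, 0, 0]" "basis_product \<mu> 2 1 = vector [u, 0, 0]"
      "basis_product \<mu> 3 1 = vector [0, 0, 0]"
  shows "classified \<mu>"
proof -
  note r = right_alternative_coords[OF RA]
  note k = known[THEN basis_product_coords(1)] known[THEN basis_product_coords(2)] known[THEN basis_product_coords(3)]
  have "u = 0" "\<mu> $ (2, 2, 3) = 0" "\<mu> $ (3, 2, 2) = 0" "\<mu> $ (2, 3, 3) = 0" "\<mu> $ (3, 3, 2) = 0"
      "\<mu> $ (3, 2, 3) = 0"
    using r[of 1 2 2 2] r[of 1 2 2 3] r[of 1 2 3 2] r[of 1 2 3 3] r[of 1 3 3 2] r[of 3 1 2 3]
    by (simp_all add: k)
  note k = k this
  have "\<mu> $ (3, 2, 1) = 0" "\<mu> $ (3, 3, 1) = 0" "\<mu> $ (2, 2, 2) = 0" "\<mu> $ (2, 3, 1) = 0" "\<mu> $ (2, 2, 1) = 0"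
    using r[of 1 2 3 1] r[of 1 3 3 1] r[of 2 1 2 2] r[of 2 1 3 1] r[of 2 2 2 2]
    by (simp_all add: k)
  note k = k this
  have z: "\<mu> $ (2, 3, 2) = 0 \<or> \<mu> $ (2, 3, 2) = \<mu> $ (3, 3, 3)"
    using r[of 2 3 3 2] by (simp add: k)
  show ?thesis
  proof (cases "\<mu> $ (2, 3, 2) = 0")
    case True
    note k = k this
    have "\<mu> = structure_table (family_A23 (\<mu> $ (3, 3, 3)))"
    by (simp add: structure_constants_eq_iff forall_3 family_A23_def k algebra_simps power2_eq_square)
  then show ?thesis by (rule ssubst) (rule classified_family_A23)

  next
    case False
    with z have e: "\<mu> $ (2, 3, 2) = \<mu> $ (3, 3, 3)" "\<mu> $ (3, 3, 3) \<noteq> 0" by auto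
    note k = k e(1)
    have "\<mu> = structure_table (family_A20' (\<mu> $ (3, 3, 3)))"
    by (simp add: structure_constants_eq_iff forall_3 family_A20'_def k algebra_simps power2_eq_square)
  then have "\<mu> \<in> orbit (component_algebra C20)"
    unfolding component_algebra.simps by (rule ssubst) (rule family_A20'_orbit[OF e(2)])
  then show ?thesis by (rule classified_by_orbit)

  qed
qed

lemma classified_peirce_2_1a:
  fixes \<mu> :: structure_constants
  assumes RA: "right_alternative \<mu>"
    and known: "basis_product \<mu> 1 1 = vector [1, 0, 0]" "basis_product \<mu> 1 2 = vector [0, 1, 0]"
      "basis_product \<mu> 1 3 = vector [0, 0, 0]" "basis_product \<mu> 2 1 = vector [0, 1, 0]"
      "basis_product \<mu> 3 1 = vector [0, 0, 1]"
  shows "classified \<mu>"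
proof -
  note r = right_alternative_coords[OF RA]
  note k = known[THEN basis_product_coords(1)] known[THEN basis_product_coords(2)] known[THEN basis_product_coords(3)]
  have "\<mu> $ (2, 2, 3) = 0" "\<mu> $ (3, 2, 1) = 0" "\<mu> $ (3, 2, 2) = 0" "\<mu> $ (2, 3, 3) = 0" "\<mu> $ (3, 3, 1) = 0"
      "\<mu> $ (3, 3, 2) = 0" "\<mu> $ (2, 3, 1) = 0" "\<mu> $ (2, 3, 2) = 0" "\<mu> $ (3, 3, 3) = 0"
    using r[of 1 2 2 3] r[of 1 2 3 1] r[of 1 2 3 2] r[of 1 2 3 3] r[of 1 3 3 1] r[of 1 3 3 2]
      r[of 2 1 3 1] r[of 2 1 3 2] r[of 3 1 3 3]
    by (simp_all add: k)
  note k = k this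
  have "\<mu> $ (2, 2, 1) = (-1) * \<mu> $ (2, 2, 2) * \<mu> $ (3, 2, 3) + \<mu> $ (3, 2, 3) * \<mu> $ (3, 2, 3)"
    by (insert r[of 3 2 2 3], simp add: k, (algebra | simp add: algebra_simps eq_neg_iff_add_eq_0)?)
  note k = k this
  have "\<mu> = structure_table (family_A24 (\<mu> $ (3, 2, 3)) (\<mu> $ (2, 2, 2)))"
    by (simp add: structure_constants_eq_iff forall_3 family_A24_def k algebra_simps power2_eq_square)
  then show ?thesis by (rule ssubst) (rule classified_family_A24)
qed

lemma classified_peirce_2_1b:
  fixes \<mu> :: structure_constants
  assumes RA: "right_alternative \<mu>"
    and known: "basis_product \<mu> 1 1 = vector [1, 0, 0]" "basis_product \<mu> 1 2 = vector [0, 1, 0]"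
      "basis_product \<mu> 1 3 = vector [-u, -w, 1]" "basis_product \<mu> 2 1 = vector [0, 1, 0]"
      "basis_product \<mu> 3 1 = vector [u, w, 0]"
  shows "classified \<mu>"
proof -
  note r = right_alternative_coords[OF RA]
  note k = known[THEN basis_product_coords(1)] known[THEN basis_product_coords(2)] known[THEN basis_product_coords(3)]
  have "\<mu> $ (2, 2, 3) = 0"
    by (insert r[of 2 1 2 3], simp add: k, (algebra | simp add: algebra_simps eq_neg_iff_add_eq_0)?)
  note k = k this
  have "\<mu> $ (3, 2, 3) = 0"
    by (insert r[of 3 1 2 3], simp add: k, (algebra | simp add: algebra_simps eq_neg_iff_add_eq_0)?)
  note k = k this
  have "\<mu> $ (2, 3, 1) = (-1) * \<mu> $ (2, 3, 3) * u"
    by (insert r[of 2 1 3 1], simp add: k, (algebra | simp add: algebra_simps eq_neg_iff_add_eq_0)?)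
  note k = k this
  have "\<mu> $ (2, 3, 2) = (-1) * \<mu> $ (2, 3, 3) * w"
    by (insert r[of 2 1 3 2], simp add: k, (algebra | simp add: algebra_simps eq_neg_iff_add_eq_0)?)
  note k = k this
  have "\<mu> $ (3, 2, 1) = \<mu> $ (2, 2, 1) * w"
    by (insert r[of 3 1 2 1], simp add: k, (algebra | simp add: algebra_simps eq_neg_iff_add_eq_0)?)
  note k = k this
  have "\<mu> $ (3, 3, 1) = (-1) * \<mu> $ (2, 3, 3) * \<mu> $ (3, 3, 2)"
    by (insert r[of 3 3 3 3], simp add: k, (algebra | simp add: algebra_simps eq_neg_iff_add_eq_0)?)
  note k = k this
  have "u = (-1) * \<mu> $ (2, 3, 3) * w"
    by (insert r[of 1 3 3 3], simp add: k, (algebra | simp add: algebra_simps eq_neg_iff_add_eq_0)?)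
  note k = k this
  have "\<mu> $ (3, 3, 3) = 0"
    by (insert r[of 3 1 3 3], simp add: k, (algebra | simp add: algebra_simps eq_neg_iff_add_eq_0)?)
  note k = k this
  have "\<mu> $ (2, 2, 1) = (-1) * \<mu> $ (2, 2, 2) * \<mu> $ (2, 3, 3) + \<mu> $ (2, 3, 3) * \<mu> $ (2, 3, 3)"
    by (insert r[of 2 2 3 3], simp add: k, (algebra | simp add: algebra_simps eq_neg_iff_add_eq_0)?)
  note k = k this
  have "\<mu> $ (3, 2, 2) = \<mu> $ (2, 2, 2) * w + (-1) * \<mu> $ (2, 3, 3) * w"
    by (insert r[of 3 1 2 2], simp add: k, (algebra | simp add: algebra_simps eq_neg_iff_add_eq_0)?)
  note k = k this
  have z: "w * (\<mu> $ (2, 2, 2) - 2 * \<mu> $ (2, 3, 3)) = 0" "\<mu> $ (3, 3, 2) * (\<mu> $ (2, 2, 2) - 2 * \<mu> $ (2, 3, 3)) = 0"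
    by (insert r[of 1 2 3 2] r[of 2 3 3 2], simp_all add: k, (algebra | simp add: algebra_simps eq_neg_iff_add_eq_0)+)
  \<comment> \<open>In the unital plane of e1 and e2, \<open>\<mu> $ (2, 3, 3)\<close> is one
    eigenvalue of e2 and \<open>\<mu> $ (2, 2, 2)\<close> the sum of both. Only for a double
    eigenvalue can \<open>w\<close> and \<open>\<mu> $ (3, 3, 2)\<close> survive.\<close>
  show ?thesis
  proof (cases "\<mu> $ (2, 2, 2) = 2 * \<mu> $ (2, 3, 3)")
    case True
    note k = k this
    have "\<mu> = structure_table (family_R10 (\<mu> $ (2, 3, 3)) w (\<mu> $ (3, 3, 2)))"
    by (simp add: structure_constants_eq_iff forall_3 family_R10_def k algebra_simps power2_eq_square)
  then show ?thesis by (rule ssubst) (rule classified_family_R10)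

  next
    case False
    then have "w = 0" "\<mu> $ (3, 3, 2) = 0" using z by auto
    note k = k this
    have "\<mu> = structure_table (family_A23' (\<mu> $ (2, 3, 3)) (\<mu> $ (2, 2, 2)))"
    by (simp add: structure_constants_eq_iff forall_3 family_A23'_def k algebra_simps power2_eq_square)
  then have "\<mu> \<in> orbit (component_algebra C23)"
    unfolding component_algebra.simps by (rule ssubst) (rule family_A23'_orbit[OF False])
  then show ?thesis by (rule classified_by_orbit)

  qed
qed

lemma classified_peirce_2_0:
  fixes \<mu> :: structure_constants
  assumes RA: "right_alternative \<mu>"
    and known: "basis_product \<mu> 1 1 = vector [1, 0, 0]" "basis_product \<mu> 1 2 = vector [0, 1, 0]"
      "basis_product \<mu> 1 3 = vector [0, 0, 0]" "basis_product \<mu> 2 1 = vector [0, 1, 0]"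
      "basis_product \<mu> 3 1 = vector [0, 0, 0]"
  shows "classified \<mu>"
proof -
  note r = right_alternative_coords[OF RA]
  note k = known[THEN basis_product_coords(1)] known[THEN basis_product_coords(2)] known[THEN basis_product_coords(3)]
  have "\<mu> $ (2, 2, 3) = 0" "\<mu> $ (3, 2, 1) = 0" "\<mu> $ (3, 2, 2) = 0" "\<mu> $ (2, 3, 3) = 0" "\<mu> $ (3, 3, 1) = 0"
      "\<mu> $ (3, 3, 2) = 0" "\<mu> $ (2, 3, 1) = 0" "\<mu> $ (2, 3, 2) = 0" "\<mu> $ (3, 2, 3) = 0"
    using r[of 1 2 2 3] r[of 1 2 3 1] r[of 1 2 3 2] r[of 1 2 3 3] r[of 1 3 3 1] r[of 1 3 3 2]
      r[of 2 1 3 1] r[of 2 1 3 2] r[of 3 1 2 3]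
    by (simp_all add: k)
  note k = k this
  \<comment> \<open>These are the eigenvalues of e2 in the unital plane spanned by e1 and
    e2.\<close>
  obtain p q where pq: "p + q = \<mu> $ (2, 2, 2)" "p * q = - \<mu> $ (2, 2, 1)" by (rule quadratic_roots)
  note k = k pq(1)[symmetric] minus_equation_iff[THEN iffD1, OF pq(2)[symmetric], symmetric]
  have "\<mu> = structure_table (family_A07_unital_plane p q (\<mu> $ (3, 3, 3)))"
    by (simp add: structure_constants_eq_iff forall_3 family_A07_unital_plane_def k algebra_simps power2_eq_square)
  then show ?thesis by (rule ssubst) (rule classified_family_A07_unital_plane)
qed

text \<open>Only right multiplication by the generator x is prescribed; the identity then determines
  every product of powers, as in a commutative associative algebra. The roots of the cubic X^3 - c
  X^2 - b X - a are the parameters of the A07 family.\<close>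

lemma classified_monogenic_coords:
  fixes \<mu> :: structure_constants
  assumes RA: "right_alternative \<mu>"
    and known: "basis_product \<mu> 1 1 = vector [0, 1, 0]" "basis_product \<mu> 2 1 = vector [0, 0, 1]"
      "basis_product \<mu> 3 1 = vector [a, b, c]"
  shows "classified \<mu>"
proof -
  note r = right_alternative_coords[OF RA]
  note k = known[THEN basis_product_coords(1)] known[THEN basis_product_coords(2)] known[THEN basis_product_coords(3)]
  have "\<mu> $ (1, 2, 1) = 0" "\<mu> $ (1, 2, 2) = 0"
    using r[of 1 1 1 1] r[of 1 1 1 2]
    by (simp_all add: k)
  note k = k this
  have "\<mu> $ (1, 2, 3) = 1"
    by (insert r[of 1 1 1 3], simp add: k, (algebra | simp add: algebra_simps eq_neg_iff_add_eq_0)?)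
  note k = k this
  have "\<mu> $ (2, 2, 1) = a"
    by (insert r[of 2 1 1 1], simp add: k, (algebra | simp add: algebra_simps eq_neg_iff_add_eq_0)?)
  note k = k this
  have "\<mu> $ (1, 3, 1) = a"
    by (insert r[of 1 1 2 1], simp add: k, (algebra | simp add: algebra_simps eq_neg_iff_add_eq_0)?)
  note k = k this
  have "\<mu> $ (2, 2, 2) = b"
    by (insert r[of 2 1 1 2], simp add: k, (algebra | simp add: algebra_simps eq_neg_iff_add_eq_0)?)
  note k = k this
  have "\<mu> $ (1, 3, 2) = b"
    by (insert r[of 1 1 2 2], simp add: k, (algebra | simp add: algebra_simps eq_neg_iff_add_eq_0)?)
  note k = k this
  have "\<mu> $ (2, 2, 3) = c"
    by (insert r[of 2 1 1 3], simp add: k, (algebra | simp add: algebra_simps eq_neg_iff_add_eq_0)?)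
  note k = k this
  have "c = \<mu> $ (1, 3, 3)"
    by (insert r[of 1 1 2 3], simp add: k, (algebra | simp add: algebra_simps eq_neg_iff_add_eq_0)?)
  note k = k this
  have "\<mu> $ (2, 3, 1) = a * \<mu> $ (1, 3, 3)"
    by (insert r[of 1 1 3 1], simp add: k, (algebra | simp add: algebra_simps eq_neg_iff_add_eq_0)?)
  note k = k this
  have "\<mu> $ (3, 2, 1) = a * \<mu> $ (1, 3, 3)"
    by (insert r[of 1 2 2 1], simp add: k, (algebra | simp add: algebra_simps eq_neg_iff_add_eq_0)?)
  note k = k this
  have "\<mu> $ (2, 3, 2) = a + b * \<mu> $ (1, 3, 3)"
    by (insert r[of 1 1 3 2], simp add: k, (algebra | simp add: algebra_simps eq_neg_iff_add_eq_0)?)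
  note k = k this
  have "\<mu> $ (2, 3, 3) = b + \<mu> $ (1, 3, 3) * \<mu> $ (1, 3, 3)"
    by (insert r[of 1 1 3 3], simp add: k, (algebra | simp add: algebra_simps eq_neg_iff_add_eq_0)?)
  note k = k this
  have "\<mu> $ (3, 3, 1) = a * \<mu> $ (3, 2, 3)"
    by (insert r[of 1 2 3 1], simp add: k, (algebra | simp add: algebra_simps eq_neg_iff_add_eq_0)?)
  note k = k this
  have "\<mu> $ (3, 2, 2) = a + b * \<mu> $ (1, 3, 3)"
    by (insert r[of 1 2 2 2], simp add: k, (algebra | simp add: algebra_simps eq_neg_iff_add_eq_0)?)
  note k = k this
  have "\<mu> $ (3, 2, 3) = b + \<mu> $ (1, 3, 3) * \<mu> $ (1, 3, 3)"
    by (insert r[of 1 2 2 3], simp add: k, (algebra | simp add: algebra_simps eq_neg_iff_add_eq_0)?)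
  note k = k this
  have "\<mu> $ (3, 3, 2) = a * \<mu> $ (1, 3, 3) + b * b + b * \<mu> $ (1, 3, 3) * \<mu> $ (1, 3, 3)"
    by (insert r[of 1 2 3 2], simp add: k, (algebra | simp add: algebra_simps eq_neg_iff_add_eq_0)?)
  note k = k this
  have "\<mu> $ (3, 3, 3) = a + 2 * b * \<mu> $ (1, 3, 3) + \<mu> $ (1, 3, 3) * \<mu> $ (1, 3, 3) * \<mu> $ (1, 3, 3)"
    by (insert r[of 1 2 3 3], simp add: k, (algebra | simp add: algebra_simps eq_neg_iff_add_eq_0)?)
  note k = k this
  obtain p q s where pqs: "p + q + s = \<mu> $ (1, 3, 3)" "- (p * q + q * s + s * p) = b" "p * q * s = a" by (rule cubic_roots)
  note k = k pqs[symmetric]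
  have "\<mu> = structure_table (family_A07_monogenic p q s)"
    by (simp add: structure_constants_eq_iff forall_3 monogenic_table_def family_A07_monogenic_def k algebra_simps power2_eq_square)
  then show ?thesis by (rule ssubst) (rule classified_family_A07_monogenic)
qed

lemma classified_peirce_0_0_null:
  fixes \<mu> :: structure_constants
  assumes RA: "right_alternative \<mu>"
    and known: "basis_product \<mu> 1 1 = vector [1, 0, 0]" "basis_product \<mu> 1 2 = vector [0, 0, 0]"
      "basis_product \<mu> 1 3 = vector [0, 0, 0]" "basis_product \<mu> 2 1 = vector [0, 0, 0]"
      "basis_product \<mu> 2 2 = vector [0, 0, 0]" "basis_product \<mu> 2 3 = vector [x, y, z]"
      "basis_product \<mu> 3 1 = vector [0, 0, 0]" "basis_product \<mu> 3 2 = vector [-x, -y, -z]"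
      "basis_product \<mu> 3 3 = vector [0, 0, 0]"
  shows "classified \<mu>"
proof -
  note r = right_alternative_coords[OF RA]
  note k = known[THEN basis_product_coords(1)] known[THEN basis_product_coords(2)] known[THEN basis_product_coords(3)]
  have "x = 0" "z = 0" "y = 0"
    using r[of 2 1 3 1] r[of 2 2 3 3] r[of 2 3 3 2]
    by (simp_all add: k)
  note k = k this
  have "\<mu> = structure_table (family_A07_diagonal 0 0)"
    by (simp add: structure_constants_eq_iff forall_3 family_A07_diagonal_def k algebra_simps power2_eq_square)
  then show ?thesis by (rule ssubst) (rule classified_family_A07_diagonal)
qed

lemma classified_unital_null:
  fixes \<mu> :: structure_constants
  assumes RA: "right_alternative \<mu>"
    and known: "basis_product \<mu> 1 1 = vector [1, 0, 0]" "basis_product \<mu> 1 2 = vector [0, 1, 0]"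
      "basis_product \<mu> 1 3 = vector [0, 0, 1]" "basis_product \<mu> 2 1 = vector [0, 1, 0]"
      "basis_product \<mu> 2 2 = vector [0, 0, 0]" "basis_product \<mu> 2 3 = vector [x, y, z]"
      "basis_product \<mu> 3 1 = vector [0, 0, 1]" "basis_product \<mu> 3 2 = vector [-x, -y, -z]"
      "basis_product \<mu> 3 3 = vector [0, 0, 0]"
  shows "classified \<mu>"
proof -
  note r = right_alternative_coords[OF RA]
  note k = known[THEN basis_product_coords(1)] known[THEN basis_product_coords(2)] known[THEN basis_product_coords(3)]
  have "z = 0" "y = 0"
    using r[of 2 2 3 3] r[of 2 3 3 2]
    by (simp_all add: k)
  note k = k this
  have "x = 0"
    by (insert r[of 2 2 3 2], simp add: k, (algebra | simp add: algebra_simps eq_neg_iff_add_eq_0)?)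
  note k = k this
  have "\<mu> = structure_table (family_A07_unital 0)"
    by (simp add: structure_constants_eq_iff forall_3 family_A07_unital_def k algebra_simps power2_eq_square)
  then show ?thesis by (rule ssubst) (rule classified_family_A07_unital)
qed

lemma classified_diagonal_coords:
  fixes \<mu> :: structure_constants
  assumes RA: "right_alternative \<mu>"
    and known: "basis_product \<mu> 1 1 = vector [1, 0, 0]" "basis_product \<mu> 1 2 = vector [0, 0, 0]"
      "basis_product \<mu> 1 3 = vector [0, 0, 0]" "basis_product \<mu> 2 1 = vector [0, 0, 0]"
      "basis_product \<mu> 2 2 = vector [0, 1, 0]" "basis_product \<mu> 2 3 = vector [0, 0, 0]"
      "basis_product \<mu> 3 1 = vector [0, 0, 0]" "basis_product \<mu> 3 2 = vector [0, 0, 0]"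
      "basis_product \<mu> 3 3 = vector [0, 0, p]"
  shows "classified \<mu>"
proof -
  note r = right_alternative_coords[OF RA]
  note k = known[THEN basis_product_coords(1)] known[THEN basis_product_coords(2)] known[THEN basis_product_coords(3)]
  have "\<mu> = structure_table (family_A07_diagonal 1 p)"
    by (simp add: structure_constants_eq_iff forall_3 family_A07_diagonal_def k algebra_simps power2_eq_square)
  then show ?thesis by (rule ssubst) (rule classified_family_A07_diagonal)
qed

text \<open>The basis is x, y, x y in an algebra all of whose squares vanish. The third vector turns
  out to annihilate everything, which leaves the Heisenberg Lie algebra, a member of the R09 family
  with alternating form.\<close>

lemma classified_alternating_coords:
  fixes \<mu> :: structure_constants
  assumes RA: "right_alternative \<mu>"
    and known: "basis_product \<mu> 1 1 = vector [0, 0, 0]" "basis_product \<mu> 1 2 = vector [0, 0, 1]"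
      "basis_product \<mu> 1 3 = vector [x, y, z]" "basis_product \<mu> 2 1 = vector [0, 0, -1]"
      "basis_product \<mu> 2 2 = vector [0, 0, 0]" "basis_product \<mu> 2 3 = vector [s, t, w]"
      "basis_product \<mu> 3 1 = vector [-x, -y, -z]" "basis_product \<mu> 3 2 = vector [-s, -t, -w]"
      "basis_product \<mu> 3 3 = vector [0, 0, 0]"
  shows "classified \<mu>"
proof -
  note r = right_alternative_coords[OF RA]
  note k = known[THEN basis_product_coords(1)] known[THEN basis_product_coords(2)] known[THEN basis_product_coords(3)]
  have "x = 0" "y = 0" "z = 0" "s = 0" "t = 0"
      "w = 0"
    using r[of 1 1 2 1] r[of 1 1 2 2] r[of 1 1 2 3] r[of 1 2 2 1] r[of 1 2 2 2] r[of 1 2 2 3]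
    by (simp_all add: k)
  note k = k this
  have "\<mu> = structure_table (family_R09 0 0 1 (- 1) 0)"
    by (simp add: structure_constants_eq_iff forall_3 family_R09_def k algebra_simps power2_eq_square)
  then show ?thesis by (rule ssubst) (rule classified_family_R09)
qed

text \<open>Here e1 = x and e3 = x^2 with x^3 = 0. The assumption \<open>nil\<close> is the second
  coordinate of the cube of e2; once the other constants are reduced it says that e2 does not occur
  in its own square.\<close>

lemma classified_nil_coords:
  fixes \<mu> :: structure_constants
  assumes RA: "right_alternative \<mu>"
    and known: "basis_product \<mu> 1 1 = vector [0, 0, 1]" "basis_product \<mu> 1 3 = vector [0, 0, 0]"
      "basis_product \<mu> 3 1 = vector [0, 0, 0]"
    and nil: "\<mu> $ (2, 2, 1) * \<mu> $ (1, 2, 2) + \<mu> $ (2, 2, 2) * \<mu> $ (2, 2, 2) + \<mu> $ (2, 2, 3) * \<mu> $ (3, 2, 2) = 0"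
  shows "classified \<mu>"
proof -
  note r = right_alternative_coords[OF RA]
  note k = known[THEN basis_product_coords(1)] known[THEN basis_product_coords(2)] known[THEN basis_product_coords(3)]
  have "\<mu> $ (3, 3, 1) = 0" "\<mu> $ (3, 3, 2) = 0" "\<mu> $ (3, 3, 3) = 0"
    using r[of 1 1 3 1] r[of 1 1 3 2] r[of 1 1 3 3]
    by (simp_all add: k)
  note k = k this
  have "\<mu> $ (2, 3, 2) = 0" "\<mu> $ (3, 2, 2) = 0"
    using r[of 2 3 3 2] r[of 3 2 3 2]
    by (simp_all add: k)
  note k = k this
  have "\<mu> $ (1, 2, 2) = 0" "\<mu> $ (2, 1, 2) = 0"
    using r[of 1 1 2 2] r[of 2 1 1 2]
    by (simp_all add: k)
  note k = k this
  have "\<mu> $ (3, 2, 1) = 0" "\<mu> $ (2, 3, 1) = 0"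
    using r[of 1 1 2 1] r[of 2 1 1 1]
    by (simp_all add: k)
  note k = k this
  have "\<mu> $ (2, 1, 1) = \<mu> $ (3, 2, 3)"
    by (insert r[of 1 1 2 3], simp add: k, (algebra | simp add: algebra_simps eq_neg_iff_add_eq_0)?)
  note k = k this
  have "\<mu> $ (3, 2, 3) = \<mu> $ (2, 3, 3)"
    by (insert r[of 2 1 1 3], simp add: k, (algebra | simp add: algebra_simps eq_neg_iff_add_eq_0)?)
  note k = k this
  have "\<mu> $ (2, 2, 1) = \<mu> $ (1, 2, 1) * \<mu> $ (1, 2, 3) + (-1) * \<mu> $ (1, 2, 3) * \<mu> $ (2, 2, 2) + \<mu> $ (1, 2, 3) * \<mu> $ (2, 3, 3)"
    by (insert r[of 1 2 2 3], simp add: k, (algebra | simp add: algebra_simps eq_neg_iff_add_eq_0)?)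
  note k = k this

  have "\<mu> $ (2, 2, 2) = 0" using nil by (simp add: k)
  note k = k this
  have "\<mu> $ (1, 2, 1) = 0" "\<mu> $ (2, 3, 3) = 0"
    using r[of 1 2 2 1] r[of 2 1 2 1] by (simp_all add: k)
  note k = k this
  have "\<mu> = structure_table (family_R09 0 1 (\<mu> $ (1, 2, 3)) (\<mu> $ (2, 1, 3)) (\<mu> $ (2, 2, 3)))"
    by (simp add: structure_constants_eq_iff forall_3 family_R09_def k algebra_simps power2_eq_square)
  then show ?thesis by (rule ssubst) (rule classified_family_R09)
qed

section \<open>Peirce decomposition\<close>

lemma right_alternative_square:
  assumes "right_alternative \<mu>"
  shows "alg_mult \<mu> (alg_mult \<mu> x y) y = alg_mult \<mu> x (alg_mult \<mu> y y)"
  using assms[unfolded right_alternative_alt, rule_format, of x y y] by (simp add: vec_eq_iff)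

lemma change_basis_product:
  fixes \<mu> :: structure_constants
  assumes "invertible (frame u v w)"
    and "alg_mult \<mu> (vector [u, v, w] $ i) (vector [u, v, w] $ j) = a *s u + b *s v + c *s w"
  shows "basis_product (GL_action (matrix_inv (frame u v w)) \<mu>) i j = vector [a, b, c]"
proof -
  have ax: "frame u v w *v axis i 1 = vector [u, v, w] $ i" for i
    by (simp add: frame_def vec_eq_iff)
  have "frame u v w *v basis_product (GL_action (matrix_inv (frame u v w)) \<mu>) i j = frame u v w *v vector [a, b, c]"
    unfolding change_basis(1)[OF assms(1), symmetric] ax assms(2) by (simp add: frame_mult)
  then show ?thesis using frame_inject[OF assms(1)] by blast
qed

lemma classified_by_frame:
  assumes "invertible (frame u v w)" "classified (GL_action (matrix_inv (frame u v w)) \<mu>)"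
  shows "classified \<mu>"
  using classified_orbit change_basis(2)[OF assms(1)] assms(2) by blast

lemma right_alternative_change_basis:
  "right_alternative \<mu> \<Longrightarrow> invertible (frame u v w) \<Longrightarrow>
    right_alternative (GL_action (matrix_inv (frame u v w)) \<mu>)"
  by (simp add: right_alternative_GL_action invertible_matrix_inv)

lemma frame_coords:
  assumes "invertible (frame u v w)" obtains a b c where "x = a *s u + b *s v + c *s w"
  using matrix_inv_vector(1)[OF assms, of x] unfolding frame_mult by metis

lemma frame_coords_unique:
  assumes "invertible (frame u v w)" "a *s u + b *s v + c *s w = a' *s u + b' *s v + c' *s w"
  shows "a = a'" "b = b'" "c = c'"
proof -
  have "frame u v w *v vector [a, b, c] = frame u v w *v vector [a', b', c']"
    using assms(2) by (simp add: frame_mult)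
  then have "(vector [a, b, c] :: complex ^ 3) = vector [a', b', c']"
    using frame_inject[OF assms(1)] by blast
  then show "a = a'" "b = b'" "c = c'" by (metis vector_3)+
qed

lemma frame_zero:
  assumes "invertible (frame u v w)" "a *s u + b *s v + c *s w = 0"
  shows "a = 0" "b = 0" "c = 0"
  using frame_coords_unique[OF assms(1), of a b c 0 0 0] assms(2) by simp_all

lemma invertible_frame_swap:
  assumes "invertible (frame u v w)" shows "invertible (frame u w v)"
proof (rule invertible_frame)
  fix a b c assume "a *s u + b *s w + c *s v = 0"
  then have "a *s u + c *s v + b *s w = 0" by (simp add: algebra_simps)
  then show "a = 0 \<and> b = 0 \<and> c = 0" using frame_zero[OF assms] by blast
qed

lemmas alg_mult_bilinear = alg_mult_add_left alg_mult_add_right alg_mult_diff_left alg_mult_diff_right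
  alg_mult_scale_left alg_mult_scale_right

lemma alg_mult_zero [simp]: "alg_mult \<mu> 0 x = 0" "alg_mult \<mu> x 0 = 0"
  using alg_mult_scale_left[of \<mu> 0 0 x] alg_mult_scale_right[of \<mu> x 0 0] by simp_all

lemma alg_mult_uminus: "alg_mult \<mu> (- x) y = - alg_mult \<mu> x y" "alg_mult \<mu> x (- y) = - alg_mult \<mu> x y"
  using alg_mult_diff_left[of \<mu> 0 x y] alg_mult_diff_right[of \<mu> x 0 y] by simp_all

definition peirce2 :: "structure_constants \<Rightarrow> complex ^ 3 \<Rightarrow> complex ^ 3 \<Rightarrow> bool" where
  "peirce2 \<mu> e x \<longleftrightarrow> alg_mult \<mu> e x = x \<and> alg_mult \<mu> x e = x"

definition peirce0 :: "structure_constants \<Rightarrow> complex ^ 3 \<Rightarrow> complex ^ 3 \<Rightarrow> bool" where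
  "peirce0 \<mu> e x \<longleftrightarrow> alg_mult \<mu> e x = 0 \<and> alg_mult \<mu> x e = 0"

text \<open>The next two kinds of vectors together span the eigenspace of \<open>L\<^sub>e + R\<^sub>e\<close> for the eigenvalue \<open>1\<close>.\<close>

definition peirce1a :: "structure_constants \<Rightarrow> complex ^ 3 \<Rightarrow> complex ^ 3 \<Rightarrow> bool" where
  "peirce1a \<mu> e x \<longleftrightarrow> (\<exists>v. peirce0 \<mu> e v \<and> alg_mult \<mu> x e = x + v \<and> alg_mult \<mu> e x = - v)"

definition peirce1b :: "structure_constants \<Rightarrow> complex ^ 3 \<Rightarrow> complex ^ 3 \<Rightarrow> bool" where
  "peirce1b \<mu> e x \<longleftrightarrow> (\<exists>u. peirce2 \<mu> e u \<and> alg_mult \<mu> x e = u \<and> alg_mult \<mu> e x = x - u)"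

definition homogeneous :: "structure_constants \<Rightarrow> complex ^ 3 \<Rightarrow> complex ^ 3 \<Rightarrow> bool" where
  "homogeneous \<mu> e x \<longleftrightarrow> peirce2 \<mu> e x \<or> peirce0 \<mu> e x \<or> peirce1a \<mu> e x \<or> peirce1b \<mu> e x"

text \<open>Twice the Jordan product with \<open>e\<close>. It is always diagonalizable, with
  eigenvalues among 2, 1, 0, whereas left multiplication by an idempotent need not be: see e1 in
  \<open>family_R10\<close> with \<open>u\<close> nonzero.\<close>

definition jordan_mult :: "structure_constants \<Rightarrow> complex ^ 3 \<Rightarrow> complex ^ 3 \<Rightarrow> complex ^ 3" where
  "jordan_mult \<mu> e x = alg_mult \<mu> e x + alg_mult \<mu> x e"

lemma jordan_mult_linear:
  "jordan_mult \<mu> e (x + y) = jordan_mult \<mu> e x + jordan_mult \<mu> e y"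
  "jordan_mult \<mu> e (x - y) = jordan_mult \<mu> e x - jordan_mult \<mu> e y"
  "jordan_mult \<mu> e (c *s x) = c *s jordan_mult \<mu> e x"
  by (simp_all add: jordan_mult_def alg_mult_bilinear vector_add_ldistrib)

lemma peirce_jordan_mult:
  "peirce2 \<mu> e x \<Longrightarrow> jordan_mult \<mu> e x = 2 *s x"
  "peirce0 \<mu> e x \<Longrightarrow> jordan_mult \<mu> e x = 0 *s x"
  "peirce1a \<mu> e x \<Longrightarrow> jordan_mult \<mu> e x = 1 *s x"
  "peirce1b \<mu> e x \<Longrightarrow> jordan_mult \<mu> e x = 1 *s x"
  by (auto simp: peirce2_def peirce0_def peirce1a_def peirce1b_def jordan_mult_def vec_eq_iff)

context
  fixes \<mu> :: structure_constants and e :: "complex ^ 3"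
  assumes RA: "right_alternative \<mu>" and idem: "alg_mult \<mu> e e = e"
begin

text \<open>In terms of \<open>S = L\<^sub>e + R\<^sub>e\<close> and \<open>R = R\<^sub>e\<close> right alternativity says
  \<open>(S - 2 R) (1 - S) = 0\<close> and \<open>R\<^sup>2 = R\<close>.\<close>

lemma jordan_mult_eigen:
  "jordan_mult \<mu> e (jordan_mult \<mu> e x - x) = 2 *s alg_mult \<mu> (jordan_mult \<mu> e x - x) e"
proof -
  have "alg_mult \<mu> (alg_mult \<mu> e e) x + alg_mult \<mu> (alg_mult \<mu> e x) e =
      alg_mult \<mu> e (alg_mult \<mu> e x) + alg_mult \<mu> e (alg_mult \<mu> x e)"
    using RA unfolding right_alternative_alt by blast
  moreover have "alg_mult \<mu> (alg_mult \<mu> x e) e = alg_mult \<mu> x e"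
    using right_alternative_square[OF RA, of x e] idem by simp
  ultimately show ?thesis
    unfolding jordan_mult_def idem by (simp add: alg_mult_bilinear vec_eq_iff algebra_simps)
qed

text \<open>Put y = (S - 1) x. The identity above, applied to x and to y, gives S y = 2 R y and S R
  y = 2 R y, so R y has eigenvalue 2 and y - R y eigenvalue 0. On these S - 1 is 1 and -1, whence
  the sign of \<open>x0\<close>.\<close>

lemma peirce_decomposition:
  obtains x1 x2 x0 where "x = x1 + x2 - x0" "jordan_mult \<mu> e x1 = x1" "peirce2 \<mu> e x2" "peirce0 \<mu> e x0"
proof -
  define y where "y = jordan_mult \<mu> e x - x"
  have Sy: "jordan_mult \<mu> e y = 2 *s alg_mult \<mu> y e" unfolding y_def by (rule jordan_mult_eigen)
  have RR: "alg_mult \<mu> (alg_mult \<mu> y e) e = alg_mult \<mu> y e"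
    using right_alternative_square[OF RA, of y e] idem by simp
  have "jordan_mult \<mu> e (jordan_mult \<mu> e y - y) = 2 *s alg_mult \<mu> (jordan_mult \<mu> e y - y) e"
    by (rule jordan_mult_eigen)
  then have SS: "jordan_mult \<mu> e (alg_mult \<mu> y e) = 2 *s alg_mult \<mu> y e"
    unfolding Sy by (simp add: jordan_mult_linear Sy alg_mult_bilinear RR vec_eq_iff algebra_simps)
  define x2 where "x2 = alg_mult \<mu> y e"
  define x0 where "x0 = y - x2"
  have R2: "alg_mult \<mu> x2 e = x2" using RR by (simp add: x2_def)
  have p2: "peirce2 \<mu> e x2"
    using SS R2 unfolding peirce2_def x2_def[symmetric] jordan_mult_def by (simp add: vec_eq_iff)
  have "alg_mult \<mu> x0 e = 0" unfolding x0_def by (simp add: alg_mult_bilinear R2) (simp add: x2_def)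
  moreover have "jordan_mult \<mu> e x0 = 0"
    unfolding x0_def by (simp add: jordan_mult_linear Sy) (simp add: SS x2_def)
  ultimately have p0: "peirce0 \<mu> e x0" unfolding peirce0_def jordan_mult_def by simp
  have "jordan_mult \<mu> e (x - x2 + x0) = x - x2 + x0"
    using peirce_jordan_mult(1)[OF p2] peirce_jordan_mult(2)[OF p0]
    by (simp add: jordan_mult_linear) (simp add: x0_def y_def vec_eq_iff algebra_simps)
  moreover have "x = (x - x2 + x0) + x2 - x0" by simp
  ultimately show ?thesis using that p2 p0 by blast
qed

text \<open>Here x e is decomposed instead of x. Since R is idempotent, the eigenvalue 1 part y of x
  e satisfies y e = y - v, and R sends x - y to the eigenvalue 2 part u.\<close>

lemma peirce1_decomposition:
  assumes "jordan_mult \<mu> e x = x"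
  obtains y z where "x = y + z" "peirce1a \<mu> e y" "peirce1b \<mu> e z"
proof -
  obtain y u v where d: "alg_mult \<mu> x e = y + u - v" "jordan_mult \<mu> e y = y" "peirce2 \<mu> e u" "peirce0 \<mu> e v"
    by (rule peirce_decomposition)
  have "alg_mult \<mu> (alg_mult \<mu> x e) e = alg_mult \<mu> x e"
    using right_alternative_square[OF RA, of x e] idem by simp
  then have Ry: "alg_mult \<mu> y e = y + - v" using d
    by (simp add: d(1) alg_mult_bilinear peirce2_def peirce0_def)
  have Ly: "alg_mult \<mu> e y = - (- v)" using d(2) Ry unfolding jordan_mult_def
    by (simp add: algebra_simps)
  have "peirce0 \<mu> e (- v)" using d(4) by (simp add: peirce0_def alg_mult_uminus)
  then have "peirce1a \<mu> e y" unfolding peirce1a_def using Ry Ly by blast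
  moreover have "peirce1b \<mu> e (x - y)"
  proof -
    have "alg_mult \<mu> (x - y) e = u" using d(1) Ry by (simp add: alg_mult_bilinear)
    moreover have "jordan_mult \<mu> e (x - y) = x - y" using assms d(2) by (simp add: jordan_mult_linear)
    ultimately have "alg_mult \<mu> e (x - y) = (x - y) - u" unfolding jordan_mult_def by (metis add_diff_cancel)
    then show ?thesis using \<open>alg_mult \<mu> (x - y) e = u\<close> d(3) unfolding peirce1b_def by blast
  qed
  moreover have "x = y + (x - y)" by simp
  ultimately show ?thesis using that by blast
qed

text \<open>By the two decompositions homogeneous vectors span, so a maximal independent set of them
  containing \<open>e\<close> is a basis.\<close>

lemma homogeneous_basis:
  assumes "e \<noteq> 0"
  obtains u v where "invertible (frame e u v)" "homogeneous \<mu> e u" "homogeneous \<mu> e v"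
proof -
  have "homogeneous \<mu> e e" unfolding homogeneous_def peirce2_def using idem by blast
  moreover have "vec.independent {e}" using assms by simp
  ultimately obtain B where B: "{e} \<subseteq> B" "B \<subseteq> Collect (homogeneous \<mu> e)" "vec.independent B"
    "Collect (homogeneous \<mu> e) \<subseteq> vec.span B"
    using vec.maximal_independent_subset_extend[of "{e}" "Collect (homogeneous \<mu> e)"] by blast
  have "x \<in> vec.span B" for x
  proof -
    obtain x1 x2 x0 where 1: "x = x1 + x2 - x0" "jordan_mult \<mu> e x1 = x1" "peirce2 \<mu> e x2" "peirce0 \<mu> e x0"
      by (rule peirce_decomposition)
    obtain y z where 2: "x1 = y + z" "peirce1a \<mu> e y" "peirce1b \<mu> e z"
      using peirce1_decomposition[OF 1(2)] .
    have "homogeneous \<mu> e y" "homogeneous \<mu> e z" "homogeneous \<mu> e x2" "homogeneous \<mu> e x0"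
      using 1 2 unfolding homogeneous_def by blast+
    then show ?thesis unfolding 1(1) 2(1) using B(4)
      by (intro vec.span_add vec.span_diff) blast+
  qed
  then have "vec.span B = vec.span UNIV" by auto
  then have "card B = vec.dim (UNIV :: (complex ^ 3) set)"
    using vec.dim_eq_card[of B UNIV] B(3) by simp
  then have card: "card B = 3" by (simp add: card_cart_basis)
  then have "finite B" by (simp add: card_ge_0_finite)
  then have "card (B - {e}) = 2" using card B(1) by simp
  then obtain u v where uv: "B - {e} = {u, v}" "u \<noteq> v" by (metis card_2_iff)
  then have Beq: "B = {e, u, v}" and ne: "e \<noteq> u" "e \<noteq> v" using B(1) by auto
  have "invertible (frame e u v)"
  proof (rule invertible_frame)
    fix a b c assume z: "a *s e + b *s u + c *s v = 0"
    define f where "f x = (if x = e then a else if x = u then b else c)" for x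
    have "(\<Sum>x\<in>B. f x *s x) = 0" unfolding Beq f_def using z ne uv(2) by (simp add: add.assoc)
    then have "f x = 0" if "x \<in> B" for x
      using vec.independentD[OF B(3) \<open>finite B\<close> subset_refl] that by blast
    then have "f e = 0" "f u = 0" "f v = 0" using Beq by auto
    then show "a = 0 \<and> b = 0 \<and> c = 0" using ne uv(2) by (auto simp: f_def)
  qed
  moreover have "homogeneous \<mu> e u" "homogeneous \<mu> e v" using B(2) Beq by auto
  ultimately show ?thesis using that by blast
qed

end

text \<open>S kills the vector, so only basis vectors of eigenvalue 0 can occur in it. The next
  lemma argues in the same way for eigenvalue 2, where \<open>e\<close> itself contributes.\<close>

lemma peirce0_coords:
  assumes inv: "invertible (frame e u v)" and idem: "alg_mult \<mu> e e = e" and x: "peirce0 \<mu> e x"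
    and S: "jordan_mult \<mu> e u = a *s u" "jordan_mult \<mu> e v = b *s v"
  obtains c d where "x = c *s u + d *s v" "c * a = 0" "d * b = 0"
proof -
  obtain k c d where k: "x = k *s e + c *s u + d *s v" by (rule frame_coords[OF inv])
  have "jordan_mult \<mu> e e = 2 *s e" by (simp add: jordan_mult_def idem vec_eq_iff)
  then have "(2 * k) *s e + (c * a) *s u + (d * b) *s v = jordan_mult \<mu> e x"
    unfolding k by (simp add: jordan_mult_linear S vector_smult_assoc mult.commute)
  also have "\<dots> = 0" using peirce_jordan_mult(2)[OF x] by simp
  finally have "2 * k = 0" "c * a = 0" "d * b = 0" using frame_zero[OF inv] by blast+
  then show ?thesis using k that[of c d] by simp
qed

lemma peirce2_coords:
  assumes inv: "invertible (frame e u v)" and idem: "alg_mult \<mu> e e = e" and x: "peirce2 \<mu> e x"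
    and S: "jordan_mult \<mu> e u = a *s u" "jordan_mult \<mu> e v = b *s v"
  obtains k c d where "x = k *s e + c *s u + d *s v" "c * a = c * 2" "d * b = d * 2"
proof -
  obtain k c d where k: "x = k *s e + c *s u + d *s v" by (rule frame_coords[OF inv])
  have "jordan_mult \<mu> e e = 2 *s e" by (simp add: jordan_mult_def idem vec_eq_iff)
  then have "(2 * k) *s e + (c * a) *s u + (d * b) *s v = jordan_mult \<mu> e x"
    unfolding k by (simp add: jordan_mult_linear S vector_smult_assoc mult.commute)
  also have "\<dots> = 2 *s x" by (rule peirce_jordan_mult(1)[OF x])
  also have "\<dots> = (2 * k) *s e + (c * 2) *s u + (d * 2) *s v"
    unfolding k by (simp add: vec_eq_iff algebra_simps)
  finally have "c * a = c * 2" "d * b = d * 2" by (rule frame_coords_unique[OF inv])+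
  then show ?thesis using k that by blast
qed

text \<open>In this and the next seven lemmas the error vectors in the definitions of types 1a and
  1b lie in the eigenspaces 0 and 2, so they are expressed by the basis vectors of those
  eigenvalues. The products with \<open>e\<close> then form one of the tables solved above.\<close>

lemma classified_basis_1a_1a:
  assumes RA: "right_alternative \<mu>" and idem: "alg_mult \<mu> e e = e" and inv: "invertible (frame e u v)"
    and u: "peirce1a \<mu> e u" and v: "peirce1a \<mu> e v"
  shows "classified \<mu>"
proof -
  note S = peirce_jordan_mult(3)[OF u] peirce_jordan_mult(3)[OF v]
  obtain u' where u': "peirce0 \<mu> e u'" "alg_mult \<mu> u e = u + u'" "alg_mult \<mu> e u = - u'"
    using u unfolding peirce1a_def by blast
  obtain c0 b where hu: "u' = c0 *s u + b *s v" "c0 * 1 = 0" "b * 1 = 0"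
    by (rule peirce0_coords[OF inv idem u'(1) S])
  then have equ: "u' = 0" by simp
  obtain v' where v': "peirce0 \<mu> e v'" "alg_mult \<mu> v e = v + v'" "alg_mult \<mu> e v = - v'"
    using v unfolding peirce1a_def by blast
  obtain c0 b where hv: "v' = c0 *s u + b *s v" "c0 * 1 = 0" "b * 1 = 0"
    by (rule peirce0_coords[OF inv idem v'(1) S])
  then have eqv: "v' = 0" by simp
  show ?thesis
    by (rule classified_by_frame[OF inv classified_peirce_1a_1a[OF right_alternative_change_basis[OF RA inv]]])
      (rule change_basis_product[OF inv], simp add: idem u'(2,3) equ v'(2,3) eqv vec_eq_iff)+
qed

lemma classified_basis_1a_1b:
  assumes RA: "right_alternative \<mu>" and idem: "alg_mult \<mu> e e = e" and inv: "invertible (frame e u v)"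
    and u: "peirce1a \<mu> e u" and v: "peirce1b \<mu> e v"
  shows "classified \<mu>"
proof -
  note S = peirce_jordan_mult(3)[OF u] peirce_jordan_mult(4)[OF v]
  obtain u' where u': "peirce0 \<mu> e u'" "alg_mult \<mu> u e = u + u'" "alg_mult \<mu> e u = - u'"
    using u unfolding peirce1a_def by blast
  obtain c0 b where hu: "u' = c0 *s u + b *s v" "c0 * 1 = 0" "b * 1 = 0"
    by (rule peirce0_coords[OF inv idem u'(1) S])
  then have equ: "u' = 0" by simp
  obtain v' where v': "peirce2 \<mu> e v'" "alg_mult \<mu> v e = v'" "alg_mult \<mu> e v = v - v'"
    using v unfolding peirce1b_def by blast
  obtain c c0 d0 where hv: "v' = c *s e + c0 *s u + d0 *s v" "c0 * 1 = c0 * 2" "d0 * 1 = d0 * 2"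
    by (rule peirce2_coords[OF inv idem v'(1) S])
  then have eqv: "v' = c *s e" by simp
  show ?thesis
    by (rule classified_by_frame[OF inv classified_peirce_1a_1b[where u = c, OF right_alternative_change_basis[OF RA inv]]])
      (rule change_basis_product[OF inv], simp add: idem u'(2,3) equ v'(2,3) eqv vec_eq_iff)+
qed

lemma classified_basis_1b_1b:
  assumes RA: "right_alternative \<mu>" and idem: "alg_mult \<mu> e e = e" and inv: "invertible (frame e u v)"
    and u: "peirce1b \<mu> e u" and v: "peirce1b \<mu> e v"
  shows "classified \<mu>"
proof -
  note S = peirce_jordan_mult(4)[OF u] peirce_jordan_mult(4)[OF v]
  obtain u' where u': "peirce2 \<mu> e u'" "alg_mult \<mu> u e = u'" "alg_mult \<mu> e u = u - u'"
    using u unfolding peirce1b_def by blast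
  obtain b c0 d0 where hu: "u' = b *s e + c0 *s u + d0 *s v" "c0 * 1 = c0 * 2" "d0 * 1 = d0 * 2"
    by (rule peirce2_coords[OF inv idem u'(1) S])
  then have equ: "u' = b *s e" by simp
  obtain v' where v': "peirce2 \<mu> e v'" "alg_mult \<mu> v e = v'" "alg_mult \<mu> e v = v - v'"
    using v unfolding peirce1b_def by blast
  obtain c c0 d0 where hv: "v' = c *s e + c0 *s u + d0 *s v" "c0 * 1 = c0 * 2" "d0 * 1 = d0 * 2"
    by (rule peirce2_coords[OF inv idem v'(1) S])
  then have eqv: "v' = c *s e" by simp
  show ?thesis
    by (rule classified_by_frame[OF inv classified_peirce_1b_1b[where u = b and w = c, OF right_alternative_change_basis[OF RA inv]]])
      (rule change_basis_product[OF inv], simp add: idem u'(2,3) equ v'(2,3) eqv vec_eq_iff)+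
qed

lemma classified_basis_1a_0:
  assumes RA: "right_alternative \<mu>" and idem: "alg_mult \<mu> e e = e" and inv: "invertible (frame e u v)"
    and u: "peirce1a \<mu> e u" and v: "peirce0 \<mu> e v"
  shows "classified \<mu>"
proof -
  note S = peirce_jordan_mult(3)[OF u] peirce_jordan_mult(2)[OF v]
  obtain u' where u': "peirce0 \<mu> e u'" "alg_mult \<mu> u e = u + u'" "alg_mult \<mu> e u = - u'"
    using u unfolding peirce1a_def by blast
  obtain c0 b where hu: "u' = c0 *s u + b *s v" "c0 * 1 = 0" "b * 0 = 0"
    by (rule peirce0_coords[OF inv idem u'(1) S])
  then have equ: "u' = b *s v" by simp
  show ?thesis
    by (rule classified_by_frame[OF inv classified_peirce_1a_0[where v = b, OF right_alternative_change_basis[OF RA inv]]])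
      (rule change_basis_product[OF inv], simp add: idem v[unfolded peirce0_def] u'(2,3) equ vec_eq_iff)+
qed

lemma classified_basis_1b_0:
  assumes RA: "right_alternative \<mu>" and idem: "alg_mult \<mu> e e = e" and inv: "invertible (frame e u v)"
    and u: "peirce1b \<mu> e u" and v: "peirce0 \<mu> e v"
  shows "classified \<mu>"
proof -
  note S = peirce_jordan_mult(4)[OF u] peirce_jordan_mult(2)[OF v]
  obtain u' where u': "peirce2 \<mu> e u'" "alg_mult \<mu> u e = u'" "alg_mult \<mu> e u = u - u'"
    using u unfolding peirce1b_def by blast
  obtain b c0 d0 where hu: "u' = b *s e + c0 *s u + d0 *s v" "c0 * 1 = c0 * 2" "d0 * 0 = d0 * 2"
    by (rule peirce2_coords[OF inv idem u'(1) S])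
  then have equ: "u' = b *s e" by simp
  show ?thesis
    by (rule classified_by_frame[OF inv classified_peirce_1b_0[where u = b, OF right_alternative_change_basis[OF RA inv]]])
      (rule change_basis_product[OF inv], simp add: idem v[unfolded peirce0_def] u'(2,3) equ vec_eq_iff)+
qed

lemma classified_basis_2_1a:
  assumes RA: "right_alternative \<mu>" and idem: "alg_mult \<mu> e e = e" and inv: "invertible (frame e u v)"
    and u: "peirce2 \<mu> e u" and v: "peirce1a \<mu> e v"
  shows "classified \<mu>"
proof -
  note S = peirce_jordan_mult(1)[OF u] peirce_jordan_mult(3)[OF v]
  obtain v' where v': "peirce0 \<mu> e v'" "alg_mult \<mu> v e = v + v'" "alg_mult \<mu> e v = - v'"
    using v unfolding peirce1a_def by blast
  obtain c0 b where hv: "v' = c0 *s u + b *s v" "c0 * 2 = 0" "b * 1 = 0"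
    by (rule peirce0_coords[OF inv idem v'(1) S])
  then have eqv: "v' = 0" by simp
  show ?thesis
    by (rule classified_by_frame[OF inv classified_peirce_2_1a[OF right_alternative_change_basis[OF RA inv]]])
      (rule change_basis_product[OF inv], simp add: idem u[unfolded peirce2_def] v'(2,3) eqv vec_eq_iff)+
qed

lemma classified_basis_2_1b:
  assumes RA: "right_alternative \<mu>" and idem: "alg_mult \<mu> e e = e" and inv: "invertible (frame e u v)"
    and u: "peirce2 \<mu> e u" and v: "peirce1b \<mu> e v"
  shows "classified \<mu>"
proof -
  note S = peirce_jordan_mult(1)[OF u] peirce_jordan_mult(4)[OF v]
  obtain v' where v': "peirce2 \<mu> e v'" "alg_mult \<mu> v e = v'" "alg_mult \<mu> e v = v - v'"
    using v unfolding peirce1b_def by blast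
  obtain c d d0 where hv: "v' = c *s e + d *s u + d0 *s v" "d * 2 = d * 2" "d0 * 1 = d0 * 2"
    by (rule peirce2_coords[OF inv idem v'(1) S])
  then have eqv: "v' = c *s e + d *s u" by simp
  show ?thesis
    by (rule classified_by_frame[OF inv classified_peirce_2_1b[where u = c and w = d, OF right_alternative_change_basis[OF RA inv]]])
      (rule change_basis_product[OF inv], simp add: idem u[unfolded peirce2_def] v'(2,3) eqv vec_eq_iff)+
qed

lemma classified_basis_2_0:
  assumes RA: "right_alternative \<mu>" and idem: "alg_mult \<mu> e e = e" and inv: "invertible (frame e u v)"
    and u: "peirce2 \<mu> e u" and v: "peirce0 \<mu> e v"
  shows "classified \<mu>"
proof -
  note S = peirce_jordan_mult(1)[OF u] peirce_jordan_mult(2)[OF v]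
  show ?thesis
    by (rule classified_by_frame[OF inv classified_peirce_2_0[OF right_alternative_change_basis[OF RA inv]]])
      (rule change_basis_product[OF inv], simp add: idem u[unfolded peirce2_def] v[unfolded peirce0_def] vec_eq_iff)+
qed

text \<open>Up to exchanging the two vectors, eight pairs of types have been treated. In the
  remaining pairs 0-0 and 2-2 the idempotent says nothing about products inside the complement, so
  they need separate arguments.\<close>

lemma classified_homogeneous_basis:
  assumes RA: "right_alternative \<mu>" and idem: "alg_mult \<mu> e e = e" and inv: "invertible (frame e u v)"
    and "homogeneous \<mu> e u" "homogeneous \<mu> e v"
  shows "classified \<mu> \<or> peirce0 \<mu> e u \<and> peirce0 \<mu> e v \<or> peirce2 \<mu> e u \<and> peirce2 \<mu> e v"
proof -
  note l = classified_basis_1a_1a classified_basis_1a_1b classified_basis_1b_1b classified_basis_1a_0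
    classified_basis_1b_0 classified_basis_2_1a classified_basis_2_1b classified_basis_2_0
  note l1 = l[OF RA idem inv] and l2 = l[OF RA idem invertible_frame_swap[OF inv]]
  show ?thesis using assms(4,5) l1 l2 unfolding homogeneous_def by blast
qed

lemma idempotent_trichotomy:
  assumes RA: "right_alternative \<mu>" and idem: "alg_mult \<mu> e e = e" "e \<noteq> 0"
  obtains "classified \<mu>"
  | u v where "invertible (frame e u v)" "peirce0 \<mu> e u" "peirce0 \<mu> e v"
  | u v where "invertible (frame e u v)" "peirce2 \<mu> e u" "peirce2 \<mu> e v"
  using homogeneous_basis[OF RA idem] classified_homogeneous_basis[OF RA idem(1)] by metis

lemma classified_monogenic:
  assumes RA: "right_alternative \<mu>"
    and inv: "invertible (frame x (alg_mult \<mu> x x) (alg_mult \<mu> (alg_mult \<mu> x x) x))"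
  shows "classified \<mu>"
proof -
  let ?y = "alg_mult \<mu> x x" let ?z = "alg_mult \<mu> ?y x"
  obtain a b c where abc: "alg_mult \<mu> ?z x = a *s x + b *s ?y + c *s ?z" by (rule frame_coords[OF inv])
  show ?thesis
    by (rule classified_by_frame[OF inv
        classified_monogenic_coords[where a = a and b = b and c = c, OF right_alternative_change_basis[OF RA inv]]])
      (rule change_basis_product[OF inv], simp add: abc)+
qed

lemma not_invertible_frame:
  assumes "\<not> invertible (frame u v w)"
  obtains a b c where "a *s u + b *s v + c *s w = 0" "a \<noteq> 0 \<or> b \<noteq> 0 \<or> c \<noteq> 0"
  using invertible_frame assms by metis

lemma peirce_span_mult:
  assumes inv: "invertible (frame e u v)" and idem: "alg_mult \<mu> e e = e"
  shows "peirce0 \<mu> e u \<Longrightarrow> peirce0 \<mu> e v \<Longrightarrow> alg_mult \<mu> (a *s e + b *s u + c *s v) e = a *s e"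
    and "peirce2 \<mu> e u \<Longrightarrow> peirce2 \<mu> e v \<Longrightarrow> alg_mult \<mu> x e = x"
    and "peirce2 \<mu> e u \<Longrightarrow> peirce2 \<mu> e v \<Longrightarrow> alg_mult \<mu> e x = x"
proof -
  show "peirce0 \<mu> e u \<Longrightarrow> peirce0 \<mu> e v \<Longrightarrow> alg_mult \<mu> (a *s e + b *s u + c *s v) e = a *s e"
    by (simp add: peirce0_def alg_mult_bilinear idem)
  obtain a b c where x: "x = a *s e + b *s u + c *s v" by (rule frame_coords[OF inv])
  show "peirce2 \<mu> e u \<Longrightarrow> peirce2 \<mu> e v \<Longrightarrow> alg_mult \<mu> x e = x"
    and "peirce2 \<mu> e u \<Longrightarrow> peirce2 \<mu> e v \<Longrightarrow> alg_mult \<mu> e x = x"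
    unfolding x by (simp_all add: peirce2_def alg_mult_bilinear idem)
qed

section \<open>Classification\<close>

lemma peirce0_linear:
  "peirce0 \<mu> e x \<Longrightarrow> peirce0 \<mu> e (c *s x)"
  "peirce0 \<mu> e x \<Longrightarrow> peirce0 \<mu> e y \<Longrightarrow> peirce0 \<mu> e (x + y)"
  "peirce0 \<mu> e x \<Longrightarrow> peirce0 \<mu> e y \<Longrightarrow> peirce0 \<mu> e (x - y)"
  by (simp_all add: peirce0_def alg_mult_bilinear)

text \<open>The Peirce 0 space is a subalgebra annihilated by \<open>e\<close>. If it contains x
  with x, x^2 independent, then e + t x generates the algebra for some \<open>t\<close>. Otherwise
  x^2 is always a multiple of x, and the space either has all squares zero or contains a second
  idempotent.\<close>

lemma classified_peirce0_complement:
  assumes RA: "right_alternative \<mu>" and idem: "alg_mult \<mu> e e = e"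
    and inv: "invertible (frame e u v)" and u: "peirce0 \<mu> e u" and v: "peirce0 \<mu> e v"
  shows "classified \<mu>"
proof (rule ccontr)
  assume nc: "\<not> classified \<mu>"
  have e0: "e \<noteq> 0" using frame_zero(1)[OF inv, of 1 0 0] by auto
  have span: "\<exists>b c. x = b *s u + c *s v" if "alg_mult \<mu> x e = 0" for x
  proof -
    obtain a b c where x: "x = a *s e + b *s u + c *s v" by (rule frame_coords[OF inv])
    have "a *s e = 0" using peirce_span_mult(1)[OF inv idem u v] that unfolding x by metis
    then have "x = b *s u + c *s v" using x by simp
    then show ?thesis by blast
  qed
  have P0: "peirce0 \<mu> e x" if "alg_mult \<mu> x e = 0" for x
    using span[OF that] peirce0_linear(1)[OF u] peirce0_linear(1)[OF v] peirce0_linear(2) by metis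
  have closed: "peirce0 \<mu> e (alg_mult \<mu> x y)" if "peirce0 \<mu> e x" "peirce0 \<mu> e y" for x y
  proof (rule P0)
    have "alg_mult \<mu> (alg_mult \<mu> x y) e + alg_mult \<mu> (alg_mult \<mu> x e) y =
        alg_mult \<mu> x (alg_mult \<mu> y e) + alg_mult \<mu> x (alg_mult \<mu> e y)"
      using RA unfolding right_alternative_alt by blast
    then show "alg_mult \<mu> (alg_mult \<mu> x y) e = 0" using that by (simp add: peirce0_def)
  qed
  have square: "\<exists>l. alg_mult \<mu> x x = l *s x" if x: "peirce0 \<mu> e x" "x \<noteq> 0" for x
  proof (cases "invertible (frame e x (alg_mult \<mu> x x))")
    case True
    let ?y = "alg_mult \<mu> x x"
    have y: "peirce0 \<mu> e ?y" "peirce0 \<mu> e (alg_mult \<mu> ?y x)" using closed x by blast+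
    obtain a p q where a: "alg_mult \<mu> ?y x = a *s e + p *s x + q *s ?y" by (rule frame_coords[OF True])
    then have "a *s e = 0"
      using peirce_span_mult(1)[OF True idem x(1) y(1), of a p q] y(2) unfolding peirce0_def by simp
    then have pq: "alg_mult \<mu> ?y x = p *s x + q *s ?y" using a by simp
    \<comment> \<open>The vector e + t x generates when 1 is not an eigenvalue of t x, whose
      eigenvalues on the plane of x, x^2 are t times the roots of X^2 - q X - p. One of t = 1, -1, 2
      works.\<close>
    have "\<exists>t. t \<noteq> 0 \<and> 1 - t * q - t ^ 2 * p \<noteq> 0"
    proof (rule ccontr)
      assume "\<not> ?thesis"
      then have h: "1 - t * q - t ^ 2 * p = 0" if "t \<noteq> 0" for t using that by blast
      have "2 * q = (1 - (-1) * q - (-1) ^ 2 * p) - (1 - 1 * q - 1 ^ 2 * p)" by simp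
      also have "\<dots> = 0" by (subst (1 2) h) simp_all
      finally have "2 * q = 0" .
      then have "q = 0" by simp
      then have "p = 1" using h[of 1] by simp
      then show False using h[of 2] \<open>q = 0\<close> by simp
    qed
    then obtain t where t: "t \<noteq> 0" "1 - t * q - t ^ 2 * p \<noteq> 0" by blast
    let ?X = "e + t *s x"
    have XX: "alg_mult \<mu> ?X ?X = e + (t ^ 2) *s ?y"
      using x(1) by (simp add: alg_mult_bilinear idem peirce0_def vector_smult_assoc power2_eq_square)
    have XXX: "alg_mult \<mu> (alg_mult \<mu> ?X ?X) ?X = e + (t ^ 3 * p) *s x + (t ^ 3 * q) *s ?y"
      using x(1) y(1) unfolding XX
      by (simp add: alg_mult_bilinear idem peirce0_def pq vec_eq_iff power2_eq_square power3_eq_cube algebra_simps)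
    have "invertible (frame ?X (alg_mult \<mu> ?X ?X) (alg_mult \<mu> (alg_mult \<mu> ?X ?X) ?X))"
    proof (rule invertible_frame)
      fix a b c
      assume "a *s ?X + b *s alg_mult \<mu> ?X ?X + c *s alg_mult \<mu> (alg_mult \<mu> ?X ?X) ?X = 0"
      then have "(a + b + c) *s e + (a * t + c * t ^ 3 * p) *s x + (b * t ^ 2 + c * t ^ 3 * q) *s ?y = 0"
        unfolding XXX unfolding XX by (simp add: vec_eq_iff algebra_simps)
      then have r: "a + b + c = 0" "a * t + c * t ^ 3 * p = 0" "b * t ^ 2 + c * t ^ 3 * q = 0"
        using frame_zero[OF True] by blast+
      have "t * (a + c * t ^ 2 * p) = 0" using r(2) by algebra
      then have ra: "a = - c * t ^ 2 * p" using t(1) by (simp add: eq_neg_iff_add_eq_0)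
      have "t ^ 2 * (b + c * t * q) = 0" using r(3) by algebra
      then have rb: "b = - c * t * q" using t(1) by (simp add: eq_neg_iff_add_eq_0)
      have "c * (1 - t * q - t ^ 2 * p) = 0" using r(1) ra rb by algebra
      then have "c = 0" using t(2) by simp
      then show "a = 0 \<and> b = 0 \<and> c = 0" using ra rb by simp
    qed
    then show ?thesis using classified_monogenic[OF RA] nc by blast
  next
    case False
    then obtain a b c where abc: "a *s e + b *s x + c *s alg_mult \<mu> x x = 0" "a \<noteq> 0 \<or> b \<noteq> 0 \<or> c \<noteq> 0"
      by (rule not_invertible_frame)
    have "alg_mult \<mu> (a *s e + b *s x + c *s alg_mult \<mu> x x) e = a *s e"
      using x(1) closed[OF x(1) x(1)] by (simp add: alg_mult_bilinear idem peirce0_def)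
    then have a: "a = 0" using abc(1) e0 by simp
    then have "c \<noteq> 0" using abc x(2) by auto
    then have "alg_mult \<mu> x x = (- b / c) *s x" using abc(1) a by (simp add: vec_eq_iff field_simps eq_neg_iff_add_eq_0)
    then show ?thesis by blast
  qed
  show False
  proof (cases "\<forall>x. peirce0 \<mu> e x \<longrightarrow> alg_mult \<mu> x x = 0")
    case True
    then have z: "alg_mult \<mu> u u = 0" "alg_mult \<mu> v v = 0" "alg_mult \<mu> (u + v) (u + v) = 0"
      using u v peirce0_linear(2)[OF u v] by blast+
    then have s: "alg_mult \<mu> v u = - alg_mult \<mu> u v"
      by (simp add: alg_mult_bilinear eq_neg_iff_add_eq_0)
    obtain a b c where abc: "alg_mult \<mu> u v = a *s e + b *s u + c *s v" by (rule frame_coords[OF inv])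
    note f = idem u[unfolded peirce0_def] v[unfolded peirce0_def] z(1,2) s abc vec_eq_iff
    have "classified \<mu>"
      by (rule classified_by_frame[OF inv
          classified_peirce_0_0_null[where x = a and y = b and z = c,
            OF right_alternative_change_basis[OF RA inv]]])
        (rule change_basis_product[OF inv], simp add: f)+
    then show False using nc by blast
  next
    case False
    then obtain x where x: "peirce0 \<mu> e x" "alg_mult \<mu> x x \<noteq> 0" by blast
    then have "x \<noteq> 0" by auto
    then obtain l where l: "alg_mult \<mu> x x = l *s x" using square x(1) by blast
    then have l0: "l \<noteq> 0" using x(2) by auto
    define f where "f = (1 / l) *s x"
    have f: "alg_mult \<mu> f f = f" "f \<noteq> 0" "peirce0 \<mu> e f"
      using l l0 \<open>x \<noteq> 0\<close> peirce0_linear(1)[OF x(1)] by (simp_all add: f_def alg_mult_bilinear vector_smult_assoc)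
    show False
    \<comment> \<open>The unital case would give e f = e, while e f = 0.\<close>
    proof (rule idempotent_trichotomy[OF RA f(1,2)])
      assume "classified \<mu>" then show False using nc by blast
    next
      fix u' v' assume "invertible (frame f u' v')" "peirce2 \<mu> f u'" "peirce2 \<mu> f v'"
      then have "alg_mult \<mu> e f = e" using peirce_span_mult(2)[OF _ f(1)] by blast
      then show False using f(3) e0 by (simp add: peirce0_def)
    next
      fix u' v' assume inv': "invertible (frame f u' v')" and u': "peirce0 \<mu> f u'" and v': "peirce0 \<mu> f v'"
      obtain b c where bc: "f = b *s u + c *s v" using span f(3) unfolding peirce0_def by blast
      obtain w where w: "peirce0 \<mu> e w" "invertible (frame e f w)"
      proof (cases "b = 0")
        case True
        then have "c \<noteq> 0" using bc f(2) by auto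
        have "invertible (frame e f u)"
        proof (rule invertible_frame)
          fix k m n assume "k *s e + m *s f + n *s u = 0"
          then have "k *s e + n *s u + (m * c) *s v = 0" unfolding bc True by (simp add: vec_eq_iff algebra_simps)
          then show "k = 0 \<and> m = 0 \<and> n = 0" using frame_zero[OF inv] \<open>c \<noteq> 0\<close> by (metis mult_eq_0_iff)
        qed
        then show ?thesis using that u by blast
      next
        case False
        have "invertible (frame e f v)"
        proof (rule invertible_frame)
          fix k m n assume "k *s e + m *s f + n *s v = 0"
          then have "k *s e + (m * b) *s u + (m * c + n) *s v = 0" unfolding bc by (simp add: vec_eq_iff algebra_simps)
          then have "k = 0" "m * b = 0" "m * c + n = 0" using frame_zero[OF inv] by blast+
          then show "k = 0 \<and> m = 0 \<and> n = 0" using False by auto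
        qed
        then show ?thesis using that v by blast
      qed
      obtain k m n where wk: "w = k *s f + m *s u' + n *s v'" by (rule frame_coords[OF inv'])
      \<comment> \<open>Without its f-component, w lies in the Peirce 0 spaces of both
        idempotents.\<close>
      define z where "z = w - k *s f"
      have z: "peirce0 \<mu> e z" "peirce0 \<mu> f z"
        using w(1) f(3) peirce0_linear unfolding z_def by blast
          (use u' v' peirce0_linear in \<open>simp add: z_def wk\<close>)
      have invz: "invertible (frame e f z)"
      proof (rule invertible_frame)
        fix k' m n assume "k' *s e + m *s f + n *s z = 0"
        then have "k' *s e + (m - n * k) *s f + n *s w = 0" unfolding z_def by (simp add: vec_eq_iff algebra_simps)
        then have "k' = 0" "m - n * k = 0" "n = 0" using frame_zero[OF w(2)] by blast+
        then show "k' = 0 \<and> m = 0 \<and> n = 0" by auto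
      qed
      then have "z \<noteq> 0" using frame_zero(3)[OF invz, of 0 0 1] by auto
      then obtain p where p: "alg_mult \<mu> z z = p *s z" using square z(1) by blast
      note fs = idem f(1) f(3)[unfolded peirce0_def] z[unfolded peirce0_def] p
      have "classified \<mu>"
        by (rule classified_by_frame[OF invz
            classified_diagonal_coords[where p = p,
              OF right_alternative_change_basis[OF RA invz]]])
          (rule change_basis_product[OF invz], simp add: fs)+
      then show False using nc by blast
    qed
  qed
qed

text \<open>If no vector generates the algebra, each x satisfies a quadratic equation over the unit.
  After completing the square, a nonzero discriminant yields a proper idempotent, for which
  everything is settled; otherwise the complement has a basis of two anticommuting square-zero
  vectors.\<close>

lemma classified_unital:
  assumes RA: "right_alternative \<mu>" and idem: "alg_mult \<mu> e e = e"
    and inv: "invertible (frame e u v)" and u: "peirce2 \<mu> e u" and v: "peirce2 \<mu> e v"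
  shows "classified \<mu>"
proof (rule ccontr)
  assume nc: "\<not> classified \<mu>"
  have e0: "e \<noteq> 0" using frame_zero(1)[OF inv, of 1 0 0] by auto
  have unit: "alg_mult \<mu> e x = x" "alg_mult \<mu> x e = x" for x
    using peirce_span_mult(2,3)[OF inv idem u v] by blast+
  have not_inv: "\<not> invertible (frame e x (alg_mult \<mu> x x))" for x
  proof
    let ?y = "alg_mult \<mu> x x"
    assume I: "invertible (frame e x ?y)"
    obtain a b c where abc: "alg_mult \<mu> ?y x = a *s e + b *s x + c *s ?y" by (rule frame_coords[OF I])
    \<comment> \<open>The powers of x + t e, starting at the first, span exactly when x + t e is
      invertible, that is when -t is not a root of X^3 - c X^2 - b X - a. One of t = 0, 1, -1, 2
      works.\<close>
    have "\<exists>t. t ^ 3 + c * t ^ 2 - b * t + a \<noteq> 0"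
    proof (rule ccontr)
      assume "\<not> ?thesis"
      then have h: "t ^ 3 + c * t ^ 2 - b * t + a = 0" for t by blast
      have "a = 0" using h[of 0] by simp
      have "2 * c + 2 * a = (1 ^ 3 + c * 1 ^ 2 - b * 1 + a) + ((-1) ^ 3 + c * (-1) ^ 2 - b * (-1) + a)" by simp
      also have "\<dots> = 0" by (subst (1 2) h) simp_all
      finally have "2 * c = 0" using \<open>a = 0\<close> by simp
      then have "c = 0" by simp
      then have "b = 1" using h[of 1] \<open>a = 0\<close> by simp
      then show False using h[of 2] \<open>a = 0\<close> \<open>c = 0\<close> by simp
    qed
    then obtain t where t: "t ^ 3 + c * t ^ 2 - b * t + a \<noteq> 0" by blast
    let ?X = "x + t *s e"
    have XX: "alg_mult \<mu> ?X ?X = (t ^ 2) *s e + (2 * t) *s x + ?y"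
      by (simp add: alg_mult_bilinear unit vec_eq_iff power2_eq_square algebra_simps)
    have XXX: "alg_mult \<mu> (alg_mult \<mu> ?X ?X) ?X = (a + t ^ 3) *s e + (b + 3 * t ^ 2) *s x + (c + 3 * t) *s ?y"
      unfolding XX by (simp add: alg_mult_bilinear unit abc vec_eq_iff power2_eq_square power3_eq_cube algebra_simps)
    have "invertible (frame ?X (alg_mult \<mu> ?X ?X) (alg_mult \<mu> (alg_mult \<mu> ?X ?X) ?X))"
    proof (rule invertible_frame)
      fix p q r
      assume "p *s ?X + q *s alg_mult \<mu> ?X ?X + r *s alg_mult \<mu> (alg_mult \<mu> ?X ?X) ?X = 0"
      then have "(p * t + q * t ^ 2 + r * (a + t ^ 3)) *s e + (p + q * (2 * t) + r * (b + 3 * t ^ 2)) *s x +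
          (q + r * (c + 3 * t)) *s ?y = 0"
        unfolding XXX unfolding XX by (simp add: vec_eq_iff algebra_simps)
      then have s: "p * t + q * t ^ 2 + r * (a + t ^ 3) = 0" "p + q * (2 * t) + r * (b + 3 * t ^ 2) = 0"
          "q + r * (c + 3 * t) = 0"
        using frame_zero[OF I] by blast+
      have q: "q = - r * (c + 3 * t)" using s(3) by (simp add: eq_neg_iff_add_eq_0)
      have p: "p = - q * (2 * t) - r * (b + 3 * t ^ 2)" using s(2) by algebra
      have "r * (t ^ 3 + c * t ^ 2 - b * t + a) = 0" using s(1) unfolding p q by algebra
      then have "r = 0" using t by simp
      then show "p = 0 \<and> q = 0 \<and> r = 0" using p q by simp
    qed
    then show False using classified_monogenic[OF RA] nc by blast
  qed
  have quadratic: "\<exists>a b. alg_mult \<mu> x x = a *s e + b *s x"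
    if x: "\<And>a b. a *s e + b *s x = 0 \<Longrightarrow> b = 0" for x
  proof -
    obtain a b c where abc: "a *s e + b *s x + c *s alg_mult \<mu> x x = 0" "a \<noteq> 0 \<or> b \<noteq> 0 \<or> c \<noteq> 0"
      by (rule not_invertible_frame[OF not_inv])
    have "c \<noteq> 0"
    proof
      assume "c = 0"
      then have "b = 0" using x abc(1) by simp
      then show False using abc \<open>c = 0\<close> e0 by simp
    qed
    then have "alg_mult \<mu> x x = (- a / c) *s e + (- b / c) *s x"
      using abc(1) by (simp add: vec_eq_iff field_simps eq_neg_iff_add_eq_0)
    then show ?thesis by blast
  qed
  have no_root: "d = 0" if x: "\<And>a b. a *s e + b *s x = 0 \<Longrightarrow> b = 0" and d: "alg_mult \<mu> x x = d *s e" for x d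
  proof (rule ccontr)
    assume "d \<noteq> 0"
    define s where "s = csqrt d"
    have s: "s * s = d" "s \<noteq> 0" using \<open>d \<noteq> 0\<close> unfolding s_def by (simp_all flip: power2_eq_square)
    \<comment> \<open>x / s squares to the unit, so f is the idempotent attached to its eigenvalue
      1.\<close>
    define f where "f = (1 / 2) *s e + (1 / (2 * s)) *s x"
    have "alg_mult \<mu> f f = f"
      unfolding f_def using s by (simp add: alg_mult_bilinear unit d vec_eq_iff field_simps) (simp flip: s(1))?
    have "f \<noteq> 0" using x[of "1 / 2" "1 / (2 * s)"] s(2) unfolding f_def by auto
    show False
    proof (rule idempotent_trichotomy[OF RA \<open>alg_mult \<mu> f f = f\<close> \<open>f \<noteq> 0\<close>])
      assume "classified \<mu>" then show False using nc by blast
    next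
      fix u' v' assume "invertible (frame f u' v')" "peirce0 \<mu> f u'" "peirce0 \<mu> f v'"
      then show False using classified_peirce0_complement[OF RA \<open>alg_mult \<mu> f f = f\<close>] nc by blast
    next
      fix u' v' assume "invertible (frame f u' v')" "peirce2 \<mu> f u'" "peirce2 \<mu> f v'"
      then have "alg_mult \<mu> e f = e" using peirce_span_mult(2)[OF _ \<open>alg_mult \<mu> f f = f\<close>] by blast
      then have "(- 1 / 2) *s e + (1 / (2 * s)) *s x = 0" unfolding unit f_def by (simp add: vec_eq_iff field_simps)
      then show False using x s(2) by fastforce
    qed
  qed
  obtain a1 a2 where a: "alg_mult \<mu> u u = a1 *s e + a2 *s u"
    using quadratic[of u] frame_zero[OF inv, where c = 0] by auto
  have v0: "b = 0" if "a *s e + b *s v = 0" for a b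
    using frame_zero[OF inv, of a 0 b] that by auto
  obtain b1 b2 where b: "alg_mult \<mu> v v = b1 *s e + b2 *s v"
    using quadratic[of v] v0 by blast
  define x where "x = u - (a2 / 2) *s e"
  define y where "y = v - (b2 / 2) *s e"
  have I: "invertible (frame e x y)"
  proof (rule invertible_frame)
    fix k m n assume "k *s e + m *s x + n *s y = 0"
    then have "(k - m * a2 / 2 - n * b2 / 2) *s e + m *s u + n *s v = 0"
      unfolding x_def y_def by (simp add: vec_eq_iff algebra_simps)
    then have "k - m * a2 / 2 - n * b2 / 2 = 0" "m = 0" "n = 0" using frame_zero[OF inv] by blast+
    then show "k = 0 \<and> m = 0 \<and> n = 0" by simp
  qed
  have lin: "m = 0 \<and> n = 0" if "k *s e + m *s x + n *s y = 0" for k m n using frame_zero[OF I that] by blast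
  have xx: "alg_mult \<mu> x x = (a1 + a2 ^ 2 / 4) *s e"
    unfolding x_def by (simp add: alg_mult_bilinear unit a vec_eq_iff power2_eq_square algebra_simps)
  have yy: "alg_mult \<mu> y y = (b1 + b2 ^ 2 / 4) *s e"
    unfolding y_def by (simp add: alg_mult_bilinear unit b vec_eq_iff power2_eq_square algebra_simps)
  have "b = 0" if "a *s e + b *s x = 0" for a b using lin[of a b 0] that by simp
  then have "a1 + a2 ^ 2 / 4 = 0" using no_root[OF _ xx] by blast
  then have xx0: "alg_mult \<mu> x x = 0" using xx by simp
  have "b = 0" if "a *s e + b *s y = 0" for a b using lin[of a 0 b] that by simp
  then have "b1 + b2 ^ 2 / 4 = 0" using no_root[OF _ yy] by blast
  then have yy0: "alg_mult \<mu> y y = 0" using yy by simp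
  define w where "w = alg_mult \<mu> x y + alg_mult \<mu> y x"
  have plus: "b = 0" if "a *s e + b *s (x + y) = 0" for a b
    using lin[of a b b] that by (simp add: vector_add_ldistrib add.assoc)
  obtain p q where pq: "alg_mult \<mu> (x + y) (x + y) = p *s e + q *s (x + y)"
    using quadratic[of "x + y"] plus by blast
  have "b = 0" if "a *s e + b *s (x - y) = 0" for a b
    using lin[of a b "- b"] that by (simp add: vec_eq_iff algebra_simps)
  then obtain p' q' where pq': "alg_mult \<mu> (x - y) (x - y) = p' *s e + q' *s (x - y)"
    using quadratic[of "x - y"] by blast
  \<comment> \<open>The squares of x + y and x - y both express w. Comparing coefficients of x and y
    gives q = 0, so (x + y)^2 is a scalar and \<open>no_root\<close> applies.\<close>
  have w1: "w = p *s e + q *s (x + y)" using pq by (simp add: w_def alg_mult_bilinear xx0 yy0 add.commute)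
  have "- w = p' *s e + q' *s (x - y)" using pq' by (simp add: w_def alg_mult_bilinear xx0 yy0 algebra_simps)
  then have "(p + p') *s e + (q + q') *s x + (q - q') *s y = 0"
    using w1 by (simp add: vec_eq_iff algebra_simps)
  then have "q + q' = 0" "q - q' = 0" using lin by blast+
  then have "q = 0" by simp
  then have "alg_mult \<mu> (x + y) (x + y) = p *s e" using pq by simp
  then have "p = 0" using no_root[of "x + y" p] plus by blast
  then have s: "alg_mult \<mu> y x = - alg_mult \<mu> x y"
    using w1 \<open>q = 0\<close> unfolding w_def by (simp add: eq_neg_iff_add_eq_0 add.commute)
  obtain a b c where abc: "alg_mult \<mu> x y = a *s e + b *s x + c *s y" by (rule frame_coords[OF I])
  note fs = idem unit xx0 yy0 s abc vec_eq_iff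
  have "classified \<mu>"
    by (rule classified_by_frame[OF I
        classified_unital_null[where x = a and y = b and z = c,
          OF right_alternative_change_basis[OF RA I]]])
      (rule change_basis_product[OF I], simp add: fs)+
  then show False using nc by blast
qed

lemma classified_idempotent:
  assumes "right_alternative \<mu>" "alg_mult \<mu> e e = e" "e \<noteq> 0" shows "classified \<mu>"
  using idempotent_trichotomy[OF assms] classified_peirce0_complement[OF assms(1,2)]
    classified_unital[OF assms(1,2)] by metis

text \<open>If x^3 is nonzero and x does not generate the whole algebra, it generates a proper
  subalgebra that is not nilpotent, and this contains an idempotent.\<close>

lemma nil_or_classified:
  assumes RA: "right_alternative \<mu>" and nc: "\<not> classified \<mu>"
  shows "alg_mult \<mu> (alg_mult \<mu> x x) x = 0"
proof (rule ccontr)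
  let ?y = "alg_mult \<mu> x x" let ?z = "alg_mult \<mu> ?y x"
  assume z0: "?z \<noteq> 0"
  have no_idem: "f = 0" if "alg_mult \<mu> f f = f" for f using classified_idempotent[OF RA that] nc by blast
  have xy: "alg_mult \<mu> x ?y = ?z" using right_alternative_square[OF RA, of x x] by simp
  have yy: "alg_mult \<mu> ?y ?y = alg_mult \<mu> ?z x" using right_alternative_square[OF RA, of ?y x] by simp
  have no_multiple: "?y \<noteq> l *s x" for l
  proof
    assume l: "?y = l *s x"
    then have "?z = l *s ?y" by (simp add: alg_mult_bilinear)
    then have l0: "l \<noteq> 0" using z0 by auto
    have "(1 / l) *s x = 0"
      by (rule no_idem) (use l l0 in \<open>simp add: alg_mult_bilinear vector_smult_assoc\<close>)
    then show False using l0 z0 by simp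
  qed
  have "\<not> invertible (frame x ?y ?z)" using classified_monogenic[OF RA] nc by blast
  then obtain a b c where abc: "a *s x + b *s ?y + c *s ?z = 0" "a \<noteq> 0 \<or> b \<noteq> 0 \<or> c \<noteq> 0"
    by (rule not_invertible_frame)
  have "c \<noteq> 0"
  proof
    assume c: "c = 0"
    show False
    proof (cases "b = 0")
      case True
      then have "x = 0" using abc c by auto
      then show False using z0 by simp
    next
      case False
      then have "?y = (- a / b) *s x" using abc(1) c by (simp add: vec_eq_iff field_simps eq_neg_iff_add_eq_0)
      then show False using no_multiple by blast
    qed
  qed
  define p q where "p = - a / c" and "q = - b / c"
  have z: "?z = p *s x + q *s ?y"
    using abc(1) \<open>c \<noteq> 0\<close> by (simp add: p_def q_def vec_eq_iff field_simps eq_neg_iff_add_eq_0)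
  have zx: "alg_mult \<mu> ?z x = p *s ?y + q *s (p *s x + q *s ?y)"
    by (subst z, simp add: alg_mult_bilinear, subst z, simp)
  show False
  proof (cases "p = 0")
    case False
    \<comment> \<open>From x^3 = p x + q x^2 follows f x = x: f is the unit of the subalgebra
      generated by x.\<close>
    define f where "f = (1 / p) *s (?y - q *s x)"
    have "alg_mult \<mu> f f = (1 / p ^ 2) *s (alg_mult \<mu> ?y ?y - (2 * q) *s ?z + q ^ 2 *s ?y)"
      unfolding f_def by (simp add: alg_mult_bilinear xy vec_eq_iff power2_eq_square field_simps)
    also have "\<dots> = f"
      unfolding f_def yy unfolding zx unfolding z using False by (simp add: vec_eq_iff power2_eq_square field_simps)
    finally have "f = 0" by (rule no_idem)
    then have "?y - q *s x = 0" using False unfolding f_def vector_mul_eq_0 by simp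
    then have "?y = q *s x" by simp
    then show False using no_multiple by blast
  next
    case True
    then have q: "q \<noteq> 0" using z z0 by auto
    \<comment> \<open>Here x^3 = q x^2, hence x^4 = q^2 x^2, and x^2 / q^2 is idempotent.\<close>
    have "(1 / q ^ 2) *s ?y = 0"
      by (rule no_idem) (use q in \<open>simp add: alg_mult_bilinear yy zx True vec_eq_iff power2_eq_square\<close>)
    then have "?y = 0" using q by simp
    then show False using z0 by simp
  qed
qed

theorem right_alternative_classified:
  assumes RA: "right_alternative \<mu>" shows "classified \<mu>"
proof (rule ccontr)
  assume nc: "\<not> classified \<mu>"
  have cube: "alg_mult \<mu> (alg_mult \<mu> x x) x = 0" for x by (rule nil_or_classified[OF RA nc])
  show False
  proof (cases "\<forall>x. alg_mult \<mu> x x = 0")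
    case False
    then obtain x where x: "alg_mult \<mu> x x \<noteq> 0" by blast
    let ?y = "alg_mult \<mu> x x"
    have ind: "a = 0 \<and> b = 0" if "a *s x + b *s ?y = 0" for a b
    proof -
      have "alg_mult \<mu> (a *s x + b *s ?y) x = a *s ?y" by (simp add: alg_mult_bilinear cube)
      then have "a = 0" using that x by simp
      then show ?thesis using that x by simp
    qed
    have "vec.dim (vec.span {x, ?y}) \<le> card {x, ?y}" by (simp add: vec.dim_le_card')
    also have "\<dots> < 3" by (simp add: card_insert_if)
    also have "3 = vec.dim (UNIV :: (complex ^ 3) set)" by (simp add: card_cart_basis)
    finally have "vec.span {x, ?y} \<noteq> UNIV" by force
    then obtain d where d: "d \<notin> vec.span {x, ?y}" by blast
    have I: "invertible (frame x d ?y)"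
    proof (rule invertible_frame)
      fix a b c assume z: "a *s x + b *s d + c *s ?y = 0"
      have "b = 0"
      proof (rule ccontr)
        assume "b \<noteq> 0"
        then have "d = (- a / b) *s x + (- c / b) *s ?y"
          using z by (simp add: vec_eq_iff field_simps eq_neg_iff_add_eq_0)
        also have "\<dots> \<in> vec.span {x, ?y}"
          by (intro vec.span_add vec.span_scale vec.span_base) auto
        finally show False using d by blast
      qed
      then show "a = 0 \<and> b = 0 \<and> c = 0" using ind[of a c] z by simp
    qed
    let ?\<nu> = "GL_action (matrix_inv (frame x d ?y)) \<mu>"
    have xy: "alg_mult \<mu> x ?y = 0" using right_alternative_square[OF RA, of x x] cube by simp
    \<comment> \<open>The cube of \<open>d\<close> vanishes too; its coordinate along
      \<open>d\<close> is the assumption \<open>nil\<close> of the table lemma.\<close>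
    have "frame x d ?y *v alg_mult ?\<nu> (alg_mult ?\<nu> (axis 2 1) (axis 2 1)) (axis 2 1) = 0"
      unfolding change_basis(1)[OF I, symmetric] by (rule cube)
    then have "alg_mult ?\<nu> (alg_mult ?\<nu> (axis 2 1) (axis 2 1)) (axis 2 1) $ 2 = 0"
      using GL_vector_0_iff[OF I] by simp
    then have nil: "?\<nu> $ (2,2,1) * ?\<nu> $ (1,2,2) + ?\<nu> $ (2,2,2) * ?\<nu> $ (2,2,2) + ?\<nu> $ (2,2,3) * ?\<nu> $ (3,2,2) = 0"
      unfolding alg_mult_axis_right_nth alg_mult_axis_nth vec_lambda_beta sum_3 .
    have "classified \<mu>"
      by (rule classified_by_frame[OF I classified_nil_coords[OF right_alternative_change_basis[OF RA I] _ _ _ nil]])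
        (rule change_basis_product[OF I], simp add: xy cube)+
    then show False using nc by blast
  next
    case True
    then have sq: "alg_mult \<mu> x x = 0" for x by blast
    have anti: "alg_mult \<mu> y x = - alg_mult \<mu> x y" for x y
      using sq[of "x + y"] by (simp add: alg_mult_bilinear sq eq_neg_iff_add_eq_0)
    show False
    proof (cases "\<forall>x y. alg_mult \<mu> x y = 0")
      case True
      then have "\<mu> $ (i, j, k) = 0" for i j k using alg_mult_axis[of \<mu> i j k] by simp
      then have "\<mu> = structure_table (family_R09 0 0 0 0 0)"
        by (simp add: structure_constants_eq_iff forall_3 family_R09_def)
      then show False using nc classified_family_R09 by metis
    next
      case False
      then obtain x y where xy: "alg_mult \<mu> x y \<noteq> 0" by blast
      let ?z = "alg_mult \<mu> x y"
      have zy: "alg_mult \<mu> ?z y = 0" using right_alternative_square[OF RA, of x y] by (simp add: sq)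
      have "alg_mult \<mu> (alg_mult \<mu> y x) x = 0" using right_alternative_square[OF RA, of y x] by (simp add: sq)
      then have zx: "alg_mult \<mu> ?z x = 0" unfolding anti[of y x] by (simp add: alg_mult_uminus)
      have I: "invertible (frame x y ?z)"
      proof (rule invertible_frame)
        fix a b c assume z: "a *s x + b *s y + c *s ?z = 0"
        \<comment> \<open>Right multiplication by y annihilates y and x y, and right multiplication
          by x annihilates x and x y; this isolates \<open>a\<close> and then
          \<open>b\<close>.\<close>
        have "alg_mult \<mu> (a *s x + b *s y + c *s ?z) y = a *s ?z" by (simp add: alg_mult_bilinear sq zy)
        then have a: "a = 0" using z xy by simp
        have "alg_mult \<mu> (a *s x + b *s y + c *s ?z) x = b *s alg_mult \<mu> y x"
          by (simp add: alg_mult_bilinear sq zx)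
        then have b: "b = 0" using z xy anti[of y x] by simp
        show "a = 0 \<and> b = 0 \<and> c = 0" using a b z xy by simp
      qed
      obtain p q r where pqr: "alg_mult \<mu> x ?z = p *s x + q *s y + r *s ?z" by (rule frame_coords[OF I])
      obtain s t w where stw: "alg_mult \<mu> y ?z = s *s x + t *s y + w *s ?z" by (rule frame_coords[OF I])
      have "classified \<mu>"
        by (rule classified_by_frame[OF I
            classified_alternating_coords[where x = p and y = q and z = r and s = s and t = t and w = w,
              OF right_alternative_change_basis[OF RA I]]])
          (rule change_basis_product[OF I], simp add: sq anti[of y x] anti[of ?z x] anti[of ?z y] pqr stw)+
      then show False using nc by blast
    qed
  qed
qed

section \<open>Components and rigid algebras\<close>

abbreviation component_closure :: "component \<Rightarrow> structure_constants set" where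
  "component_closure c \<equiv> zariski closure_of orbit (component_algebra c)"

lemma orbit_invariant:
  assumes "\<And>g. invertible g \<Longrightarrow> P (GL_action g \<mu>) \<longleftrightarrow> P \<mu>" "\<nu> \<in> orbit \<mu>" shows "P \<nu> \<longleftrightarrow> P \<mu>"
  using assms unfolding orbit_def by auto

lemma component_closure_right_alternative: "component_closure c \<subseteq> {\<mu>. right_alternative \<mu>}"
proof (rule closure_of_minimal[OF _ closedin_right_alternative])
  show "orbit (component_algebra c) \<subseteq> {\<mu>. right_alternative \<mu>}"
    using orbit_invariant[of right_alternative, OF right_alternative_GL_action]
      right_alternative_component_algebra by blast
qed

lemma orbit_subset_component_closure: "orbit (component_algebra c) \<subseteq> component_closure c"
  by (simp add: closure_of_subset)

text \<open>The separating condition of \<open>c'\<close> is closed and invariant, so it persists on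
  the whole closure, while among the nine algebras it holds only at its own.\<close>

lemma component_closure_separated:
  assumes "\<mu> \<in> orbit (component_algebra c)" "\<mu> \<in> component_closure c'" shows "c = c'"
proof -
  have "component_closure c' \<subseteq> {\<mu>. separating_condition c' \<mu>}"
  proof (rule closure_of_minimal[OF _ closedin_separating_condition])
    show "orbit (component_algebra c') \<subseteq> {\<mu>. separating_condition c' \<mu>}"
      using orbit_invariant[of "separating_condition c'", OF separating_condition_GL_action]
        separating_condition_iff by blast
  qed
  then have "separating_condition c' \<mu>" using assms(2) by blast
  then have "separating_condition c' (component_algebra c)"
    using orbit_invariant[of "separating_condition c'", OF separating_condition_GL_action assms(1)] by blast
  then show ?thesis using separating_condition_iff by auto
qed

lemma inj_component_closure: "inj component_closure"
  using component_closure_separated orbit_refl orbit_subset_component_closure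
  by (metis (no_types, lifting) injI subsetD)

lemma right_alternative_iff_component_closure:
  "right_alternative \<mu> \<longleftrightarrow> (\<exists>c. \<mu> \<in> component_closure c)"
  using right_alternative_classified component_closure_right_alternative unfolding classified_def by blast

lemma irreducible_subset_variety:
  "irreducible_subset right_alternative_variety S \<longleftrightarrow>
     irreducible_subset zariski S \<and> S \<subseteq> {\<mu>. right_alternative \<mu>}"
proof -
  have "subtopology right_alternative_variety S = subtopology zariski S" if "S \<subseteq> {\<mu>. right_alternative \<mu>}"
    using that unfolding right_alternative_variety_def subtopology_subtopology by (simp add: Int_absorb1)
  then show ?thesis unfolding irreducible_subset_def right_alternative_variety_def by auto
qed

lemma irreducible_subset_finite_union:
  assumes "irreducible_subset zariski S" "finite F" "\<And>T. T \<in> F \<Longrightarrow> algebraic_set T" "S \<subseteq> \<Union>F"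
  shows "\<exists>T\<in>F. S \<subseteq> T"
  using assms(2-4)
proof (induction F)
  case empty
  then show ?case using assms(1) by (auto simp: irreducible_subset_zariski_iff)
next
  case (insert T F)
  have "algebraic_set (\<Union>F)"
    using insert.prems(1) insert.hyps(1) closedin_Union[of F zariski] by (simp add: closedin_zariski)
  then have "S \<subseteq> T \<or> S \<subseteq> \<Union>F"
    using assms(1) insert.prems unfolding irreducible_subset_zariski_iff by simp
  then show ?case using insert.IH insert.prems by auto
qed

lemma irreducible_subset_component:
  assumes "irreducible_subset right_alternative_variety D"
  obtains c where "D \<subseteq> component_closure c"
proof -
  have "finite (UNIV :: component set)" unfolding UNIV_component by simp
  then have "finite (range component_closure)" by simp
  moreover have "D \<subseteq> \<Union>(range component_closure)"
    using assms right_alternative_iff_component_closure unfolding irreducible_subset_variety by blast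
  moreover have "algebraic_set T" if "T \<in> range component_closure" for T
    using that by (auto simp flip: closedin_zariski)
  moreover have "irreducible_subset zariski D" using assms unfolding irreducible_subset_variety by blast
  ultimately have "\<exists>T\<in>range component_closure. D \<subseteq> T"
    using irreducible_subset_finite_union[of D "range component_closure"] by blast
  then show ?thesis using that by blast
qed

lemma irreducible_component_closure:
  "irreducible_subset right_alternative_variety (component_closure c)"
  using irreducible_orbit_closure component_closure_right_alternative
  unfolding irreducible_subset_variety by blast

lemma component_closure_subset: "component_closure c \<subseteq> component_closure c' \<Longrightarrow> c = c'"
  using component_closure_separated[OF orbit_refl] orbit_refl orbit_subset_component_closure by blast

lemma irreducible_components_variety:
  "irreducible_components right_alternative_variety = range component_closure"
proof (intro equalityI subsetI)
  fix D assume "D \<in> irreducible_components right_alternative_variety"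
  then have D: "irreducible_subset right_alternative_variety D"
    "\<And>E. irreducible_subset right_alternative_variety E \<Longrightarrow> D \<subseteq> E \<Longrightarrow> E = D"
    unfolding irreducible_components_def by blast+
  obtain c where "D \<subseteq> component_closure c" using irreducible_subset_component[OF D(1)] .
  then show "D \<in> range component_closure" using D(2)[OF irreducible_component_closure] by blast
next
  fix D assume "D \<in> range component_closure"
  then obtain c where c: "D = component_closure c" by blast
  have "E = D" if E: "irreducible_subset right_alternative_variety E" "D \<subseteq> E" for E
  proof -
    obtain c' where c': "E \<subseteq> component_closure c'" using irreducible_subset_component[OF E(1)] .
    then have "c = c'" using component_closure_subset E(2) c by blast
    then show ?thesis using c c' E(2) by blast
  qed
  then show "D \<in> irreducible_components right_alternative_variety"
    unfolding irreducible_components_def using c irreducible_component_closure by blast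
qed

text \<open>In the variety the complement of the orbit consists of the other eight closures and the
  boundary locus. A point outside these can be classified only by \<open>c\<close>, and, not being
  on the boundary, it lies in the orbit.\<close>

lemma openin_component_orbit: "openin right_alternative_variety (orbit (component_algebra c))"
proof -
  let ?C = "(\<Union>c'\<in>UNIV - {c}. component_closure c') \<union> {\<mu>. boundary_condition c \<mu>}"
  have "finite (UNIV - {c})" unfolding UNIV_component by simp
  then have "closedin zariski (\<Union>c'\<in>UNIV - {c}. component_closure c')"
    by (intro closedin_Union) auto
  then have "closedin zariski ?C" by (intro closedin_Un closedin_boundary_condition)
  then have "openin zariski (- ?C)" by (simp add: closedin_def Compl_eq_Diff_UNIV)
  moreover have "orbit (component_algebra c) = - ?C \<inter> {\<mu>. right_alternative \<mu>}"
  proof (intro equalityI subsetI)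
    fix \<mu> assume \<mu>: "\<mu> \<in> orbit (component_algebra c)"
    have "\<not> boundary_condition c \<mu>"
      using orbit_invariant[of "boundary_condition c", OF boundary_condition_GL_action \<mu>]
        not_boundary_condition_component by blast
    moreover have "right_alternative \<mu>"
      using \<mu> orbit_subset_component_closure component_closure_right_alternative by blast
    ultimately show "\<mu> \<in> - ?C \<inter> {\<mu>. right_alternative \<mu>}"
      using component_closure_separated[OF \<mu>] by blast
  next
    fix \<mu> assume \<mu>: "\<mu> \<in> - ?C \<inter> {\<mu>. right_alternative \<mu>}"
    then have "classified \<mu>" using right_alternative_classified by blast
    then obtain c' where c': "\<mu> \<in> component_closure c'"
      "\<mu> \<in> orbit (component_algebra c') \<or> boundary_condition c' \<mu>" unfolding classified_def by blast
    then have "c' = c" using \<mu> by blast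
    then show "\<mu> \<in> orbit (component_algebra c)" using c'(2) \<mu> by blast
  qed
  ultimately show ?thesis unfolding right_alternative_variety_def openin_subtopology by blast
qed

text \<open>An open orbit meets every orbit whose closure contains one of its points, and orbits
  that meet are equal.\<close>

lemma rigid_iff: "rigid \<mu> \<longleftrightarrow> (\<exists>c. \<mu> \<in> orbit (component_algebra c))"
proof
  assume r: "rigid \<mu>"
  then obtain c where c: "\<mu> \<in> component_closure c"
    unfolding rigid_def right_alternative_iff_component_closure by blast
  obtain T where T: "openin zariski T" "orbit \<mu> = T \<inter> {\<mu>. right_alternative \<mu>}"
    using r unfolding rigid_def right_alternative_variety_def openin_subtopology by blast
  have "\<mu> \<in> T" using T(2) orbit_refl by blast
  then obtain \<nu> where \<nu>: "\<nu> \<in> orbit (component_algebra c)" "\<nu> \<in> T"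
    using c T(1) unfolding in_closure_of by blast
  then have "\<nu> \<in> orbit \<mu>"
    using T(2) orbit_subset_component_closure component_closure_right_alternative by blast
  then show "\<exists>c. \<mu> \<in> orbit (component_algebra c)" using \<nu>(1) orbit_sym orbit_trans by blast
next
  assume "\<exists>c. \<mu> \<in> orbit (component_algebra c)"
  then obtain c where c: "\<mu> \<in> orbit (component_algebra c)" by blast
  then have "right_alternative \<mu>"
    using orbit_subset_component_closure component_closure_right_alternative by blast
  then show "rigid \<mu>" unfolding rigid_def orbit_eq[OF c] using openin_component_orbit by blast
qed

text \<open>The class of an algebra under isomorphism is its full orbit, and an orbit containing a
  rigid algebra is one of the nine.\<close>

lemma rigid_classes:
  "{\<mu>. rigid \<mu>} // {(\<mu>, \<nu>). alg_iso \<mu> \<nu>} = range (\<lambda>c. orbit (component_algebra c))"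
proof -
  have "{(\<mu>, \<nu>). alg_iso \<mu> \<nu>} `` {\<mu>} = orbit \<mu>" for \<mu> by (auto simp: alg_iso_iff_orbit)
  then have "{\<mu>. rigid \<mu>} // {(\<mu>, \<nu>). alg_iso \<mu> \<nu>} = orbit ` {\<mu>. rigid \<mu>}"
    unfolding quotient_def by auto
  also have "\<dots> = range (\<lambda>c. orbit (component_algebra c))"
  proof (intro equalityI subsetI)
    fix O' assume "O' \<in> orbit ` {\<mu>. rigid \<mu>}"
    then obtain \<mu> c where "O' = orbit \<mu>" "\<mu> \<in> orbit (component_algebra c)" using rigid_iff by auto
    then show "O' \<in> range (\<lambda>c. orbit (component_algebra c))" using orbit_eq by blast
  next
    fix O' assume "O' \<in> range (\<lambda>c. orbit (component_algebra c))"
    then show "O' \<in> orbit ` {\<mu>. rigid \<mu>}" using rigid_iff orbit_refl by blast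
  qed
  finally show ?thesis .
qed

lemma inj_component_orbit: "inj (\<lambda>c. orbit (component_algebra c))"
  using component_closure_separated orbit_refl orbit_subset_component_closure
  by (metis (no_types, lifting) injI subsetD)

lemma card_component: "card (UNIV :: component set) = 9"
  unfolding UNIV_component by simp

section \<open>Dimension\<close>

text \<open>The head of the list is the exponent of the last function. Removing it passes to the
  preceding functions, as the induction along a chain requires.\<close>

fun monomial :: "(nat \<Rightarrow> 'a \<Rightarrow> complex) \<Rightarrow> nat list \<Rightarrow> 'a \<Rightarrow> complex" where
  "monomial f [] x = 1"
| "monomial f (k # ks) x = f (length ks) x ^ k * monomial f ks x"

text \<open>Each exponent is bounded separately, not the total degree: the number of monomials is
  then exactly a power, and multiplication adds the bounds.\<close>

definition exponents :: "nat \<Rightarrow> nat \<Rightarrow> nat list set" where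
  "exponents n d = {ks. length ks = n \<and> set ks \<subseteq> {..d}}"

lemma finite_exponents: "finite (exponents n d)"
  unfolding exponents_def using finite_lists_length_eq[of "{..d}" n] by (simp add: conj_commute)

lemma card_exponents: "card (exponents n d) = (d + 1) ^ n"
  unfolding exponents_def using card_lists_length_eq[of "{..d}" n] by (simp add: conj_commute)

lemma exponents_0: "exponents 0 d = {[]}"
  by (auto simp: exponents_def)

lemma sum_exponents_Suc:
  "(\<Sum>ks\<in>exponents (Suc n) d. F ks) = (\<Sum>k\<le>d. \<Sum>ks\<in>exponents n d. F (k # ks))"
proof -
  have "exponents (Suc n) d = (\<lambda>(k, ks). k # ks) ` ({..d} \<times> exponents n d)"
    by (auto simp: exponents_def length_Suc_conv image_iff)
  moreover have "inj_on (\<lambda>(k, ks). k # ks) ({..d} \<times> exponents n d)" by (auto intro: inj_onI)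
  ultimately have "(\<Sum>ks\<in>exponents (Suc n) d. F ks) = (\<Sum>(k, ks)\<in>{..d} \<times> exponents n d. F (k # ks))"
    by (simp add: sum.reindex case_prod_beta' comp_def)
  then show ?thesis by (simp add: sum.cartesian_product)
qed

lemma monomial_polynomial:
  assumes "\<And>i. i < n \<Longrightarrow> f i \<in> function_algebra G" "length ks \<le> n"
  shows "monomial f ks \<in> function_algebra G"
  using assms(2)
proof (induction ks)
  case Nil
  then show ?case by (simp add: function_algebra.const[of 1])
next
  case (Cons k ks)
  have "(\<lambda>x. f (length ks) x ^ k * monomial f ks x) \<in> function_algebra G"
    using Cons assms(1)[of "length ks"] by (intro function_algebra.mult function_algebra_power) auto
  then show ?case by simp
qed

lemma irreducible_subset_product:
  assumes "irreducible_subset zariski S" "complex_polynomial_fun p" "complex_polynomial_fun q"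
    and "\<And>x. x \<in> S \<Longrightarrow> p x * q x = 0"
  shows "(\<forall>x\<in>S. p x = 0) \<or> (\<forall>x\<in>S. q x = 0)"
proof -
  have "algebraic_set (zero_locus {p})" "algebraic_set (zero_locus {q})"
    unfolding algebraic_set_def using assms(2,3) by blast+
  moreover have "S \<subseteq> zero_locus {p} \<union> zero_locus {q}" using assms(4) by (auto simp: zero_locus_def)
  ultimately have "S \<subseteq> zero_locus {p} \<or> S \<subseteq> zero_locus {q}"
    using assms(1) unfolding irreducible_subset_zariski_iff by blast
  then show ?thesis by (auto simp: zero_locus_def)
qed

text \<open>On \<open>Z (m + 1)\<close> a relation may be divided by the largest power of \<open>f m\<close> that it contains;
  restricted to \<open>Z m\<close>, where \<open>f m = 0\<close>, it is a relation between the preceding polynomials.\<close>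

lemma chain_algebraically_independent:
  fixes Z :: "nat \<Rightarrow> (complex ^ 'n) set"
  assumes irr: "\<And>i. i \<le> n \<Longrightarrow> irreducible_subset zariski (Z i)"
    and sub: "\<And>i. i < n \<Longrightarrow> Z i \<subseteq> Z (Suc i)"
    and poly: "\<And>i. i < n \<Longrightarrow> complex_polynomial_fun (f i)"
    and zero: "\<And>i x. i < n \<Longrightarrow> x \<in> Z i \<Longrightarrow> f i x = 0"
    and nonzero: "\<And>i. i < n \<Longrightarrow> \<exists>x\<in>Z (Suc i). f i x \<noteq> 0"
  shows "m \<le> n \<Longrightarrow> (\<And>x. x \<in> Z m \<Longrightarrow> (\<Sum>ks\<in>exponents m d. c ks * monomial f ks x) = 0) \<Longrightarrow>
    ks \<in> exponents m d \<Longrightarrow> c ks = 0"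
proof (induction m arbitrary: c ks)
  case 0
  have "Z 0 \<noteq> {}" using irr[of 0] by (auto simp: irreducible_subset_zariski_iff)
  then show ?case using 0 by (auto simp: exponents_0)
next
  case (Suc m)
  define G where "G k x = (\<Sum>ks\<in>exponents m d. c (k # ks) * monomial f ks x)" for k x
  have G: "G k \<in> function_algebra (range (\<lambda>i x. x $ i))" for k
    unfolding G_def using Suc.prems(1) poly complex_polynomial_fun_iff
    by (intro function_algebra_sum function_algebra.mult function_algebra.const monomial_polynomial[of n])
      (auto simp: exponents_def)
  have sum: "(\<Sum>k\<le>d. f m x ^ k * G k x) = 0" if "x \<in> Z (Suc m)" for x
  proof -
    have "(\<Sum>k\<le>d. f m x ^ k * G k x) =
        (\<Sum>k\<le>d. \<Sum>ks\<in>exponents m d. c (k # ks) * monomial f (k # ks) x)"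
      unfolding G_def sum_distrib_left by (intro sum.cong refl) (simp add: exponents_def mult_ac)
    then show ?thesis using Suc.prems(2)[OF that] unfolding sum_exponents_Suc by simp
  qed
  have fm: "f m \<in> function_algebra (range (\<lambda>i x. x $ i))"
    using poly[of m] Suc.prems(1) complex_polynomial_fun_iff by auto
  have "\<forall>ks\<in>exponents m d. c (k # ks) = 0" if "k \<le> d" for k
    using that
  proof (induction k rule: less_induct)
    case (less k)
    define H where "H x = (\<Sum>j\<in>{k<..d}. f m x ^ (j - k - 1) * G j x)" for x
    have "f m x ^ k * (G k x + f m x * H x) = 0" if x: "x \<in> Z (Suc m)" for x
    proof -
      have low: "G j x = 0" if "j < k" for j
        unfolding G_def using less.IH[OF that] less.prems that by (intro sum.neutral) auto
      have "{..d} = {..<k} \<union> ({k} \<union> {k<..d})" using less.prems by auto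
      then have "(\<Sum>j\<le>d. f m x ^ j * G j x) = (\<Sum>j<k. f m x ^ j * G j x) +
          (f m x ^ k * G k x + (\<Sum>j\<in>{k<..d}. f m x ^ j * G j x))"
        by (simp only:) (subst sum.union_disjoint, auto)
      also have "(\<Sum>j<k. f m x ^ j * G j x) = 0" by (intro sum.neutral) (simp add: low)
      also have "(\<Sum>j\<in>{k<..d}. f m x ^ j * G j x) = f m x ^ k * (f m x * H x)"
        unfolding H_def sum_distrib_left
      proof (intro sum.cong refl)
        fix j assume "j \<in> {k<..d}"
        then have "j = k + Suc (j - k - 1)" by auto
        then have "f m x ^ j = f m x ^ k * (f m x * f m x ^ (j - k - 1))"
          by (metis power_add power_Suc)
        then show "f m x ^ j * G j x = f m x ^ k * (f m x * (f m x ^ (j - k - 1) * G j x))"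
          by (simp add: mult.assoc)
      qed
      finally show ?thesis using sum[OF x] by (simp add: algebra_simps)
    qed
    moreover have "complex_polynomial_fun (\<lambda>x. f m x ^ k)"
      "complex_polynomial_fun (\<lambda>x. G k x + f m x * H x)"
      unfolding complex_polynomial_fun_iff H_def
      by (intro function_algebra.add function_algebra.mult function_algebra_power function_algebra_sum fm G)+
    moreover have "irreducible_subset zariski (Z (Suc m))" using irr Suc.prems(1) by blast
    \<comment> \<open>Irreducibility of \<open>Z (Suc m)\<close> allows cancelling
      \<open>f m x ^ k\<close>, which is not identically zero there. On \<open>Z m\<close> the
      multiple of \<open>f m\<close> then drops out.\<close>
    ultimately have "(\<forall>x\<in>Z (Suc m). f m x ^ k = 0) \<or> (\<forall>x\<in>Z (Suc m). G k x + f m x * H x = 0)"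
      using irreducible_subset_product by blast
    moreover have "\<not> (\<forall>x\<in>Z (Suc m). f m x ^ k = 0)"
      using nonzero[of m] Suc.prems(1) by auto
    ultimately have "G k x = 0" if "x \<in> Z m" for x
      using zero[of m x] sub[of m] Suc.prems(1) that by force
    then show ?case using Suc.IH[of "\<lambda>ks. c (k # ks)"] Suc.prems(1) unfolding G_def by auto
  qed
  then show ?case using Suc.prems(3) by (auto simp: exponents_def length_Suc_conv)
qed

text \<open>Gaussian elimination: the pivot \<open>a0\<close> clears the equation \<open>b\<close>
  from the other unknowns, and its own value is recovered afterwards.\<close>

lemma homogeneous_system:
  fixes M :: "'a \<Rightarrow> 'b \<Rightarrow> complex"
  assumes "finite B" "finite A" "card B < card A"
  shows "\<exists>c. (\<exists>a\<in>A. c a \<noteq> 0) \<and> (\<forall>b\<in>B. (\<Sum>a\<in>A. c a * M a b) = 0)"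
  using assms
proof (induction B arbitrary: A M)
  case empty
  then have "A \<noteq> {}" by auto
  then show ?case by (intro exI[of _ "\<lambda>_. 1"]) auto
next
  case (insert b B)
  show ?case
  proof (cases "\<forall>a\<in>A. M a b = 0")
    case True
    have "card B < card A" using insert by simp
    then obtain c where "\<exists>a\<in>A. c a \<noteq> 0" "\<forall>b\<in>B. (\<Sum>a\<in>A. c a * M a b) = 0"
      using insert.IH[OF insert.prems(1), of M] by blast
    then show ?thesis using True by (intro exI[of _ c]) auto
  next
    case False
    then obtain a0 where a0: "a0 \<in> A" "M a0 b \<noteq> 0" by blast
    define A' where "A' = A - {a0}"
    have A': "finite A'" "card B < card A'" "A = insert a0 A'" "a0 \<notin> A'"
      using insert a0 by (auto simp: A'_def)
    obtain c where c: "\<exists>a\<in>A'. c a \<noteq> 0"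
      "\<forall>b'\<in>B. (\<Sum>a\<in>A'. c a * (M a b' - M a b / M a0 b * M a0 b')) = 0"
      using insert.IH[OF A'(1,2), of "\<lambda>a b'. M a b' - M a b / M a0 b * M a0 b'"] by blast
    define s where "s = (\<Sum>a\<in>A'. c a * M a b) / M a0 b"
    define c' where "c' a = (if a = a0 then - s else c a)" for a
    have eq: "(\<Sum>a\<in>A. c' a * M a b') = - s * M a0 b' + (\<Sum>a\<in>A'. c a * M a b')" for b'
    proof -
      have "(\<Sum>a\<in>A'. c' a * M a b') = (\<Sum>a\<in>A'. c a * M a b')"
        using A'(4) by (intro sum.cong) (auto simp: c'_def)
      then show ?thesis unfolding A'(3) using A'(1,4) by (simp add: c'_def)
    qed
    have "(\<Sum>a\<in>A. c' a * M a b') = 0" if "b' \<in> insert b B" for b'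
    proof (cases "b' = b")
      case True
      then show ?thesis unfolding eq using a0(2) by (simp add: s_def)
    next
      case False
      then have "0 = (\<Sum>a\<in>A'. c a * (M a b' - M a b / M a0 b * M a0 b'))" using c(2) that by auto
      also have "\<dots> = (\<Sum>a\<in>A'. c a * M a b') - s * M a0 b'"
        by (simp add: s_def sum_subtractf right_diff_distrib sum_divide_distrib sum_distrib_right mult.assoc)
      finally show ?thesis unfolding eq by simp
    qed
    moreover have "\<exists>a\<in>A. c' a \<noteq> 0" using c(1) A'(3,4) by (auto simp: c'_def)
    ultimately show ?thesis by blast
  qed
qed

definition box_polynomials :: "(nat \<Rightarrow> 'a \<Rightarrow> complex) \<Rightarrow> nat \<Rightarrow> nat \<Rightarrow> ('a \<Rightarrow> complex) set" where
  "box_polynomials h n e = {F. \<exists>c. \<forall>x. F x = (\<Sum>ks\<in>exponents n e. c ks * monomial h ks x)}"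

lemma box_polynomials_monomial:
  assumes "ks \<in> exponents n e" shows "(\<lambda>x. monomial h ks x) \<in> box_polynomials h n e"
proof -
  have "monomial h ks x = (\<Sum>ls\<in>exponents n e. (if ls = ks then 1 else 0) * monomial h ls x)" for x
  proof -
    have "(\<Sum>ls\<in>exponents n e. (if ls = ks then 1 else 0) * monomial h ls x) =
        (\<Sum>ls\<in>exponents n e. if ls = ks then monomial h ks x else 0)"
      by (intro sum.cong) auto
    then show ?thesis using assms finite_exponents by simp
  qed
  then show ?thesis unfolding box_polynomials_def mem_Collect_eq by (intro exI allI)
qed

lemma box_polynomials_scale:
  assumes "F \<in> box_polynomials h n e" shows "(\<lambda>x. k * F x) \<in> box_polynomials h n e"
proof -
  obtain c where c: "F x = (\<Sum>ks\<in>exponents n e. c ks * monomial h ks x)" for x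
    using assms unfolding box_polynomials_def by blast
  have "k * F x = (\<Sum>ks\<in>exponents n e. (k * c ks) * monomial h ks x)" for x
    unfolding c sum_distrib_left by (simp add: mult.assoc)
  then show ?thesis unfolding box_polynomials_def mem_Collect_eq by (intro exI allI)
qed

lemma box_polynomials_add:
  assumes "F \<in> box_polynomials h n e" "G \<in> box_polynomials h n e"
  shows "(\<lambda>x. F x + G x) \<in> box_polynomials h n e"
proof -
  obtain c c' where c: "F x = (\<Sum>ks\<in>exponents n e. c ks * monomial h ks x)"
    "G x = (\<Sum>ks\<in>exponents n e. c' ks * monomial h ks x)" for x
    using assms unfolding box_polynomials_def by blast
  have "F x + G x = (\<Sum>ks\<in>exponents n e. (c ks + c' ks) * monomial h ks x)" for x
    unfolding c by (simp add: sum.distrib ring_distribs)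
  then show ?thesis unfolding box_polynomials_def mem_Collect_eq by (intro exI allI)
qed

lemma box_polynomials_sum:
  assumes "\<And>i. i \<in> A \<Longrightarrow> F i \<in> box_polynomials h n e"
  shows "(\<lambda>x. \<Sum>i\<in>A. F i x) \<in> box_polynomials h n e"
proof -
  have "(\<lambda>x. 0) \<in> box_polynomials h n e"
    unfolding box_polynomials_def mem_Collect_eq by (intro exI[of _ "\<lambda>_. 0"]) simp
  then show ?thesis using assms
    by (induction A rule: infinite_finite_induct) (auto intro: box_polynomials_add)
qed

lemma box_polynomials_mono:
  assumes "F \<in> box_polynomials h n e" "e \<le> e'" shows "F \<in> box_polynomials h n e'"
proof -
  obtain c where c: "F x = (\<Sum>ks\<in>exponents n e. c ks * monomial h ks x)" for x
    using assms unfolding box_polynomials_def by blast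
  have "exponents n e \<subseteq> exponents n e'" using assms(2) by (auto simp: exponents_def)
  then have "(\<lambda>x. \<Sum>ks\<in>exponents n e. c ks * monomial h ks x) \<in> box_polynomials h n e'"
    by (intro box_polynomials_sum box_polynomials_scale box_polynomials_monomial) auto
  moreover have "F = (\<lambda>x. \<Sum>ks\<in>exponents n e. c ks * monomial h ks x)" using c by auto
  ultimately show ?thesis by simp
qed

lemma monomial_mult:
  "length ks = length ls \<Longrightarrow> monomial h ks x * monomial h ls x = monomial h (map2 (+) ks ls) x"
  by (induction ks ls rule: list_induct2) (auto simp: power_add mult_ac)

lemma map2_exponents:
  assumes "ks \<in> exponents n e" "ls \<in> exponents n e'"
  shows "map2 (+) ks ls \<in> exponents n (e + e')"
proof -
  have "x \<le> e + e'" if "x \<in> set (map2 (+) ks ls)" for x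
  proof -
    have "x \<in> (\<lambda>(a, b). a + b) ` set (zip ks ls)" using that by (simp only: set_map)
    then obtain p where p: "p \<in> set (zip ks ls)" "x = (\<lambda>(a, b). a + b) p" by (elim imageE)
    obtain a b where "p = (a, b)" by (cases p)
    with p have ab: "(a, b) \<in> set (zip ks ls)" "x = a + b" by simp_all
    then have "a \<le> e" "b \<le> e'"
      using assms set_zip_leftD[OF ab(1)] set_zip_rightD[OF ab(1)] by (auto simp: exponents_def)
    then show ?thesis using ab(2) by simp
  qed
  then show ?thesis using assms by (auto simp: exponents_def)
qed

lemma box_polynomials_mult:
  assumes "F \<in> box_polynomials h n e" "G \<in> box_polynomials h n e'"
  shows "(\<lambda>x. F x * G x) \<in> box_polynomials h n (e + e')"
proof -
  obtain c c' where c: "F x = (\<Sum>ks\<in>exponents n e. c ks * monomial h ks x)"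
    "G x = (\<Sum>ks\<in>exponents n e'. c' ks * monomial h ks x)" for x
    using assms unfolding box_polynomials_def by blast
  have "F x * G x = (\<Sum>ks\<in>exponents n e. \<Sum>ls\<in>exponents n e'. (c ks * c' ls) * monomial h (map2 (+) ks ls) x)" for x
    unfolding c sum_product by (intro sum.cong refl) (auto simp: exponents_def mult_ac simp flip: monomial_mult)
  then have "(\<lambda>x. F x * G x) =
      (\<lambda>x. \<Sum>ks\<in>exponents n e. \<Sum>ls\<in>exponents n e'. (c ks * c' ls) * monomial h (map2 (+) ks ls) x)" by blast
  also have "\<dots> \<in> box_polynomials h n (e + e')"
    by (intro box_polynomials_sum box_polynomials_scale box_polynomials_monomial map2_exponents)
  finally show ?thesis .
qed

lemma box_polynomials_const: "(\<lambda>_. k) \<in> box_polynomials h n e"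
proof -
  have "monomial h (replicate n 0) x = 1" for x by (induction n) auto
  moreover have "replicate n 0 \<in> exponents n e" by (auto simp: exponents_def)
  ultimately show ?thesis
    using box_polynomials_scale[OF box_polynomials_monomial, of "replicate n 0" n e k h] by simp
qed

lemma box_polynomials_power:
  assumes "F \<in> box_polynomials h n e" shows "(\<lambda>x. F x ^ k) \<in> box_polynomials h n (k * e)"
proof (induction k)
  case 0
  then show ?case using box_polynomials_const[of 1] by simp
next
  case (Suc k)
  then show ?case using box_polynomials_mult[OF assms Suc] by simp
qed

lemma box_polynomials_generator:
  assumes "i < n" shows "h i \<in> box_polynomials h n 1"
proof -
  have 0: "monomial h (replicate k 0) x = 1" for k x by (induction k) auto
  have "monomial h (replicate k 0 @ 1 # replicate i 0) x = h i x" for k x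
    by (induction k) (auto simp: 0)
  moreover have "replicate (n - 1 - i) 0 @ 1 # replicate i 0 \<in> exponents n 1"
    using assms by (auto simp: exponents_def)
  ultimately show ?thesis
    using box_polynomials_monomial[of "replicate (n - 1 - i) 0 @ 1 # replicate i 0" n 1 h] by auto
qed

lemma function_algebra_box:
  assumes "F \<in> function_algebra (h ` {..<n})" shows "\<exists>e. F \<in> box_polynomials h n e"
  using assms
proof (induction rule: function_algebra.induct)
  case (const c)
  then show ?case using box_polynomials_const by blast
next
  case (gen f)
  then show ?case using box_polynomials_generator by blast
next
  case (add f g)
  then obtain a b where "f \<in> box_polynomials h n a" "g \<in> box_polynomials h n b" by blast
  then have "f \<in> box_polynomials h n (max a b)" "g \<in> box_polynomials h n (max a b)"
    using box_polynomials_mono by (meson max.cobounded1, meson max.cobounded2)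
  then show ?case using box_polynomials_add by blast
next
  case (mult f g)
  then show ?case using box_polynomials_mult by blast
qed

lemma matrix_entries_enumeration:
  obtains h :: "nat \<Rightarrow> complex ^ 3 ^ 3 \<Rightarrow> complex" where "\<And>i j. (\<lambda>g. g $ i $ j) \<in> h ` {..<9}"
proof -
  have "card (UNIV :: (3 \<times> 3) set) = 9" by (simp add: card_prod)
  then obtain b where b: "bij_betw b {0..<9::nat} (UNIV :: (3 \<times> 3) set)"
    using ex_bij_betw_nat_finite[of "UNIV :: (3 \<times> 3) set"] by auto
  have "(\<lambda>g. g $ i $ j) \<in> (\<lambda>k g. g $ fst (b k) $ snd (b k)) ` {..<9}" for i j
  proof -
    obtain k where "k \<in> {0..<9}" "b k = (i, j)" using b unfolding bij_betw_def by (metis UNIV_I imageE)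
    then show ?thesis by (intro image_eqI[of _ _ k]) auto
  qed
  then show ?thesis using that by blast
qed

lemma box_polynomials_common:
  fixes n :: nat
  assumes "\<And>j. j < n \<Longrightarrow> \<exists>e. F j \<in> box_polynomials h m e"
  shows "\<exists>e. \<forall>j<n. F j \<in> box_polynomials h m e"
  using assms
proof (induction n)
  case (Suc n)
  then obtain e e' where e: "\<forall>j<n. F j \<in> box_polynomials h m e" "F n \<in> box_polynomials h m e'" by force
  have "\<forall>j<Suc n. F j \<in> box_polynomials h m (max e e')"
    using e box_polynomials_mono[of _ h m _ "max e e'"] by (auto simp: less_Suc_eq)
  then show ?case by blast
qed simp

text \<open>Pulling back along \<open>g \<mapsto> g * \<mu>\<close> and clearing denominators turns the \<open>(d + 1)\<^sup>n\<close> monomials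
  in \<open>f\<close> into polynomials in the nine matrix entries, which span too small a space if \<open>n > 9\<close>.\<close>

lemma polynomials_on_orbit_dependent:
  assumes n: "9 < n" and f: "\<And>i. i < n \<Longrightarrow> complex_polynomial_fun (f i)"
  obtains d c where "\<exists>ks\<in>exponents n d. c ks \<noteq> 0"
    "\<And>\<nu>. \<nu> \<in> orbit \<mu> \<Longrightarrow> (\<Sum>ks\<in>exponents n d. c ks * monomial f ks \<nu>) = 0"
proof -
  obtain h :: "nat \<Rightarrow> complex ^ 3 ^ 3 \<Rightarrow> complex" where h: "\<And>i j. (\<lambda>g. g $ i $ j) \<in> h ` {..<9}"
    by (rule matrix_entries_enumeration) blast
  let ?A = "function_algebra (h ` {..<9})"
  have entries: "(\<lambda>g. g $ i $ j) \<in> ?A" for i j using h by (rule function_algebra.gen)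
  define D0 where "D0 g = det g ^ 3" for g :: "complex ^ 3 ^ 3"
  have D0: "D0 \<in> ?A" unfolding D0_def
    by (rule function_algebra_power[OF det_function_algebra[where g = "\<lambda>g. g", OF entries]])
  have act: "(\<lambda>g. D0 g * GL_action g \<mu> $ t) \<in> ?A" for t
    unfolding D0_def
    by (rule GL_action_rational[where g = "\<lambda>g. g" and M = "\<lambda>_. \<mu>", OF entries function_algebra.const])
  have "\<exists>N. \<forall>M\<ge>N. (\<lambda>g. D0 g ^ M * f i (GL_action g \<mu>)) \<in> ?A" if "i < n" for i
    using complex_polynomial_fun_clear_denominator[OF f[OF that] D0 act] by blast
  then have "\<forall>i. \<exists>N. i < n \<longrightarrow> (\<forall>M\<ge>N. (\<lambda>g. D0 g ^ M * f i (GL_action g \<mu>)) \<in> ?A)" by blast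
  then obtain N where "\<forall>i. i < n \<longrightarrow> (\<forall>M\<ge>N i. (\<lambda>g. D0 g ^ M * f i (GL_action g \<mu>)) \<in> ?A)"
    by (rule choice[THEN exE])
  then have N: "\<And>i M. i < n \<Longrightarrow> N i \<le> M \<Longrightarrow> (\<lambda>g. D0 g ^ M * f i (GL_action g \<mu>)) \<in> ?A"
    by blast
  \<comment> \<open>The sum bounds every \<open>N i\<close>, so one power of the denominator clears
    all the functions.\<close>
  define M where "M = (\<Sum>i<n. N i)"
  define D where "D g = D0 g ^ M" for g
  have NM: "N i \<le> M" if "i < n" for i unfolding M_def using that by (intro member_le_sum) auto
  have "\<exists>e. (\<lambda>g. D g * f i (GL_action g \<mu>)) \<in> box_polynomials h 9 e" if "i < n" for i
    unfolding D_def by (rule function_algebra_box) (use N NM that in blast)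
  then obtain e1 where e1: "\<forall>i<n. (\<lambda>g. D g * f i (GL_action g \<mu>)) \<in> box_polynomials h 9 e1"
    using box_polynomials_common[of n "\<lambda>i g. D g * f i (GL_action g \<mu>)" h 9] by blast
  have "D \<in> ?A" unfolding D_def by (intro function_algebra_power D0)
  then obtain e2 where e2: "D \<in> box_polynomials h 9 e2" using function_algebra_box by blast
  define e where "e = max e1 e2"
  have P: "(\<lambda>g. D g * f i (GL_action g \<mu>)) \<in> box_polynomials h 9 e" if "i < n" for i
    by (rule box_polynomials_mono[of _ _ _ e1]) (use e1 that in \<open>auto simp: e_def\<close>)
  have De: "D \<in> box_polynomials h 9 e" by (rule box_polynomials_mono[OF e2]) (simp add: e_def)
  \<comment> \<open>Each variable is padded to the power \<open>d\<close> of the denominator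
    whatever its exponent, so that all monomials are multiplied by the same power of
    \<open>D\<close>.\<close>
  have Q: "length ks \<le> n \<Longrightarrow> set ks \<subseteq> {..d} \<Longrightarrow>
      (\<lambda>g. D g ^ (length ks * d) * monomial f ks (GL_action g \<mu>)) \<in> box_polynomials h 9 (length ks * (d * e))"
    for ks d
  proof (induction ks)
    case Nil
    then show ?case using box_polynomials_const[of 1] by simp
  next
    case (Cons k ks)
    have "k \<le> d" "length ks < n" using Cons.prems by auto
    then have "(\<lambda>g. D g ^ (d - k) * (D g * f (length ks) (GL_action g \<mu>)) ^ k) \<in>
        box_polynomials h 9 ((d - k) * e + k * e)"
      by (intro box_polynomials_mult box_polynomials_power P De)
    moreover have "(d - k) * e + k * e = d * e" using \<open>k \<le> d\<close> by (simp flip: add_mult_distrib)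
    moreover have "(\<lambda>g. D g ^ (length ks * d) * monomial f ks (GL_action g \<mu>)) \<in> box_polynomials h 9 (length ks * (d * e))"
      using Cons by auto
    ultimately have "(\<lambda>g. (D g ^ (d - k) * (D g * f (length ks) (GL_action g \<mu>)) ^ k) *
        (D g ^ (length ks * d) * monomial f ks (GL_action g \<mu>))) \<in> box_polynomials h 9 (d * e + length ks * (d * e))"
      using box_polynomials_mult[of "\<lambda>g. D g ^ (d - k) * (D g * f (length ks) (GL_action g \<mu>)) ^ k" h 9 "d * e"] by simp
    moreover have "(D g ^ (d - k) * (D g * f (length ks) (GL_action g \<mu>)) ^ k) *
        (D g ^ (length ks * d) * monomial f ks (GL_action g \<mu>)) =
        D g ^ (length (k # ks) * d) * monomial f (k # ks) (GL_action g \<mu>)" for g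
    proof -
      have "D g ^ (length (k # ks) * d) = D g ^ (d - k) * D g ^ k * D g ^ (length ks * d)"
        using \<open>k \<le> d\<close> by (simp flip: power_add)
      then show ?thesis by (simp add: power_mult_distrib mult_ac)
    qed
    ultimately show ?case by simp
  qed
  \<comment> \<open>The aim is (E + 1)^9 < (d + 1)^n, where E = n d e grows linearly in d. As E + 1
    \<le> K (d + 1), the choice d = K^9 gives (E + 1)^9 \<le> d (d + 1)^9 < (d + 1)^10.\<close>
  define K where "K = n * e + 1"
  define d where "d = K ^ 9"
  define E where "E = n * (d * e)"
  have "E + 1 \<le> K * (d + 1)" unfolding E_def K_def by (simp add: algebra_simps)
  then have "(E + 1) ^ 9 \<le> (K * (d + 1)) ^ 9" by (rule power_mono) simp
  also have "\<dots> = d * (d + 1) ^ 9" by (simp only: power_mult_distrib d_def)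
  also have "\<dots> < (d + 1) ^ Suc 9" unfolding power_Suc by simp
  also have "\<dots> \<le> (d + 1) ^ n" using n by (intro power_increasing) auto
  finally have card: "card (exponents 9 E) < card (exponents n d)" by (simp only: card_exponents)
  have "\<exists>m. \<forall>g. D g ^ (n * d) * monomial f ks (GL_action g \<mu>) = (\<Sum>ls\<in>exponents 9 E. m ls * monomial h ls g)"
    if "ks \<in> exponents n d" for ks
    using Q[of ks d] that unfolding box_polynomials_def exponents_def E_def by auto
  then have "\<forall>ks. \<exists>m. ks \<in> exponents n d \<longrightarrow>
      (\<forall>g. D g ^ (n * d) * monomial f ks (GL_action g \<mu>) = (\<Sum>ls\<in>exponents 9 E. m ls * monomial h ls g))"
    by blast
  then obtain m where "\<forall>ks. ks \<in> exponents n d \<longrightarrow>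
      (\<forall>g. D g ^ (n * d) * monomial f ks (GL_action g \<mu>) = (\<Sum>ls\<in>exponents 9 E. m ks ls * monomial h ls g))"
    by (rule choice[THEN exE])
  then have m: "\<And>ks g. ks \<in> exponents n d \<Longrightarrow>
      D g ^ (n * d) * monomial f ks (GL_action g \<mu>) = (\<Sum>ls\<in>exponents 9 E. m ks ls * monomial h ls g)"
    by blast
  obtain c where c: "\<exists>ks\<in>exponents n d. c ks \<noteq> 0"
    "\<And>ls. ls \<in> exponents 9 E \<Longrightarrow> (\<Sum>ks\<in>exponents n d. c ks * m ks ls) = 0"
    using homogeneous_system[OF finite_exponents finite_exponents card, of m] by blast
  have "(\<Sum>ks\<in>exponents n d. c ks * monomial f ks \<nu>) = 0" if \<nu>: "\<nu> \<in> orbit \<mu>" for \<nu>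
  proof -
    obtain g where g: "invertible g" "\<nu> = GL_action g \<mu>" using \<nu> unfolding orbit_def by blast
    have "D g ^ (n * d) * (\<Sum>ks\<in>exponents n d. c ks * monomial f ks \<nu>) =
        (\<Sum>ks\<in>exponents n d. c ks * (D g ^ (n * d) * monomial f ks (GL_action g \<mu>)))"
      unfolding g(2) sum_distrib_left by (simp add: mult_ac)
    also have "\<dots> = (\<Sum>ks\<in>exponents n d. \<Sum>ls\<in>exponents 9 E. c ks * m ks ls * monomial h ls g)"
      by (intro sum.cong refl) (simp add: m sum_distrib_left mult.assoc)
    also have "\<dots> = (\<Sum>ls\<in>exponents 9 E. (\<Sum>ks\<in>exponents n d. c ks * m ks ls) * monomial h ls g)"
      by (subst sum.swap) (simp add: sum_distrib_right)
    also have "\<dots> = 0" by (simp add: c(2))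
    finally show ?thesis using g(1) by (simp add: D_def D0_def invertible_det_nz)
  qed
  then show ?thesis using that c(1) by blast
qed

section \<open>Chains of irreducible closed sets in the variety\<close>

lemma closedin_variety_iff:
  "closedin right_alternative_variety S \<longleftrightarrow> algebraic_set S \<and> S \<subseteq> {\<mu>. right_alternative \<mu>}"
  unfolding right_alternative_variety_def
  using closedin_closed_subtopology[OF closedin_right_alternative] by (simp add: closedin_zariski)

text \<open>Polynomials that distinguish consecutive members are algebraically independent on the
  top member. That member lies in one orbit closure, and a relation on the orbit persists on its
  closure.\<close>

lemma chain_length_le_9:
  fixes Z :: "nat \<Rightarrow> structure_constants set"
  assumes Z: "\<And>i. i \<le> n \<Longrightarrow> closedin right_alternative_variety (Z i) \<and> irreducible_subset right_alternative_variety (Z i)"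
    and chain: "\<And>i. i < n \<Longrightarrow> Z i \<subset> Z (Suc i)"
  shows "n \<le> 9"
proof (rule ccontr)
  assume "\<not> n \<le> 9"
  have "\<exists>p. complex_polynomial_fun p \<and> (\<forall>x\<in>Z i. p x = 0) \<and> (\<exists>x\<in>Z (Suc i). p x \<noteq> 0)" if i: "i < n" for i
  proof -
    obtain P where P: "\<forall>p\<in>P. complex_polynomial_fun p" "Z i = zero_locus P"
      using Z[of i] i unfolding closedin_variety_iff algebraic_set_def by auto
    obtain x where "x \<in> Z (Suc i)" "x \<notin> Z i" using chain[OF i] by blast
    then show ?thesis using P unfolding zero_locus_def by blast
  qed
  then have "\<forall>i. \<exists>p. i < n \<longrightarrow> complex_polynomial_fun p \<and> (\<forall>x\<in>Z i. p x = 0) \<and> (\<exists>x\<in>Z (Suc i). p x \<noteq> 0)"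
    by blast
  then obtain f where "\<forall>i. i < n \<longrightarrow> complex_polynomial_fun (f i) \<and> (\<forall>x\<in>Z i. f i x = 0) \<and> (\<exists>x\<in>Z (Suc i). f i x \<noteq> 0)"
    by (rule choice[THEN exE])
  then have f: "\<And>i. i < n \<Longrightarrow> complex_polynomial_fun (f i)"
    "\<And>i x. i < n \<Longrightarrow> x \<in> Z i \<Longrightarrow> f i x = 0" "\<And>i. i < n \<Longrightarrow> \<exists>x\<in>Z (Suc i). f i x \<noteq> 0"
    by blast+
  obtain k where k: "Z n \<subseteq> component_closure k" using irreducible_subset_component Z by blast
  obtain d c where c: "\<exists>ks\<in>exponents n d. c ks \<noteq> 0"
    "\<And>\<nu>. \<nu> \<in> orbit (component_algebra k) \<Longrightarrow> (\<Sum>ks\<in>exponents n d. c ks * monomial f ks \<nu>) = 0"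
    by (rule polynomials_on_orbit_dependent[where n = n and f = f and \<mu> = "component_algebra k"])
      (use \<open>\<not> n \<le> 9\<close> f(1) in \<open>simp, blast, blast\<close>)
  have "complex_polynomial_fun (\<lambda>\<nu>. \<Sum>ks\<in>exponents n d. c ks * monomial f ks \<nu>)"
    unfolding complex_polynomial_fun_iff using f(1) complex_polynomial_fun_iff
    by (intro function_algebra_sum function_algebra.mult function_algebra.const monomial_polynomial[of n])
      (auto simp: exponents_def)
  then have vanish: "(\<Sum>ks\<in>exponents n d. c ks * monomial f ks \<nu>) = 0" if "\<nu> \<in> Z n" for \<nu>
    using zariski_closure_iff[of \<nu>] k that c(2) by blast
  have "c ks = 0" if "ks \<in> exponents n d" for ks
  proof (rule chain_algebraically_independent[where n = n and Z = Z and f = f and m = n and d = d and c = c and ks = ks])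
    show "irreducible_subset zariski (Z i)" if "i \<le> n" for i
      using Z[OF that] unfolding irreducible_subset_variety by blast
    show "Z i \<subseteq> Z (Suc i)" if "i < n" for i using chain[OF that] by blast
  qed (use f that vanish in auto)
  then show False using c(1) by blast
qed

text \<open>A chain of length \<open>9\<close>: the algebras generated by \<open>e\<^sub>1\<close> with basis \<open>e\<^sub>1, e\<^sub>1\<^sup>2, e\<^sub>1\<^sup>3\<close> are
  parametrised by \<open>e\<^sub>1\<^sup>2\<close>, \<open>e\<^sub>1\<^sup>3\<close> and the coordinates of \<open>e\<^sub>1\<^sup>4\<close> in this basis;
  these nine parameters are released one after the other.\<close>

definition generic_frame :: "(nat \<Rightarrow> complex) \<Rightarrow> complex ^ 3 ^ 3" where
  "generic_frame p = frame (vector [1, 0, 0]) (vector [p 3, p 4, p 5]) (vector [p 6, p 7, p 8])"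

definition generic_algebra :: "(nat \<Rightarrow> complex) \<Rightarrow> structure_constants" where
  "generic_algebra p = GL_action (generic_frame p) (structure_table (monogenic_table (p 0) (p 1) (p 2)))"

text \<open>At the base point the frame is the identity matrix and the fourth power of e1 is
  zero.\<close>

definition base_parameter :: "nat \<Rightarrow> complex" where
  "base_parameter i = (if i = 4 \<or> i = 8 then 1 else 0)"

definition parameter_space :: "nat \<Rightarrow> (nat \<Rightarrow> complex) set" where
  "parameter_space j = {p. \<forall>i\<ge>j. p i = base_parameter i}"

definition chain_set :: "nat \<Rightarrow> structure_constants set" where
  "chain_set j = {generic_algebra p | p. p \<in> parameter_space j \<and> det (generic_frame p) \<noteq> 0}"

definition position :: "nat \<Rightarrow> 3" where
  "position j = (if j mod 3 = 0 then 1 else if j mod 3 = 1 then 2 else 3)"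

text \<open>This recovers parameter \<open>j\<close>, shifted to vanish until it is released. The
  coefficients of the fourth power are read from e1 e3, which is correct only while the frame is the
  identity; hence they are released first, and the square and the cube of e1 afterwards.\<close>

definition chain_function :: "nat \<Rightarrow> structure_constants \<Rightarrow> complex" where
  "chain_function j \<mu> = (if j < 3 then alg_mult \<mu> (axis 1 1) (axis 3 1)
     else if j < 6 then alg_mult \<mu> (axis 1 1) (axis 1 1)
     else alg_mult \<mu> (axis 1 1) (alg_mult \<mu> (axis 1 1) (axis 1 1))) $ position j - base_parameter j"

lemma det_generic_frame: "det (generic_frame p) = p 4 * p 8 - p 5 * p 7"
  by (simp add: generic_frame_def frame_def det_3 algebra_simps)

lemma generic_algebra_powers:
  assumes "det (generic_frame p) \<noteq> 0"
  shows "alg_mult (generic_algebra p) (axis 1 1) (axis 1 1) = vector [p 3, p 4, p 5]"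
    and "alg_mult (generic_algebra p) (axis 1 1) (vector [p 3, p 4, p 5]) = vector [p 6, p 7, p 8]"
    and "alg_mult (generic_algebra p) (axis 1 1) (vector [p 6, p 7, p 8]) =
      generic_frame p *v vector [p 0, p 1, p 2]"
proof -
  have inv: "invertible (generic_frame p)" using assms by (simp add: invertible_det_nz)
  have ax: "generic_frame p *v axis 1 1 = axis 1 1" "generic_frame p *v axis 2 1 = vector [p 3, p 4, p 5]"
    "generic_frame p *v axis 3 1 = vector [p 6, p 7, p 8]"
    unfolding generic_frame_def frame_axis by (simp_all add: axis_def vec_eq_iff forall_3)
  note m = alg_mult_GL_action'[OF inv, of "structure_table (monogenic_table (p 0) (p 1) (p 2))", folded generic_algebra_def]
  let ?m = "alg_mult (structure_table (monogenic_table (p 0) (p 1) (p 2)))"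
  have t: "?m (axis 1 1) (axis 1 1) = axis 2 1" "?m (axis 1 1) (axis 2 1) = axis 3 1"
    "?m (axis 1 1) (axis 3 1) = vector [p 0, p 1, p 2]"
    unfolding alg_mult_axis_nth by (simp_all add: vec_eq_iff forall_3 monogenic_table_def axis_def)
  show "alg_mult (generic_algebra p) (axis 1 1) (axis 1 1) = vector [p 3, p 4, p 5]"
    using m[of "axis 1 1" "axis 1 1"] by (simp only: ax t)
  show "alg_mult (generic_algebra p) (axis 1 1) (vector [p 3, p 4, p 5]) = vector [p 6, p 7, p 8]"
    using m[of "axis 1 1" "axis 2 1"] by (simp only: ax t)
  show "alg_mult (generic_algebra p) (axis 1 1) (vector [p 6, p 7, p 8]) = generic_frame p *v vector [p 0, p 1, p 2]"
    using m[of "axis 1 1" "axis 3 1"] by (simp only: ax t)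
qed

lemma chain_function_generic:
  assumes "det (generic_frame p) \<noteq> 0" "j < 9" "j < 3 \<Longrightarrow> p \<in> parameter_space 3"
  shows "chain_function j (generic_algebra p) = p j - base_parameter j"
proof -
  have "j \<in> {0, 1, 2, 3, 4, 5, 6, 7, 8}" using assms(2) by auto
  moreover have "p 3 = 0 \<and> p 4 = 1 \<and> p 5 = 0 \<and> p 6 = 0 \<and> p 7 = 0 \<and> p 8 = 1" if "j < 3"
    using assms(3)[OF that] by (simp add: parameter_space_def base_parameter_def)
  moreover have "(vector [0, 0, 1] :: complex ^ 3) = axis 3 1" by (simp add: vec_eq_iff forall_3 axis_def)
  moreover have "(axis 3 1 :: complex ^ 3) $ 1 = 0" "(axis 3 1 :: complex ^ 3) $ 2 = 0"
    "(axis 3 1 :: complex ^ 3) $ 3 = 1" by (simp_all add: axis_def)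
  ultimately show ?thesis using generic_algebra_powers[OF assms(1)]
    by (auto simp: chain_function_def position_def base_parameter_def generic_frame_def frame_mult)
qed

lemma chain_function_polynomial: "complex_polynomial_fun (chain_function j)"
proof -
  have "(\<lambda>\<mu>. alg_mult \<mu> x (axis i 1) $ position j - base_parameter j) \<in> coordinate_algebra" for x i
    by (intro polynomial_intros)
  moreover have "(\<lambda>\<mu>. alg_mult \<mu> x (alg_mult \<mu> y (axis i 1)) $ position j - base_parameter j) \<in> coordinate_algebra" for x y i
    by (intro polynomial_intros)
  ultimately show ?thesis
    unfolding complex_polynomial_fun_iff chain_function_def by (cases "j < 3"; cases "j < 6") simp_all
qed

lemma chain_set_rationally_connected: "rationally_connected (chain_set j)"
  unfolding chain_set_def generic_algebra_def
proof (rule rationally_connected_family[of base_parameter])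
  show "base_parameter \<in> parameter_space j" by (simp add: parameter_space_def)
  show "det (generic_frame base_parameter) \<noteq> 0" by (simp add: det_generic_frame base_parameter_def)
next
  fix p q assume pq: "p \<in> parameter_space j" "q \<in> parameter_space j"
  let ?l = "\<lambda>t i. p i + t * (q i - p i)"
  have l: "(\<lambda>t. ?l t i) \<in> function_algebra {\<lambda>t. t}" for i by (intro function_algebra_intros)
  have "\<forall>i k. (\<lambda>t. generic_frame (?l t) $ i $ k) \<in> function_algebra {\<lambda>t. t}"
    by (simp add: generic_frame_def frame_def forall_3) (intro conjI l function_algebra.const)
  moreover have "\<forall>i k m. (\<lambda>t. monogenic_table (?l t 0) (?l t 1) (?l t 2) $ i $ k $ m) \<in> function_algebra {\<lambda>t. t}"
    by (simp add: monogenic_table_def forall_3) (intro conjI function_algebra_intros)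
  then have "\<forall>k. (\<lambda>t. structure_table (monogenic_table (?l t 0) (?l t 1) (?l t 2)) $ k) \<in> function_algebra {\<lambda>t. t}"
    by (intro allI) (rule structure_table_polynomial)
  moreover have "?l t \<in> parameter_space j" for t using pq by (simp add: parameter_space_def)
  moreover have "?l 0 = p" "?l 1 = q" by auto
  ultimately show "\<exists>l. l 0 = p \<and> l 1 = q \<and> (\<forall>t. l t \<in> parameter_space j) \<and>
      (\<forall>i k. (\<lambda>t. generic_frame (l t) $ i $ k) \<in> function_algebra {\<lambda>t. t}) \<and>
      (\<forall>k. (\<lambda>t. structure_table (monogenic_table (l t 0) (l t 1) (l t 2)) $ k) \<in> function_algebra {\<lambda>t. t})"
    by (intro exI[of _ ?l]) blast
qed

text \<open>The identity is not checked on the table. Splitting the cubic makes the table a member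
  of \<open>family_A07_monogenic\<close>, hence a point of an orbit closure, all of which is right
  alternative.\<close>

lemma right_alternative_generic:
  assumes "det (generic_frame p) \<noteq> 0" shows "right_alternative (generic_algebra p)"
proof -
  obtain a b c where "a + b + c = p 2" "- (a * b + b * c + c * a) = p 1" "a * b * c = p 0"
    by (rule cubic_roots)
  then have "monogenic_table (p 0) (p 1) (p 2) = family_A07_monogenic a b c"
    unfolding family_A07_monogenic_def by simp
  then have "classified (structure_table (monogenic_table (p 0) (p 1) (p 2)))"
    using classified_family_A07_monogenic by simp
  then have "right_alternative (structure_table (monogenic_table (p 0) (p 1) (p 2)))"
    unfolding classified_def using component_closure_right_alternative by blast
  then show ?thesis
    unfolding generic_algebra_def using right_alternative_GL_action assms by (simp add: invertible_det_nz)
qed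

lemma chain_of_length_9:
  "\<exists>Z. (\<forall>i\<le>9. closedin right_alternative_variety (Z i) \<and> irreducible_subset right_alternative_variety (Z i)) \<and>
    (\<forall>i<9. Z i \<subset> Z (Suc i))"
proof (intro exI conjI allI impI)
  let ?Z = "\<lambda>j. zariski closure_of chain_set j"
  fix j :: nat
  have "?Z j \<subseteq> {\<mu>. right_alternative \<mu>}"
    by (rule closure_of_minimal[OF _ closedin_right_alternative])
      (auto simp: chain_set_def right_alternative_generic)
  then show "closedin right_alternative_variety (?Z j)" "irreducible_subset right_alternative_variety (?Z j)"
    unfolding closedin_variety_iff irreducible_subset_variety
    using irreducible_subset_zariski_closure[OF chain_set_rationally_connected] by (auto simp flip: closedin_zariski)
  assume j: "j < 9"
  have "parameter_space j \<subseteq> parameter_space (Suc j)" by (auto simp: parameter_space_def)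
  then have "?Z j \<subseteq> ?Z (Suc j)" unfolding chain_set_def by (intro closure_of_mono) blast
  moreover have "?Z j \<noteq> ?Z (Suc j)"
  proof
    assume eq: "?Z j = ?Z (Suc j)"
    \<comment> \<open>Raising the newly released parameter by one makes the chain function 1. For
      \<open>j = 4\<close> or \<open>j = 8\<close> the parameter becomes 2, which keeps the frame
      invertible.\<close>
    let ?p = "base_parameter(j := base_parameter j + 1)"
    have "chain_function j \<mu> = 0" if mem: "\<mu> \<in> chain_set j" for \<mu>
    proof -
      obtain p where p: "\<mu> = generic_algebra p" "p \<in> parameter_space j" "det (generic_frame p) \<noteq> 0"
        using mem unfolding chain_set_def by blast
      have "p \<in> parameter_space 3" if "j < 3" using p(2) that by (simp add: parameter_space_def)
      then show ?thesis using chain_function_generic[OF p(3) j] p(1,2) by (simp add: parameter_space_def)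
    qed
    then have zero: "chain_function j \<mu> = 0" if "\<mu> \<in> ?Z j" for \<mu>
      using that chain_function_polynomial unfolding zariski_closure_iff by blast
    have "j \<in> {0, 1, 2, 3, 4, 5, 6, 7, 8}" using j by auto
    then have det: "det (generic_frame ?p) \<noteq> 0"
      by (auto simp: det_generic_frame base_parameter_def)
    have "?p \<in> parameter_space (Suc j)" by (simp add: parameter_space_def)
    then have "generic_algebra ?p \<in> chain_set (Suc j)" unfolding chain_set_def using det by blast
    then have "generic_algebra ?p \<in> ?Z j" unfolding eq using closure_of_subset[of "chain_set (Suc j)" zariski] by auto
    moreover have "?p \<in> parameter_space 3" if "j < 3" using that by (simp add: parameter_space_def)
    ultimately show False using zero chain_function_generic[OF det j] by simp
  qed
  ultimately show "?Z j \<subset> ?Z (Suc j)" by blast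
qed

lemma krull_dim_variety: "krull_dim right_alternative_variety = 9"
proof (rule antisym)
  show "krull_dim right_alternative_variety \<le> 9"
    unfolding krull_dim_def
  proof (rule Sup_least)
    fix x assume "x \<in> enat ` {n. \<exists>Z. (\<forall>i\<le>n. closedin right_alternative_variety (Z i) \<and>
        irreducible_subset right_alternative_variety (Z i)) \<and> (\<forall>i<n. Z i \<subset> Z (Suc i))}"
    then obtain n where "x = enat n" "n \<le> 9" using chain_length_le_9 by blast
    then show "x \<le> 9" by (simp add: numeral_eq_enat)
  qed
  show "9 \<le> krull_dim right_alternative_variety"
    unfolding krull_dim_def numeral_eq_enat by (rule Sup_upper, rule imageI, rule CollectI, rule chain_of_length_9)
qed

theorem theoremG1:
  shows "krull_dim right_alternative_variety = 9 \<and>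
    card (irreducible_components right_alternative_variety) = 9 \<and>
    irreducible_components right_alternative_variety =
      {zariski closure_of orbit A07, zariski closure_of orbit A17, zariski closure_of orbit A18,
       zariski closure_of orbit A19, zariski closure_of orbit A20, zariski closure_of orbit A23,
       zariski closure_of orbit A24, zariski closure_of orbit R09, zariski closure_of orbit R10} \<and>
    card ({\<mu>. rigid \<mu>} // {(\<mu>, \<nu>). alg_iso \<mu> \<nu>}) = 9"
proof (intro conjI)
  show "krull_dim right_alternative_variety = 9" by (rule krull_dim_variety)
  show "card (irreducible_components right_alternative_variety) = 9"
    unfolding irreducible_components_variety card_image[OF inj_component_closure] by (rule card_component)
  show "irreducible_components right_alternative_variety =
      {zariski closure_of orbit A07, zariski closure_of orbit A17, zariski closure_of orbit A18,
       zariski closure_of orbit A19, zariski closure_of orbit A20, zariski closure_of orbit A23,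
       zariski closure_of orbit A24, zariski closure_of orbit R09, zariski closure_of orbit R10}"
    unfolding irreducible_components_variety UNIV_component by simp
  show "card ({\<mu>. rigid \<mu>} // {(\<mu>, \<nu>). alg_iso \<mu> \<nu>}) = 9"
    unfolding rigid_classes card_image[OF inj_component_orbit] by (rule card_component)
qed

end
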